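(* Let $U_z=\{z:|z|<1\}$ and $U_w=\{w:|w|<1\}$. Let $f$ be a function of the class $\mathcal B$, with coefficients $a_1,a_2,a_3$ at the point $z=1$, and let $E$ be a set that is closed with respect to $U_w$, lies in the complement $U_w\setminus f(U_z)$, and is at a positive distance from the point $1$. Then $$-\frac16\operatorname{Re}S_f(1):=-\operatorname{Re}\Bigl(\frac{a_3}{a_1}-\frac{a_2^2}{a_1^2}\Bigr)\ \ge\ a_1^2\,\operatorname{relcap}E .$$ Equality holds for functions $f$ of class $\mathcal B$ mapping $U_z$ conformally and univalently onto the domain $U_w\setminus E$.
   Context: The class $\mathcal B$ consists of the functions $f$ holomorphic in the unit disk $U_z$ with $f(U_z)\subset U_w$ that have the asymptotic expansion $$f(z)=1+a_1(z-1)+a_2(z-1)^2+a_3(z-1)^3+\angle o((z-1)^3),$$ where $a_1>0$, $\operatorname{Re}(2a_2+a_1(1-a_1))=0$, and $\angle o((z-1)^3)$ denotes a quantity that is $o((z-1)^3)$ as $z\to1$ in every Stolz angle in $U_z$ with vertex at $z=1$. For such $f$ the boundary Schwarzian derivative at $1$ is $S_f(1)=6\bigl(a_3/a_1-a_2^2/a_1^2\bigr)$. For an open set $G\subset\overline{\mathbb C}$ and a finite point $z\in G$, $r(G,z)$ denotes the inner radius at $z$ of the connected component $G_z$ of $G$ containing $z$: $\log r(G,z)=\lim_{w\to z}\bigl(g_{G_z}(w,z)+\log|w-z|\bigr)$, $g_{G_z}$ being the Green function of $G_z$. With $U=\{|z|<1\}$, for a relatively closed set $E\subset U$ at positive distance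 from the point $1$, the relative capacity $\operatorname{relcap}E$ (with respect to $U$ at the point $1$) is the (existing and unique) real number defined by $$\frac{r(U\setminus E,z)}{r(U,z)}=1-2(\operatorname{relcap}E)\,|z-1|^2+o(|z-1|^2),\qquad z\to1,$$ where $z\to 1$ along arcs in $U$ perpendicular to the unit circle at $1$ (e.g. $z=x\in(0,1)$, $x\to1$). *)

theory Defs
  imports "HOL-Complex_Analysis.Complex_Analysis" "HOL-Library.Landau_Symbols"
begin

text \<open>
  \<open>C\<^sup>2\<close> on an open set with vanishing Laplacian; \<open>u1, u2\<close> are the first and \<open>u11, u12, u21, u22\<close>
  the second partial derivatives in the coordinates \<open>Re, Im\<close>.
\<close>

definition harmonic_on :: "(complex \<Rightarrow> real) \<Rightarrow> complex set \<Rightarrow> bool" where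
  "harmonic_on u G \<longleftrightarrow> open G \<and>
    (\<exists>u1 u2 u11 u12 u21 u22.
      (\<forall>z\<in>G. (u has_derivative (\<lambda>h. u1 z * Re h + u2 z * Im h)) (at z) \<and>
             (u1 has_derivative (\<lambda>h. u11 z * Re h + u12 z * Im h)) (at z) \<and>
             (u2 has_derivative (\<lambda>h. u21 z * Re h + u22 z * Im h)) (at z) \<and>
             u11 z + u22 z = 0) \<and>
      continuous_on G u11 \<and> continuous_on G u12 \<and> continuous_on G u21 \<and> continuous_on G u22)"

text \<open>
  The (generalized) Green function \<open>g\<^sub>G(w, z)\<close> of a plane domain \<open>G\<close> with pole \<open>z\<close>, as in
  Armitage--Gardiner, Doob and Helms: the logarithmic kernel
  \<open>- log |w - z|\<close> minus its greatest
  harmonic minorant on \<open>G\<close>.  No regularity of the boundary is assumed.  It is meant for domains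
  on which minorants exist, in particular for all bounded domains; its value at \<open>w = z\<close>
  (mathematically \<open>\<infinity>\<close>) is irrelevant.
\<close>

definition green :: "complex set \<Rightarrow> complex \<Rightarrow> complex \<Rightarrow> real" where
  "green G w z = - ln (cmod (w - z)) -
     (SUP h \<in> {h. harmonic_on h G \<and> (\<forall>v\<in>G - {z}. h v \<le> - ln (cmod (v - z)))}. h w)"

definition inner_radius :: "complex set \<Rightarrow> complex \<Rightarrow> real" where
  "inner_radius G z =
     exp (Lim (at z) (\<lambda>w. green (connected_component_set G z) w z + ln (cmod (w - z))))"

text \<open>
  Arcs in the unit disk ending at \<open>1\<close> whose tangent there is perpendicular to the unit circle,
  i.e.\ the direction of \<open>\<gamma> t - 1\<close> tends to \<open>-1\<close>.
\<close>

definition perpendicular_arc :: "(real \<Rightarrow> complex) \<Rightarrow> bool" where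
  "perpendicular_arc \<gamma> \<longleftrightarrow> arc \<gamma> \<and> pathfinish \<gamma> = 1 \<and> \<gamma> ` {0..<1} \<subseteq> ball 0 1 \<and>
     ((\<lambda>t. sgn (\<gamma> t - 1)) \<longlongrightarrow> -1) (at_left 1)"

definition relcap :: "complex set \<Rightarrow> real" where
  "relcap E = (THE c. \<forall>\<gamma>. perpendicular_arc \<gamma> \<longrightarrow>
     (\<lambda>t. inner_radius (ball 0 1 - E) (\<gamma> t) / inner_radius (ball 0 1) (\<gamma> t)
            - (1 - 2 * c * (cmod (\<gamma> t - 1))\<^sup>2))
       \<in> o[at_left 1](\<lambda>t. (cmod (\<gamma> t - 1))\<^sup>2))"

definition stolz_angle :: "real \<Rightarrow> complex set" where
  "stolz_angle \<alpha> = {z \<in> ball 0 1. \<bar>Arg (1 - z)\<bar> < \<alpha>}"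

definition class_B :: "(complex \<Rightarrow> complex) \<Rightarrow> real \<Rightarrow> complex \<Rightarrow> complex \<Rightarrow> bool" where
  "class_B f a1 a2 a3 \<longleftrightarrow>
     f holomorphic_on ball 0 1 \<and> f ` ball 0 1 \<subseteq> ball 0 1 \<and>
     a1 > 0 \<and> Re (2 * a2 + a1 * (1 - a1)) = 0 \<and>
     (\<forall>\<alpha>\<in>{0<..<pi / 2}.
        (\<lambda>z. f z - (1 + a1 * (z - 1) + a2 * (z - 1)\<^sup>2 + a3 * (z - 1) ^ 3))
          \<in> o[at 1 within stolz_angle \<alpha>](\<lambda>z. (z - 1) ^ 3))"

text \<open>\<open>S\<^sub>f(1)\<close> in terms of the coefficients of \<open>f\<close> at \<open>1\<close>, which \<open>f\<close> determines uniquely.\<close>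

definition boundary_schwarzian :: "real \<Rightarrow> complex \<Rightarrow> complex \<Rightarrow> complex" where
  "boundary_schwarzian a1 a2 a3 = 6 * (a3 / a1 - a2\<^sup>2 / (complex_of_real a1)\<^sup>2)"

end

theory Submission
  imports Defs "HOL-Real_Asymp.Real_Asymp"
begin

text \<open>
  Put \<open>G = U - E\<close>. Lindelof's principle for the Green function gives
  \<open>\<bar>f'(x)\<bar> (1 - x\<^sup>2) \<le> r(G, f(x))\<close>, with equality for conformal maps onto \<open>G\<close>. Divide by
  \<open>r(U, f(x)) = 1 - \<bar>f(x)\<bar>\<^sup>2\<close> and let \<open>x\<close> tend to \<open>1\<close> along the radius: the left side is
  \<open>1 + Re S\<^sub>f(1) (1 - x)\<^sup>2 / 3 + o((1 - x)\<^sup>2)\<close>, the right side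
  \<open>1 - 2 relcap E a\<^sub>1\<^sup>2 (1 - x)\<^sup>2 + o((1 - x)\<^sup>2)\<close>.

  That the relative capacity exists for every admissible \<open>E\<close> is the main work. The logarithm of
  \<open>r(U, z) / r(G, z)\<close> is the value at \<open>z\<close> of the greatest harmonic minorant in \<open>G\<close> of the Green
  function of \<open>U\<close> with pole \<open>z\<close>. Away from the point \<open>1\<close>, half of \<open>1 - \<bar>z\<bar>\<^sup>2\<close> times the Poisson
  kernel \<open>P\<close> at \<open>1\<close> approximates that Green function uniformly up to a factor \<open>1 \<plusminus> \<epsilon>\<close>. So the
  minorant is squeezed between multiples of a fixed harmonic function \<open>u\<close>, the greatest harmonic
  minorant of \<open>P\<close> and of a barrier vanishing at \<open>1\<close>. Schwarz reflection shows that \<open>u\<close> has a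
  derivative at \<open>1\<close>.
\<close>

section \<open>Harmonic functions as real parts\<close>

text \<open>\<open>poisson\<close> is harmonic on the whole disc, so by itself it would be its own
  greatest harmonic minorant. Its singularity at 1 has to be removed; the barrier
  \<open>4 / d\<^sup>2 * poisson (- w)\<close>, a multiple of the Poisson kernel at -1, vanishes on
  the circle near 1 and still dominates \<open>poisson\<close> outside the disc of radius
  \<open>d\<close> about 1. The set \<open>E\<close> may be very irregular, so harmonic functions on
  its complement need not have boundary values there. Hence nothing is ever compared along
  \<open>E\<close>: minorants are compared through their extremality, and the maximum principle for
  the two kernels is used only in a lens at 1 whose boundary avoids \<open>E\<close>. The function
  \<open>u\<close> does not depend on \<open>z\<close>, and both \<open>u z\<close> and
  \<open>1 - (cmod z)\<^sup>2\<close> are O(|z - 1|). Their product has the second order that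
  \<open>relcap\<close> demands, and one boundary derivative of \<open>u\<close> settles all curves
  that approach 1 perpendicularly, including the image of the radius under \<open>f\<close>.\<close>

lemma second_difference_mvt:
  fixes u :: "complex \<Rightarrow> real"
  assumes u: "\<And>z. z \<in> ball c r \<Longrightarrow> (u has_derivative D z) (at z)"
    and Da: "\<And>z. z \<in> ball c r \<Longrightarrow> ((\<lambda>z. D z a) has_derivative E z) (at z)"
    and ab: "cmod a = 1" "cmod b = 1" and h: "0 < h" "2 * h < r"
  shows "\<exists>p\<in>cball c (2 * h). 
    u (c + of_real h * a + of_real h * b) - u (c + of_real h * a) - u (c + of_real h * b) + u c = h\<^sup>2 * E p b"
proof -
  have line: "((\<lambda>x. v (w + of_real x * e)) has_real_derivative V (w + of_real x * e) e) (at x)"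
    if "(v has_derivative V (w + of_real x * e)) (at (w + of_real x * e))" for v V w x and e :: complex
  proof -
    have "((\<lambda>x. w + of_real x * e) has_derivative (\<lambda>t. of_real t * e)) (at x)"
      by (auto intro!: derivative_eq_intros)
    from has_derivative_compose[OF this that]
    have "((\<lambda>x. v (w + of_real x * e)) has_derivative (\<lambda>t. V (w + of_real x * e) (of_real t * e))) (at x)" .
    moreover have "V (w + of_real x * e) (of_real t * e) = V (w + of_real x * e) e * t" for t
      using linear_scale[OF has_derivative_linear[OF that], of t e] by (simp add: scaleR_conv_of_real)
    ultimately show ?thesis
      by (simp add: has_field_derivative_def)
  qed
  have near: "c + of_real x * a + of_real y * b \<in> ball c r \<and> c + of_real x * a + of_real y * b \<in> cball c (2 * h)"
    if "0 \<le> x" "x \<le> h" "0 \<le> y" "y \<le> h" for x y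
  proof -
    have "cmod (of_real x * a + of_real y * b) \<le> x + y"
      using norm_triangle_ineq[of "of_real x * a" "of_real y * b"] that ab by (simp add: norm_mult)
    moreover have "dist c (c + of_real x * a + of_real y * b) = cmod (of_real x * a + of_real y * b)"
      by (metis add.assoc dist_add_cancel dist_0_norm add.right_neutral)
    ultimately show ?thesis using that h by auto
  qed
  let ?\<phi> = "\<lambda>x. u (c + of_real h * b + of_real x * a) - u (c + of_real x * a)"
  have \<phi>': "(?\<phi> has_real_derivative D (c + of_real h * b + of_real x * a) a - D (c + of_real x * a) a) (at x)"
    if "0 \<le> x" "x \<le> h" for x
  proof (intro derivative_intros line u)
    show "c + of_real h * b + of_real x * a \<in> ball c r" 
      using near[of x h] that h by (simp add: algebra_simps)
    show "c + of_real x * a \<in> ball c r" 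
      using near[of x 0] that h by (simp add: algebra_simps)
  qed
  then obtain \<xi> where \<xi>: "0 < \<xi>" "\<xi> < h" 
    "?\<phi> h - ?\<phi> 0 = (h - 0) * (D (c + of_real h * b + of_real \<xi> * a) a - D (c + of_real \<xi> * a) a)"
    using MVT2[of 0 h ?\<phi> "\<lambda>x. D (c + of_real h * b + of_real x * a) a - D (c + of_real x * a) a", OF h(1) \<phi>'] by blast
  let ?\<psi> = "\<lambda>y. D (c + of_real \<xi> * a + of_real y * b) a"
  have \<psi>': "(?\<psi> has_real_derivative E (c + of_real \<xi> * a + of_real y * b) b) (at y)"
    if "0 \<le> y" "y \<le> h" for y
    by (rule line[where v="\<lambda>z. D z a"], rule Da) (use near[of \<xi> y] that \<xi> in auto)
  then obtain \<eta> where \<eta>: "0 < \<eta>" "\<eta> < h" 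
    "?\<psi> h - ?\<psi> 0 = (h - 0) * E (c + of_real \<xi> * a + of_real \<eta> * b) b"
    using MVT2[of 0 h ?\<psi> "\<lambda>y. E (c + of_real \<xi> * a + of_real y * b) b", OF h(1) \<psi>'] by blast
  show ?thesis
  proof (rule bexI)
    show "c + of_real \<xi> * a + of_real \<eta> * b \<in> cball c (2 * h)" using near \<xi> \<eta> by auto
    have "?\<phi> h - ?\<phi> 0 = h\<^sup>2 * E (c + of_real \<xi> * a + of_real \<eta> * b) b"
      using \<xi>(3) \<eta>(3) by (simp add: power2_eq_square algebra_simps)
    then show "u (c + of_real h * a + of_real h * b) - u (c + of_real h * a) - u (c + of_real h * b) + u c 
      = h\<^sup>2 * E (c + of_real \<xi> * a + of_real \<eta> * b) b" by (simp add: algebra_simps)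
  qed
qed

text \<open>\<open>harmonic_on\<close> does not assert that the mixed partials agree, but the
  Cauchy-Riemann equations below depend on it. The second difference is symmetric in the two
  directions, so the mean value theorem taken in either order expresses the same number; continuity
  of the mixed partials lets the intermediate points shrink to \<open>c\<close>.\<close>

lemma mixed_partials_eq:
  fixes u :: "complex \<Rightarrow> real"
  assumes G: "open G" "c \<in> G"
    and u: "\<And>z. z \<in> G \<Longrightarrow> (u has_derivative (\<lambda>h. u1 z * Re h + u2 z * Im h)) (at z)"
    and u1: "\<And>z. z \<in> G \<Longrightarrow> (u1 has_derivative (\<lambda>h. u11 z * Re h + u12 z * Im h)) (at z)"
    and u2: "\<And>z. z \<in> G \<Longrightarrow> (u2 has_derivative (\<lambda>h. u21 z * Re h + u22 z * Im h)) (at z)"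
    and cont: "continuous_on G u12" "continuous_on G u21"
  shows "u12 c = u21 c"
proof -
  obtain r where r: "r > 0" "ball c r \<subseteq> G" using G openE by blast
  define h :: "nat \<Rightarrow> real" where "h n = r / (3 * (real n + 1))" for n
  have h: "h n > 0" "2 * h n < r" for n
    using r add_pos_nonneg[of r "r * (real n * 3)"] by (auto simp: h_def field_simps)
  have h0: "h \<longlonglongrightarrow> 0" unfolding h_def by real_asymp
  have ub: "(u has_derivative (\<lambda>h. u1 z * Re h + u2 z * Im h)) (at z)" if "z \<in> ball c r" for z
    using u r that by blast
  have "\<exists>p q. p \<in> cball c (2 * h n) \<and> q \<in> cball c (2 * h n) \<and> u12 p = u21 q" for n
  proof -
    obtain p where p: "p \<in> cball c (2 * h n)"
      "u (c + of_real (h n) * 1 + of_real (h n) * \<i>) - u (c + of_real (h n) * 1) - u (c + of_real (h n) * \<i>) + u c = (h n)\<^sup>2 * u12 p"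
      using second_difference_mvt[of c r u "\<lambda>z h. u1 z * Re h + u2 z * Im h" 1 
          "\<lambda>z h. u11 z * Re h + u12 z * Im h" \<i> "h n", OF ub _ _ _ h] u1 r(2) by (simp add: subset_iff) (erule bexE, simp)
    obtain q where q: "q \<in> cball c (2 * h n)"
      "u (c + of_real (h n) * \<i> + of_real (h n) * 1) - u (c + of_real (h n) * \<i>) - u (c + of_real (h n) * 1) + u c = (h n)\<^sup>2 * u21 q"
      using second_difference_mvt[of c r u "\<lambda>z h. u1 z * Re h + u2 z * Im h" \<i> 
          "\<lambda>z h. u21 z * Re h + u22 z * Im h" 1 "h n", OF ub _ _ _ h] u2 r(2) by (simp add: subset_iff) (erule bexE, simp)
    have "(h n)\<^sup>2 * u12 p = (h n)\<^sup>2 * u21 q" using p(2) q(2) by (simp add: algebra_simps)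
    with h[of n] p q show ?thesis by auto
  qed
  then obtain p q where pq: "\<And>n. p n \<in> cball c (2 * h n)" "\<And>n. q n \<in> cball c (2 * h n)" "\<And>n. u12 (p n) = u21 (q n)"
    by metis
  have lim: "X \<longlonglongrightarrow> c" if "\<And>n. X n \<in> cball c (2 * h n)" for X
  proof (rule metric_tendsto_imp_tendsto[where a=0 and f="\<lambda>n. 2 * h n"])
    show "(\<lambda>n. 2 * h n) \<longlonglongrightarrow> 0" using tendsto_mult_right_zero[OF h0] by simp
    show "\<forall>\<^sub>F x in sequentially. dist (X x) c \<le> dist (2 * h x) 0"
      using that h by (auto simp: dist_commute less_imp_le)
  qed
  have "isCont u12 c" "isCont u21 c" using cont G continuous_on_eq_continuous_at by blast+
  then have "(\<lambda>n. u12 (p n)) \<longlonglongrightarrow> u12 c" "(\<lambda>n. u21 (q n)) \<longlonglongrightarrow> u21 c"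
    using lim pq isCont_tendsto_compose by blast+
  then show ?thesis using pq(3) LIMSEQ_unique by simp
qed

lemma has_derivative_Re_holomorphic:
  assumes "(F has_field_derivative D) (at z)"
  shows "((\<lambda>z. Re (F z)) has_derivative (\<lambda>h. Re D * Re h + (- Im D) * Im h)) (at z)"
proof -
  have "(F has_derivative (\<lambda>h. D * h)) (at z)" using assms by (simp add: has_field_derivative_def)
  from has_derivative_Re[OF this] show ?thesis by simp
qed

text \<open>The conjugate gradient \<open>Complex (u1 z) (- u2 z)\<close> is holomorphic: its
  Cauchy-Riemann equations are the Laplace equation and the symmetry of the mixed partials. A
  primitive of it has a real part with the same gradient as \<open>u\<close>.\<close>

lemma harmonic_on_convex_Re:
  assumes h: "harmonic_on u G" and S: "open S" "convex S" "S \<subseteq> G"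
  obtains F where "F holomorphic_on S" "\<And>z. z \<in> S \<Longrightarrow> u z = Re (F z)"
proof -
  from h obtain u1 u2 u11 u12 u21 u22 where G: "open G"
    and u: "\<And>z. z \<in> G \<Longrightarrow> (u has_derivative (\<lambda>h. u1 z * Re h + u2 z * Im h)) (at z)"
    and u1: "\<And>z. z \<in> G \<Longrightarrow> (u1 has_derivative (\<lambda>h. u11 z * Re h + u12 z * Im h)) (at z)"
    and u2: "\<And>z. z \<in> G \<Longrightarrow> (u2 has_derivative (\<lambda>h. u21 z * Re h + u22 z * Im h)) (at z)"
    and lap: "\<And>z. z \<in> G \<Longrightarrow> u11 z + u22 z = 0"
    and cont: "continuous_on G u12" "continuous_on G u21"
    unfolding harmonic_on_def by blast
  define g where "g = (\<lambda>z. Complex (u1 z) (- u2 z))"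
  have g: "(g has_field_derivative Complex (u11 z) (- u12 z)) (at z)" if "z \<in> G" for z
  proof -
    have sym: "u21 z = u12 z" using mixed_partials_eq[OF G that u u1 u2 cont] by simp
    have "((\<lambda>z. of_real (u1 z) - \<i> * of_real (u2 z)) has_derivative
        (\<lambda>h. of_real (u11 z * Re h + u12 z * Im h) - \<i> * of_real (u21 z * Re h + u22 z * Im h))) (at z)"
      by (intro derivative_intros u1 u2 that)
    moreover have "(\<lambda>z. of_real (u1 z) - \<i> * of_real (u2 z)) = g"
      by (auto simp: g_def complex_eq_iff)
    moreover have "of_real (u11 z * Re h + u12 z * Im h) - \<i> * of_real (u21 z * Re h + u22 z * Im h)
       = Complex (u11 z) (- u12 z) * h" for h
      using lap[OF that] sym by (simp add: complex_eq_iff add_eq_0_iff)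
    ultimately show ?thesis by (simp add: has_field_derivative_def)
  qed
  have "g holomorphic_on S"
    using g S by (meson field_differentiable_at_within field_differentiable_def holomorphic_onI subsetD)
  then obtain F where F: "\<And>z. z \<in> S \<Longrightarrow> (F has_field_derivative g z) (at z within S)"
    using holomorphic_convex_primitive'[OF S(2,1)] by blast
  have F': "(F has_field_derivative g z) (at z)" if "z \<in> S" for z
    using F[OF that] by (simp add: at_within_open[OF that S(1)])
  have "((\<lambda>z. u z - Re (F z)) has_derivative (\<lambda>h. 0)) (at z within S)" if "z \<in> S" for z
  proof -
    have "((\<lambda>z. u z - Re (F z)) has_derivative (\<lambda>h. (u1 z * Re h + u2 z * Im h) - (Re (g z) * Re h + (- Im (g z)) * Im h))) (at z)"
      using that S by (intro derivative_intros u has_derivative_Re_holomorphic F') auto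
    then show ?thesis by (simp add: g_def has_derivative_at_withinI)
  qed
  then obtain c where c: "\<And>z. z \<in> S \<Longrightarrow> u z - Re (F z) = c"
    using has_derivative_zero_constant[OF S(2), of "\<lambda>z. u z - Re (F z)"] by blast
  have "(\<lambda>z. F z + of_real c) holomorphic_on S"
    using F by (intro holomorphic_intros) (auto simp: holomorphic_on_def field_differentiable_def)
  moreover have "u z = Re (F z + of_real c)" if "z \<in> S" for z using c[OF that] by simp
  ultimately show thesis by (rule that)
qed

text \<open>Different local completions \<open>F z\<close> need not match, but their derivatives do,
  because each is determined by the real derivative of \<open>u\<close>. They glue to a global
  holomorphic \<open>g\<close>, and the partials of \<open>u\<close> up to order two are read off
  from \<open>g\<close> and \<open>deriv g\<close>.\<close>

lemma harmonic_onI_local: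
  assumes G: "open G"
    and loc: "\<And>z. z \<in> G \<Longrightarrow> \<exists>r>0. \<exists>F. F holomorphic_on ball z r \<and> (\<forall>w\<in>ball z r. u w = Re (F w))"
  shows "harmonic_on u G"
proof -
  have "\<exists>r F. r > 0 \<and> ball z r \<subseteq> G \<and> F holomorphic_on ball z r \<and> (\<forall>w\<in>ball z r. u w = Re (F w))" if z: "z \<in> G" for z
  proof -
    obtain r F where r: "r > 0" "F holomorphic_on ball z r" "\<forall>w\<in>ball z r. u w = Re (F w)" using loc[OF z] by blast
    obtain s where s: "s > 0" "ball z s \<subseteq> G" using G z openE by blast
    show ?thesis
      by (rule exI[of _ "min r s"], rule exI[of _ F]) (use r s in \<open>auto intro: holomorphic_on_subset\<close>)
  qed
  then obtain r F where r: "\<And>z. z \<in> G \<Longrightarrow> r z > 0" "\<And>z. z \<in> G \<Longrightarrow> ball z (r z) \<subseteq> G"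
    and F: "\<And>z. z \<in> G \<Longrightarrow> F z holomorphic_on ball z (r z)" 
    and uF: "\<And>z w. z \<in> G \<Longrightarrow> w \<in> ball z (r z) \<Longrightarrow> u w = Re (F z w)" by metis
  define g where "g z = deriv (F z) z" for z
  have FD: "(F z has_field_derivative deriv (F z) w) (at w)" if "z \<in> G" "w \<in> ball z (r z)" for z w
    using F[OF that(1)] that(2) holomorphic_derivI open_ball by blast
  have uD: "(u has_derivative (\<lambda>h. Re (deriv (F z) w) * Re h + (- Im (deriv (F z) w)) * Im h)) (at w)"
    if "z \<in> G" "w \<in> ball z (r z)" for z w
    by (rule has_derivative_transform_within_open[OF has_derivative_Re_holomorphic[OF FD[OF that]] open_ball that(2)])
      (use uF that in auto)
  have geq: "g w = deriv (F z) w" if "z \<in> G" "w \<in> ball z (r z)" for z w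
  proof -
    have w: "w \<in> G" using r that by blast
    have "(\<lambda>h. Re (deriv (F z) w) * Re h + (- Im (deriv (F z) w)) * Im h) = 
          (\<lambda>h. Re (deriv (F w) w) * Re h + (- Im (deriv (F w) w)) * Im h)"
      using has_derivative_unique[OF uD[OF that] uD[OF w]] r(1)[OF w] by simp
    from fun_cong[OF this, of 1] fun_cong[OF this, of \<i>] show ?thesis by (simp add: g_def complex_eq_iff)
  qed
  have "g holomorphic_on G"
  proof (rule holomorphic_onI)
    fix z assume z: "z \<in> G"
    have "deriv (F z) holomorphic_on ball z (r z)" using F[OF z] holomorphic_deriv open_ball by blast
    then have "g holomorphic_on ball z (r z)" using geq[OF z] holomorphic_cong by (metis (no_types, lifting))
    then have "g field_differentiable at z" 
      using r(1)[OF z] by (simp add: holomorphic_on_imp_differentiable_at)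
    then show "g field_differentiable at z within G" by (rule field_differentiable_at_within)
  qed
  then have gD: "(g has_field_derivative deriv g z) (at z)" if "z \<in> G" for z
    using G that holomorphic_derivI by blast
  have g': "deriv g holomorphic_on G" using \<open>g holomorphic_on G\<close> G holomorphic_deriv by blast
  then have cg: "continuous_on G (deriv g)" by (rule holomorphic_on_imp_continuous_on)
  have imD: "((\<lambda>z. - Im (g z)) has_derivative (\<lambda>h. (- Im (deriv g z)) * Re h + (- Re (deriv g z)) * Im h)) (at z)"
    if "z \<in> G" for z
  proof -
    have "(g has_derivative (\<lambda>h. deriv g z * h)) (at z)" using gD[OF that] by (simp add: has_field_derivative_def)
    from has_derivative_minus[OF has_derivative_Im[OF this]] show ?thesis by (simp add: algebra_simps)
  qed
  show ?thesis unfolding harmonic_on_def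
  proof (intro conjI G exI ballI)
    fix z assume z: "z \<in> G"
    show "(u has_derivative (\<lambda>h. Re (g z) * Re h + (- Im (g z)) * Im h)) (at z)"
      using uD[OF z] r(1)[OF z] by (simp add: g_def)
    show "((\<lambda>z. Re (g z)) has_derivative (\<lambda>h. Re (deriv g z) * Re h + (- Im (deriv g z)) * Im h)) (at z)"
      by (rule has_derivative_Re_holomorphic[OF gD[OF z]])
    show "((\<lambda>z. - Im (g z)) has_derivative (\<lambda>h. (- Im (deriv g z)) * Re h + (- Re (deriv g z)) * Im h)) (at z)"
      by (rule imD[OF z])
    show "Re (deriv g z) + - Re (deriv g z) = 0" by simp
  qed (intro continuous_intros cg)+
qed

section \<open>Closure properties of harmonic functions\<close>

lemma harmonic_on_open: "harmonic_on u G \<Longrightarrow> open G"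
  by (simp add: harmonic_on_def)

lemma harmonic_on_ball_Re:
  assumes "harmonic_on u G" "ball a r \<subseteq> G"
  obtains F where "F holomorphic_on ball a r" "\<And>z. z \<in> ball a r \<Longrightarrow> u z = Re (F z)"
  by (rule harmonic_on_convex_Re[OF assms(1) open_ball convex_ball assms(2)]) (rule that)

lemma harmonic_on_Re:
  assumes "open G" "F holomorphic_on G" "\<And>z. z \<in> G \<Longrightarrow> u z = Re (F z)"
  shows "harmonic_on u G"
proof (rule harmonic_onI_local[OF assms(1)])
  fix z assume "z \<in> G"
  then obtain r where "r > 0" "ball z r \<subseteq> G" using assms(1) openE by blast
  then show "\<exists>r>0. \<exists>F. F holomorphic_on ball z r \<and> (\<forall>w\<in>ball z r. u w = Re (F w))"
    using holomorphic_on_subset[OF assms(2)] assms(3) by blast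
qed

lemma harmonic_on_local_Re:
  assumes "harmonic_on u G" "z \<in> G"
  obtains r F where "r > 0" "ball z r \<subseteq> G" "F holomorphic_on ball z r" "\<And>w. w \<in> ball z r \<Longrightarrow> u w = Re (F w)"
proof -
  obtain r where r: "r > 0" "ball z r \<subseteq> G" using assms harmonic_on_open openE by blast
  from harmonic_on_ball_Re[OF assms(1) r(2)] obtain F 
    where "F holomorphic_on ball z r" "\<And>w. w \<in> ball z r \<Longrightarrow> u w = Re (F w)" by metis
  with r show thesis by (rule that)
qed

lemma harmonic_on_cong_subset:
  assumes u: "harmonic_on u G" and H: "open H" "H \<subseteq> G" and uv: "\<And>z. z \<in> H \<Longrightarrow> u z = v z"
  shows "harmonic_on v H"
proof (rule harmonic_onI_local[OF H(1)])
  fix z assume "z \<in> H"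
  then obtain r where r: "r > 0" "ball z r \<subseteq> H" using H openE by blast
  with H have "ball z r \<subseteq> G" by blast
  from harmonic_on_ball_Re[OF u this] obtain F 
    where "F holomorphic_on ball z r" "\<And>w. w \<in> ball z r \<Longrightarrow> u w = Re (F w)" by metis
  then show "\<exists>r>0. \<exists>F. F holomorphic_on ball z r \<and> (\<forall>w\<in>ball z r. v w = Re (F w))" 
    using r uv by (intro exI[of _ r] conjI exI[of _ F]) (auto simp: subset_iff)
qed

lemma harmonic_on_subset: "harmonic_on u G \<Longrightarrow> open H \<Longrightarrow> H \<subseteq> G \<Longrightarrow> harmonic_on u H"
  by (rule harmonic_on_cong_subset) auto

lemma harmonic_on_cong: "harmonic_on u G \<Longrightarrow> (\<And>z. z \<in> G \<Longrightarrow> u z = v z) \<Longrightarrow> harmonic_on v G"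
  using harmonic_on_cong_subset harmonic_on_open by blast

lemma harmonic_on_linear:
  assumes "harmonic_on u G" "harmonic_on v G"
  shows "harmonic_on (\<lambda>z. a * u z + b * v z) G"
proof (rule harmonic_onI_local)
  show G: "open G" using assms harmonic_on_open by blast
  fix z assume "z \<in> G"
  then obtain r where r: "r > 0" "ball z r \<subseteq> G" using G openE by blast
  obtain F where F: "F holomorphic_on ball z r" "\<And>w. w \<in> ball z r \<Longrightarrow> u w = Re (F w)"
    using harmonic_on_ball_Re[OF assms(1) r(2)] by blast
  obtain H where H: "H holomorphic_on ball z r" "\<And>w. w \<in> ball z r \<Longrightarrow> v w = Re (H w)"
    using harmonic_on_ball_Re[OF assms(2) r(2)] by blast
  have "(\<lambda>w. of_real a * F w + of_real b * H w) holomorphic_on ball z r" using F H by (intro holomorphic_intros)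
  then show "\<exists>r>0. \<exists>F. F holomorphic_on ball z r \<and> (\<forall>w\<in>ball z r. a * u w + b * v w = Re (F w))"
    using r F H by (intro exI[of _ r] conjI exI[of _ "\<lambda>w. of_real a * F w + of_real b * H w"]) auto
qed

lemma harmonic_on_const: "open G \<Longrightarrow> harmonic_on (\<lambda>z. c) G"
  by (rule harmonic_on_Re[where F="\<lambda>z. of_real c"]) auto

lemma harmonic_on_diff: "harmonic_on u G \<Longrightarrow> harmonic_on v G \<Longrightarrow> harmonic_on (\<lambda>z. u z - v z) G"
  using harmonic_on_linear[of u G v 1 "-1"] by simp

lemma harmonic_on_add: "harmonic_on u G \<Longrightarrow> harmonic_on v G \<Longrightarrow> harmonic_on (\<lambda>z. u z + v z) G"
  using harmonic_on_linear[of u G v 1 1] by simp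

lemma harmonic_on_cmult: "harmonic_on u G \<Longrightarrow> harmonic_on (\<lambda>z. c * u z) G"
  using harmonic_on_linear[of u G u c 0] by simp

lemma harmonic_on_compose:
  assumes u: "harmonic_on u G" and f: "f holomorphic_on A" "open A" "f ` A \<subseteq> G"
  shows "harmonic_on (\<lambda>z. u (f z)) A"
proof (rule harmonic_onI_local[OF f(2)])
  fix z assume z: "z \<in> A"
  then have "f z \<in> G" using f by blast
  from harmonic_on_local_Re[OF u this] obtain r F 
    where r: "r > 0" "F holomorphic_on ball (f z) r" "\<And>w. w \<in> ball (f z) r \<Longrightarrow> u w = Re (F w)"
    by metis
  have "open (A \<inter> f -` ball (f z) r)"
    using continuous_on_open_vimage[OF f(2), of f] holomorphic_on_imp_continuous_on[OF f(1)] by (auto simp: Int_commute)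
  moreover have "z \<in> A \<inter> f -` ball (f z) r" using z r by simp
  ultimately obtain s where s: "s > 0" "ball z s \<subseteq> A \<inter> f -` ball (f z) r" using openE by blast
  have "(F \<circ> f) holomorphic_on ball z s"
    by (rule holomorphic_on_compose_gen[OF holomorphic_on_subset[OF f(1)] r(2)]) (use s in auto)
  then show "\<exists>r>0. \<exists>F. F holomorphic_on ball z r \<and> (\<forall>w\<in>ball z r. u (f w) = Re (F w))"
    using s r(3) by (intro exI[of _ s] conjI exI[of _ "F \<circ> f"]) auto
qed

lemma harmonic_on_continuous: "harmonic_on u G \<Longrightarrow> continuous_on G u"
  unfolding harmonic_on_def using has_derivative_continuous continuous_at_imp_continuous_on by blast

section \<open>Maximum principle and Harnack estimates\<close>

text \<open>The exponential of a holomorphic completion has modulus \<open>exp h\<close>, so the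
  maximum modulus principle applies to it.\<close>

lemma harmonic_on_max_locally_constant:
  assumes h: "harmonic_on h G" and z: "z \<in> G" and max: "\<And>w. w \<in> G \<Longrightarrow> h w \<le> h z"
  shows "\<exists>r>0. ball z r \<subseteq> G \<and> (\<forall>w\<in>ball z r. h w = h z)"
proof -
  from harmonic_on_local_Re[OF h z] obtain r F
    where r: "r > 0" "ball z r \<subseteq> G" "F holomorphic_on ball z r" "\<And>w. w \<in> ball z r \<Longrightarrow> h w = Re (F w)"
    by metis
  have "(\<lambda>w. exp (F w)) constant_on ball z r"
  proof (rule maximum_modulus_principle[where S="ball z r" and U="ball z r" and \<xi>=z])
    show "(\<lambda>w. exp (F w)) holomorphic_on ball z r" by (intro holomorphic_intros r)
    show "cmod (exp (F w)) \<le> cmod (exp (F z))" if "w \<in> ball z r" for w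
      using max[of w] r(2) r(4)[OF that] r(4)[of z] r(1) that by auto
  qed (use r in auto)
  then obtain c where c: "exp (F w) = c" if "w \<in> ball z r" for w by (auto simp: constant_on_def)
  have "h w = h z" if "w \<in> ball z r" for w
  proof -
    have "exp (Re (F w)) = exp (Re (F z))"
      using c[OF that] c[of z] r(1) by (metis norm_exp_eq_Re centre_in_ball)
    then show ?thesis using r(4)[OF that] r(4)[of z] r(1) by simp
  qed
  with r show ?thesis by blast
qed

text \<open>The frontier condition is a one-sided upper limit, so \<open>h\<close> may tend to minus
  infinity at frontier points, as happens later at a deleted pole. The condition makes the
  superlevel set \<open>K\<close> compact, and the set \<open>M\<close> of maximum points would then
  be nonempty, bounded and clopen in the plane.\<close>

lemma harmonic_on_maximum_principle:
  assumes h: "harmonic_on h G" and bd: "bounded G"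
    and lim: "\<And>\<xi> e. \<xi> \<in> frontier G \<Longrightarrow> e > 0 \<Longrightarrow> \<forall>\<^sub>F w in at \<xi> within G. h w \<le> e"
    and z: "z \<in> G"
  shows "h z \<le> 0"
proof (rule ccontr)
  assume "\<not> h z \<le> 0"
  then have pos: "h z > 0" by simp
  have G: "open G" using h harmonic_on_open by blast
  have cont: "continuous_on G h" using h harmonic_on_continuous by blast
  define K where "K = {w \<in> G. h w \<ge> h z}"
  have "closed K" unfolding closed_limpt
  proof (intro allI impI)
    fix l assume l: "l islimpt K"
    have lG: "l islimpt G" using l islimpt_subset[of l K G] by (auto simp: K_def)
    show "l \<in> K"
    proof (cases "l \<in> G")
      case False
      then have "l \<in> frontier G" using lG G by (simp add: frontier_def closure_def interior_open)
      from lim[OF this, of "h z / 2"] pos obtain d where d: "d > 0" 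
        "\<And>w. w \<in> G \<Longrightarrow> w \<noteq> l \<Longrightarrow> dist w l < d \<Longrightarrow> h w \<le> h z / 2"
        by (auto simp: eventually_at)
      obtain w where "w \<in> K" "w \<noteq> l" "dist w l < d" using l d(1) by (auto simp: islimpt_approachable)
      then show ?thesis using d(2)[of w] pos by (auto simp: K_def)
    next
      case True
      have "(h \<longlongrightarrow> h l) (at l within K)"
        using cont True by (auto simp: continuous_on_def K_def intro: tendsto_within_subset)
      moreover have "\<forall>\<^sub>F w in at l within K. h z \<le> h w"
        by (auto simp: eventually_at_filter K_def)
      ultimately have "h z \<le> h l"
        using l tendsto_lowerbound trivial_limit_within by blast
      then show ?thesis using True by (simp add: K_def)
    qed
  qed
  moreover have "bounded K" using bd by (rule bounded_subset) (auto simp: K_def)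
  ultimately have K: "compact K" by (simp add: compact_eq_bounded_closed)
  have contK: "continuous_on K h" using cont by (rule continuous_on_subset) (auto simp: K_def)
  have "z \<in> K" using z by (simp add: K_def)
  then obtain w0 where w0: "w0 \<in> K" "\<And>w. w \<in> K \<Longrightarrow> h w \<le> h w0"
    using continuous_attains_sup[OF K _ contK] by blast
  have max: "h w \<le> h w0" if "w \<in> G" for w
    using w0(2)[of w] w0(2)[OF \<open>z \<in> K\<close>] that by (cases "w \<in> K") (auto simp: K_def)
  define M where "M = {w \<in> K. h w = h w0}"
  have "closed M" unfolding M_def
    using continuous_closed_preimage_constant[OF contK \<open>closed K\<close>] .
  moreover have "open M"
  proof (rule openI)
    fix w assume w: "w \<in> M"
    then have "w \<in> G" "h w = h w0" by (auto simp: M_def K_def)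
    then obtain r where "r > 0" "ball w r \<subseteq> G" "\<forall>v\<in>ball w r. h v = h w"
      using harmonic_on_max_locally_constant[OF h, of w] max by auto
    then have "ball w r \<subseteq> M" using w \<open>h w = h w0\<close> by (auto simp: M_def K_def)
    with \<open>r > 0\<close> show "\<exists>e>0. ball w e \<subseteq> M" by blast
  qed
  ultimately have "M = {} \<or> M = UNIV" using clopen by blast
  moreover have "w0 \<in> M" using w0(1) by (simp add: M_def)
  moreover have "bounded M" using \<open>bounded K\<close> by (rule bounded_subset) (auto simp: M_def)
  ultimately show False using not_bounded_UNIV by auto
qed

lemma harmonic_on_maximum_principle_closure:
  assumes h: "harmonic_on h G" and bd: "bounded G" and cont: "continuous_on (closure G) g"
    and hg: "\<And>z. z \<in> G \<Longrightarrow> h z = g z" and le: "\<And>\<xi>. \<xi> \<in> frontier G \<Longrightarrow> g \<xi> \<le> 0" and z: "z \<in> G"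
  shows "h z \<le> 0"
proof (rule harmonic_on_maximum_principle[OF h bd _ z])
  fix \<xi> e assume \<xi>: "\<xi> \<in> frontier G" and e: "(e::real) > 0"
  have "(g \<longlongrightarrow> g \<xi>) (at \<xi> within closure G)" using cont \<xi> by (auto simp: continuous_on_def frontier_def)
  then have "(g \<longlongrightarrow> g \<xi>) (at \<xi> within G)" by (rule tendsto_within_subset) (rule closure_subset)
  then have "\<forall>\<^sub>F w in at \<xi> within G. g w < e" by (rule order_tendstoD(2)) (use le[OF \<xi>] e in linarith)
  moreover have "\<forall>\<^sub>F w in at \<xi> within G. w \<in> G" by (auto simp: eventually_at_filter)
  ultimately show "\<forall>\<^sub>F w in at \<xi> within G. h w \<le> e" by eventually_elim (use hg in auto)
qed

text \<open>The map from w to (w - F a) / (w + cnj (F a)) carries the right half-plane into the unit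
  disc and \<open>F a\<close> to 0. The Schwarz lemma bounds it by the relative distance to the
  centre, and the estimate is solved for \<open>F z - F a\<close>. This one bound supplies the
  Harnack inequality, the derivative bound and the convergence argument below.\<close>

lemma Re_pos_Schwarz_ball:
  assumes F: "F holomorphic_on ball a r" and pos: "\<And>z. z \<in> ball a r \<Longrightarrow> Re (F z) > 0" 
    and r: "r > 0" and z: "z \<in> ball a r"
  shows "cmod (F z - F a) \<le> 2 * (dist a z / r) / (1 - dist a z / r) * Re (F a)"
proof -
  define \<rho> where "\<rho> = dist a z / r"
  have \<rho>: "0 \<le> \<rho>" "\<rho> < 1" using r z by (auto simp: \<rho>_def)
  have inball: "a + of_real r * \<zeta> \<in> ball a r" if "cmod \<zeta> < 1" for \<zeta>
    using that r by (simp add: dist_norm norm_mult)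
  define \<phi> where "\<phi> \<zeta> = (F (a + of_real r * \<zeta>) - F a) / (F (a + of_real r * \<zeta>) + cnj (F a))" for \<zeta>
  have Fa: "Re (F a) > 0" using pos r by simp
  have den: "F w + cnj (F a) \<noteq> 0" if "w \<in> ball a r" for w
    using pos[OF that] Fa by (auto simp: complex_eq_iff)
  have holF: "(\<lambda>\<zeta>. F (a + of_real r * \<zeta>)) holomorphic_on ball 0 1"
    by (rule holomorphic_on_compose_gen[of _ _ F "ball a r", unfolded o_def])
      (use inball F in \<open>auto intro!: holomorphic_intros\<close>)
  have lt: "cmod (w - F a) < cmod (w + cnj (F a))" if "Re w > 0" for w
  proof -
    have "(cmod (w - F a))\<^sup>2 + 4 * (Re w * Re (F a)) = (cmod (w + cnj (F a)))\<^sup>2"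
      unfolding cmod_power2 by (simp add: power2_eq_square algebra_simps)
    moreover have "Re w * Re (F a) > 0" using that Fa by simp
    ultimately have "(cmod (w - F a))\<^sup>2 < (cmod (w + cnj (F a)))\<^sup>2" by linarith
    then show ?thesis using power2_less_imp_less norm_ge_zero by blast
  qed
  have "cmod (\<phi> \<zeta>) \<le> cmod \<zeta>" if "cmod \<zeta> < 1" for \<zeta>
  proof (rule Schwarz_Lemma(1))
    show "\<phi> holomorphic_on ball 0 1" unfolding \<phi>_def
      by (intro holomorphic_intros holF) (use den inball in auto)
    show "\<phi> 0 = 0" by (simp add: \<phi>_def)
    show "cmod (\<phi> z) < 1" if "cmod z < 1" for z
      using lt[OF pos[OF inball[OF that]]] by (simp add: \<phi>_def norm_divide divide_less_eq)
  qed fact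
  moreover define \<zeta> where "\<zeta> = (z - a) / of_real r"
  moreover have "cmod \<zeta> = \<rho>" using r by (simp add: \<zeta>_def \<rho>_def norm_divide dist_norm norm_minus_commute)
  moreover have "a + of_real r * \<zeta> = z" using r by (simp add: \<zeta>_def)
  ultimately have "cmod ((F z - F a) / (F z + cnj (F a))) \<le> \<rho>"
    using \<rho> unfolding \<phi>_def by metis
  then have "cmod (F z - F a) \<le> \<rho> * cmod (F z + cnj (F a))"
    using den[OF z] by (simp add: norm_divide divide_le_eq)
  also have "cmod (F z + cnj (F a)) = cmod ((F z - F a) + of_real (2 * Re (F a)))" by (rule arg_cong[of _ _ cmod]) (simp add: complex_eq_iff)
  also have "\<rho> * \<dots> \<le> \<rho> * (cmod (F z - F a) + 2 * Re (F a))"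
    using \<rho>(1) mult_left_mono norm_triangle_ineq[of "F z - F a" "of_real (2 * Re (F a))"] Fa 
    unfolding norm_of_real by (metis abs_of_pos mult_pos_pos zero_less_numeral)
  finally have "(1 - \<rho>) * cmod (F z - F a) \<le> 2 * \<rho> * Re (F a)"
    using \<rho> by (simp add: algebra_simps)
  then show ?thesis unfolding \<rho>_def[symmetric] using \<rho> by (simp add: field_simps)
qed

text \<open>Adding a positive constant \<open>e\<close> makes the real part strictly positive; then
  \<open>e\<close> tends to 0.\<close>

lemma Re_nonneg_Schwarz_ball:
  assumes F: "F holomorphic_on ball a r" and pos: "\<And>z. z \<in> ball a r \<Longrightarrow> Re (F z) \<ge> 0" 
    and z: "z \<in> ball a r"
  shows "cmod (F z - F a) \<le> 2 * (dist a z / r) / (1 - dist a z / r) * Re (F a)"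
proof (rule tendsto_lowerbound)
  have r: "r > 0" using z zero_le_dist[of a z] unfolding mem_ball by linarith
  show "((\<lambda>e. 2 * (dist a z / r) / (1 - dist a z / r) * (Re (F a) + e)) 
    \<longlongrightarrow> 2 * (dist a z / r) / (1 - dist a z / r) * Re (F a)) (at_right 0)"
    using tendsto_mult[OF tendsto_const tendsto_add[OF tendsto_const tendsto_ident_at[of 0 "{0<..}"]],
        of "2 * (dist a z / r) / (1 - dist a z / r)" "Re (F a)"] by simp
  show "\<forall>\<^sub>F e in at_right 0. cmod (F z - F a) \<le> 2 * (dist a z / r) / (1 - dist a z / r) * (Re (F a) + e)"
    using eventually_at_right_less
  proof eventually_elim
    case (elim e)
    have "cmod ((F z + of_real e) - (F a + of_real e)) \<le> 2 * (dist a z / r) / (1 - dist a z / r) * Re (F a + of_real e)"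
      by (rule Re_pos_Schwarz_ball[OF _ _ r z]) (use elim pos in \<open>auto intro!: holomorphic_intros F add_nonneg_pos\<close>)
    then show ?case by simp
  qed
qed simp

text \<open>Divide the previous bound by the distance to the centre and let the point approach it.
  This is the gradient estimate behind the Lipschitz bound in
  \<open>harmonic_boundary_derivative\<close>.\<close>

lemma Re_nonneg_deriv_bound:
  assumes F: "F holomorphic_on ball a r" and pos: "\<And>z. z \<in> ball a r \<Longrightarrow> Re (F z) \<ge> 0" and r: "r > 0"
  shows "cmod (deriv F a) \<le> 2 / r * Re (F a)"
proof (rule tendsto_le)
  have "(F has_field_derivative deriv F a) (at a)" using F r holomorphic_derivI by auto
  then show "((\<lambda>z. cmod ((F z - F a) / (z - a))) \<longlongrightarrow> cmod (deriv F a)) (at a)"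
    by (intro tendsto_norm) (simp add: has_field_derivative_iff)
  show "((\<lambda>z. 2 / r / (1 - dist a z / r) * Re (F a)) \<longlongrightarrow> 2 / r * Re (F a)) (at a)"
  proof -
    have "((\<lambda>z. 2 / r / (1 - dist a z / r) * Re (F a)) \<longlongrightarrow> 2 / r / (1 - dist a a / r) * Re (F a)) (at a)"
      using r by (intro tendsto_intros) auto
    then show ?thesis by simp
  qed
  have "\<forall>\<^sub>F z in at a. z \<in> ball a r" using r by (intro eventually_at_in_open') auto
  moreover have "\<forall>\<^sub>F z in at a. z \<noteq> a" by (simp add: eventually_neq_at_within)
  ultimately show "\<forall>\<^sub>F z in at a. cmod ((F z - F a) / (z - a)) \<le> 2 / r / (1 - dist a z / r) * Re (F a)"
  proof eventually_elim
    case (elim z)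
    have "cmod (F z - F a) \<le> 2 * (dist a z / r) / (1 - dist a z / r) * Re (F a)"
      using Re_nonneg_Schwarz_ball[OF F pos elim(1)] by blast
    then have "cmod (F z - F a) / dist a z \<le> 2 * (dist a z / r) / (1 - dist a z / r) * Re (F a) / dist a z"
      by (rule divide_right_mono) simp
    then show ?case using elim by (simp add: norm_divide dist_norm norm_minus_commute)
  qed
qed simp

lemma harmonic_on_Harnack:
  assumes h: "harmonic_on h G" "ball a r \<subseteq> G" and pos: "\<And>z. z \<in> ball a r \<Longrightarrow> h z \<ge> 0" 
    and z: "z \<in> ball a r"
  shows "\<bar>h z - h a\<bar> \<le> 2 * (dist a z / r) / (1 - dist a z / r) * h a"
proof -
  from harmonic_on_ball_Re[OF h] obtain F 
    where F: "F holomorphic_on ball a r" "\<And>z. z \<in> ball a r \<Longrightarrow> h z = Re (F z)" by metis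
  have a: "a \<in> ball a r" using z zero_le_dist[of a z] unfolding mem_ball dist_self by linarith
  have "\<bar>Re (F z - F a)\<bar> \<le> cmod (F z - F a)" by (rule abs_Re_le_cmod)
  also have "\<dots> \<le> 2 * (dist a z / r) / (1 - dist a z / r) * Re (F a)"
    by (rule Re_nonneg_Schwarz_ball[OF F(1) _ z]) (use F pos in fastforce)
  finally show ?thesis using F(2)[OF z] F(2)[OF a] by simp
qed

text \<open>Uniform convergence of the real parts forces locally uniform convergence of the
  holomorphic functions once the free imaginary constants are fixed at the centre: the Schwarz
  estimate controls a difference by its real part at the centre.\<close>

lemma uniform_limit_Re_holomorphic:
  assumes F: "\<And>n. F n holomorphic_on ball a r"
    and lim: "uniform_limit (ball a r) (\<lambda>n z. Re (F n z)) u sequentially"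
  shows "\<exists>H. H holomorphic_on ball a r \<and> (\<forall>z\<in>ball a r. u z = Re (H z))"
proof (cases "r > 0")
  case r: True
  define H where "H n z = F n z - \<i> * of_real (Im (F n a))" for n z
  define g where "g z = lim (\<lambda>n. H n z)" for z
  have unif: "uniform_limit (cball a s) H g sequentially" if s: "0 < s" "s < r" for s
  proof -
    define C where "C = 2 * (s / r) / (1 - s / r)"
    have C: "C \<ge> 0" using s by (auto simp: C_def)
    have "uniformly_Cauchy_on (cball a s) H" unfolding uniformly_Cauchy_on_def
    proof (intro allI impI)
      fix e :: real assume e: "e > 0"
      define \<eta> where "\<eta> = e / (8 * (C + 1))"
      have \<eta>: "\<eta> > 0" using e C by (simp add: \<eta>_def)
      have "\<forall>\<^sub>F n in sequentially. \<forall>z\<in>ball a r. dist (Re (F n z)) (u z) < \<eta>"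
        using lim \<eta> by (simp add: uniform_limit_iff)
      then obtain N where "\<forall>n\<ge>N. \<forall>z\<in>ball a r. dist (Re (F n z)) (u z) < \<eta>"
        unfolding eventually_sequentially by blast
      then have N: "\<And>n z. n \<ge> N \<Longrightarrow> z \<in> ball a r \<Longrightarrow> dist (Re (F n z)) (u z) < \<eta>"
        by blast
      have "dist (H m z) (H n z) < e" if z: "z \<in> cball a s" and mn: "m \<ge> N" "n \<ge> N" for z m n
      proof -
        have zr: "z \<in> ball a r" using z s by auto
        have near: "\<bar>Re (F m w) - Re (F n w)\<bar> < 2 * \<eta>" if "w \<in> ball a r" for w
          using N[OF mn(1) that] N[OF mn(2) that] by (auto simp: dist_real_def)
        \<comment> \<open>The real parts of \<open>F m\<close> and \<open>F n\<close> differ by less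
          than \<open>2 * \<eta>\<close>, so this shift makes the real part nonnegative and at most
          \<open>4 * \<eta>\<close> at the centre.\<close>
        define Q where "Q w = F m w - F n w + of_real (2 * \<eta>)" for w
        have "cmod (Q z - Q a) \<le> 2 * (dist a z / r) / (1 - dist a z / r) * Re (Q a)"
        proof (rule Re_nonneg_Schwarz_ball[OF _ _ zr])
          show "Q holomorphic_on ball a r" unfolding Q_def by (intro holomorphic_intros F)
          show "0 \<le> Re (Q w)" if "w \<in> ball a r" for w using near[OF that] by (simp add: Q_def)
        qed
        also have "\<dots> \<le> C * (4 * \<eta>)"
        proof (rule mult_mono)
          have "dist a z / r \<le> s / r" using z r by (simp add: divide_right_mono)
          then show "2 * (dist a z / r) / (1 - dist a z / r) \<le> C" unfolding C_def using s r
            by (intro frac_le) auto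
          show "Re (Q a) \<le> 4 * \<eta>" using near[of a] r by (simp add: Q_def)
          show "0 \<le> Re (Q a)" using near[of a] r by (simp add: Q_def)
        qed (use C in auto)
        finally have 1: "cmod (Q z - Q a) \<le> 4 * C * \<eta>" by simp
        have "H m z - H n z = (Q z - Q a) + of_real (Re (F m a) - Re (F n a))"
          by (simp add: H_def Q_def complex_eq_iff)
        then have "cmod (H m z - H n z) \<le> cmod (Q z - Q a) + \<bar>Re (F m a) - Re (F n a)\<bar>"
          using norm_triangle_ineq by (metis norm_of_real)
        also have "\<dots> < 4 * C * \<eta> + 2 * \<eta>" using 1 near[of a] r by simp
        also have "\<dots> \<le> 8 * (C + 1) * \<eta>" using C \<eta> by (simp add: algebra_simps)
        also have "\<dots> = e" using C by (simp add: \<eta>_def)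
        finally show ?thesis by (simp add: dist_norm)
      qed
      then show "\<exists>M. \<forall>x\<in>cball a s. \<forall>m\<ge>M. \<forall>n\<ge>M. dist (H m x) (H n x) < e" by blast
    qed
    then have "uniformly_convergent_on (cball a s) H" by (rule Cauchy_uniformly_convergent)
    then show ?thesis unfolding uniformly_convergent_uniform_limit_iff g_def .
  qed
  have "g holomorphic_on ball a r"
  proof (rule holomorphic_uniform_sequence[OF open_ball])
    show "H n holomorphic_on ball a r" for n unfolding H_def by (intro holomorphic_intros F)
    fix x assume x: "x \<in> ball a r"
    define d where "d = (r - dist a x) / 2"
    have d: "d > 0" "dist a x + d < r" "dist a x + d > 0"
      using x add_pos_nonneg[OF r zero_le_dist[of a x]] unfolding d_def mem_ball by (auto simp: field_simps)
    have sub: "cball x d \<subseteq> cball a (dist a x + d)"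
      by (auto) (metis add_left_mono dist_triangle_le dist_commute)
    show "\<exists>d>0. cball x d \<subseteq> ball a r \<and> uniform_limit (cball x d) H g sequentially"
      using d sub uniform_limit_on_subset[OF unif[OF d(3,2)] sub] by (intro exI[of _ d]) auto
  qed
  moreover have "u z = Re (g z)" if z: "z \<in> ball a r" for z
  proof -
    define s where "s = (r + dist a z) / 2"
    have s: "0 < s" "s < r" "z \<in> cball a s" using z add_pos_nonneg[OF r zero_le_dist[of a z]] unfolding s_def mem_ball by auto
    have "(\<lambda>n. H n z) \<longlonglongrightarrow> g z" using tendsto_uniform_limitI[OF unif[OF s(1,2)] s(3)] .
    then have "(\<lambda>n. Re (H n z)) \<longlonglongrightarrow> Re (g z)" by (rule tendsto_Re)
    then have "(\<lambda>n. Re (F n z)) \<longlonglongrightarrow> Re (g z)" by (simp add: H_def)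
    moreover have "(\<lambda>n. Re (F n z)) \<longlonglongrightarrow> u z" using tendsto_uniform_limitI[OF lim z] .
    ultimately show ?thesis using LIMSEQ_unique by blast
  qed
  ultimately show ?thesis by blast
next
  case False
  then have "ball a r = {}" by (simp add: ball_empty)
  then show ?thesis using holomorphic_on_empty[of "\<lambda>z. 0"] by (metis empty_iff)
qed

section \<open>The Dirichlet problem on discs and subharmonic functions\<close>

text \<open>On the circle the conjugate of \<open>z\<close> is its inverse, so a real polynomial is
  a trigonometric polynomial there, and negative powers can be conjugated away under the real part.
  This supplies explicit harmonic extensions for a dense set of boundary data.\<close>

lemma real_polynomial_function_circle_eq_Re_poly:
  fixes q :: "complex \<Rightarrow> real"
  assumes q: "real_polynomial_function q"
  shows "\<exists>p. \<forall>z\<in>sphere 0 1. q z = Re (poly p z)"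
proof -
  define T where "T = {\<psi>. \<exists>p. \<forall>z\<in>sphere 0 1. \<psi> z = Re (poly p z)}"
  have T_add: "(\<lambda>z. \<psi> z + \<theta> z) \<in> T" if \<psi>: "\<psi> \<in> T" and \<theta>: "\<theta> \<in> T" for \<psi> \<theta>
  proof -
    from \<psi> \<theta> obtain p p' where "\<forall>z\<in>sphere 0 1. \<psi> z = Re (poly p z)" "\<forall>z\<in>sphere 0 1. \<theta> z = Re (poly p' z)"
      by (auto simp: T_def)
    then have "\<forall>z\<in>sphere 0 1. \<psi> z + \<theta> z = Re (poly (p + p') z)" by simp
    then show ?thesis unfolding T_def by blast
  qed
  have T_const: "(\<lambda>z. c * \<psi> z) \<in> T" if "\<psi> \<in> T" for \<psi> c
  proof -
    from that obtain p where "\<forall>z\<in>sphere 0 1. \<psi> z = Re (poly p z)"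
      by (auto simp: T_def)
    then have "\<forall>z\<in>sphere 0 1. c * \<psi> z = Re (poly (smult (of_real c) p) z)" by simp
    then show ?thesis unfolding T_def by blast
  qed
  have T_linear: "(\<lambda>z. Re (c * z) * \<psi> z) \<in> T" if "\<psi> \<in> T" for \<psi> c
  proof -
    from that obtain p where p: "\<forall>z\<in>sphere 0 1. \<psi> z = Re (poly p z)"
      by (auto simp: T_def)
    obtain a p' where p': "p = pCons a p'" by (rule pCons_cases)
    \<comment> \<open>\<open>Re (c * z) * Re w\<close> is half of
      \<open>Re (c * z * w) + Re (w * cnj (c * z))\<close>. For
      \<open>w = a + z * poly p' z\<close>, the factor \<open>cnj z\<close> in the second term
      cancels the \<open>z\<close> in front of \<open>p'\<close>, and the product with the constant
      \<open>a\<close> is replaced by its conjugate.\<close>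
    have "Re (c * z) * \<psi> z = Re (poly (smult (1/2) (pCons 0 (smult c p) + [:0, cnj a * c:] + smult (cnj c) p')) z)"
      if z: "z \<in> sphere 0 1" for z
    proof -
      have zz: "z * cnj z = 1" using z by (simp add: complex_norm_square[symmetric])
      have 1: "Re (c * z) * Re w = (Re (c * z * w) + Re (w * cnj (c * z))) / 2" for w
        by (simp add: algebra_simps)
      have W: "poly p z = a + z * poly p' z" by (simp add: p')
      have 2: "(a + z * poly p' z) * cnj (c * z) = cnj (cnj a * c * z) + cnj c * poly p' z"
        using zz by (simp add: algebra_simps)
      have "Re (poly p z * cnj (c * z)) = Re (cnj a * c * z + cnj c * poly p' z)"
        unfolding W 2 by (simp only: plus_complex.simps cnj.simps)
      then have 3: "Re (c * z) * \<psi> z = (Re (c * z * poly p z) + Re (cnj a * c * z + cnj c * poly p' z)) / 2"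
        using p z 1[of "poly p z"] by simp
      have 4: "poly (smult (1/2) (pCons 0 (smult c p) + [:0, cnj a * c:] + smult (cnj c) p')) z
        = (c * z * poly p z + (cnj a * c * z + cnj c * poly p' z)) / 2"
        by (simp add: algebra_simps)
      show ?thesis unfolding 3 4 by (simp only: Re_divide_numeral plus_complex.simps)
    qed
    then show ?thesis unfolding T_def by blast
  qed
  \<comment> \<open>Induction on \<open>q\<close> for the multiplier algebra of \<open>T\<close>, which unlike \<open>T\<close> is visibly closed under products.\<close>
  from q have mult: "\<forall>\<psi>\<in>T. (\<lambda>z. q z * \<psi> z) \<in> T"
  proof induction
    case (linear f)
    have "f z = Re (Complex (f 1) (- f \<i>) * z)" for z
    proof -
      have "f z = f (Re z *\<^sub>R 1 + Im z *\<^sub>R \<i>)" by (rule arg_cong[of _ _ f]) (simp add: complex_eq_iff)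
      also have "\<dots> = Re z * f 1 + Im z * f \<i>"
        using linear by (simp only: linear_add[OF bounded_linear.linear] linear_scale[OF bounded_linear.linear] real_scaleR_def)
      finally show ?thesis by (simp add: algebra_simps)
    qed
    then show ?case using T_linear by (metis (no_types, lifting) ext)
  next
    case (const c)
    then show ?case using T_const by blast
  next
    case (add f g)
    then show ?case using T_add by (simp add: distrib_right)
  next
    case (mult f g)
    then show ?case by (simp add: mult.assoc)
  qed
  have one: "(\<lambda>z. 1) \<in> T" unfolding T_def by (rule CollectI, rule exI[of _ "1"]) simp
  from bspec[OF mult one] show ?thesis by (simp add: T_def)
qed

text \<open>Stone-Weierstrass approximates the boundary data uniformly by real parts of polynomials.
  The maximum principle turns this into uniform convergence on the closed disc, and the limit is
  harmonic by \<open>uniform_limit_Re_holomorphic\<close>.\<close>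

lemma Dirichlet_ball:
  fixes \<phi> :: "complex \<Rightarrow> real"
  assumes r: "r > 0" and \<phi>: "continuous_on (sphere a r) \<phi>"
  obtains v where "continuous_on (cball a r) v" "\<And>z. z \<in> sphere a r \<Longrightarrow> v z = \<phi> z" "harmonic_on v (ball a r)"
proof -
  have sph: "a + of_real r * \<zeta> \<in> sphere a r" if "\<zeta> \<in> sphere 0 1" for \<zeta>
    using that r by (simp add: dist_norm norm_mult)
  have cont: "continuous_on (sphere 0 1) (\<lambda>\<zeta>. \<phi> (a + of_real r * \<zeta>))"
    by (rule continuous_on_compose2[OF \<phi>]) (use sph in \<open>auto intro!: continuous_intros\<close>)
  have "\<exists>p. \<forall>z\<in>sphere a r. \<bar>\<phi> z - Re (poly p ((z - a) / of_real r))\<bar> < 1 / (real n + 1)" for n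
  proof -
    obtain q where q: "real_polynomial_function q" 
      "\<And>\<zeta>. \<zeta> \<in> sphere 0 1 \<Longrightarrow> \<bar>\<phi> (a + of_real r * \<zeta>) - q \<zeta>\<bar> < 1 / (real n + 1)"
      using Stone_Weierstrass_real_polynomial_function[OF _ cont, of "1 / (real n + 1)"] by auto
    from real_polynomial_function_circle_eq_Re_poly[OF q(1)] obtain p 
      where p: "\<And>z. z \<in> sphere 0 1 \<Longrightarrow> q z = Re (poly p z)" by blast
    have "\<bar>\<phi> z - Re (poly p ((z - a) / of_real r))\<bar> < 1 / (real n + 1)" if z: "z \<in> sphere a r" for z
    proof -
      have "(z - a) / of_real r \<in> sphere 0 1" using z r by (simp add: norm_divide dist_norm norm_minus_commute)
      from q(2)[OF this] p[OF this] r show ?thesis by simp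
    qed
    then show ?thesis by blast
  qed
  then obtain p where p: "\<And>n z. z \<in> sphere a r \<Longrightarrow> \<bar>\<phi> z - Re (poly (p n) ((z - a) / of_real r))\<bar> < 1 / (real n + 1)"
    by metis
  define F where "F n z = poly (p n) ((z - a) / of_real r)" for n z
  have F: "F n holomorphic_on S" for n S unfolding F_def using r by (intro holomorphic_intros) auto
  have le: "Re (F m z) - Re (F n z) \<le> 1 / (real m + 1) + 1 / (real n + 1)" if z: "z \<in> cball a r" for m n z
  proof -
    have "Re ((\<lambda>z. F m z - F n z) z) \<le> 1 / (real m + 1) + 1 / (real n + 1)"
    proof (rule maximum_real_frontier[where S="cball a r" and f="\<lambda>z. F m z - F n z" and \<xi>=z])
      show "continuous_on (closure (cball a r)) (\<lambda>z. F m z - F n z)"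
        by (intro holomorphic_on_imp_continuous_on holomorphic_intros F)
      fix z assume "z \<in> frontier (cball a r)"
      then have z: "z \<in> sphere a r" using r by simp
      show "Re (F m z - F n z) \<le> 1 / (real m + 1) + 1 / (real n + 1)"
        using p[OF z, of m] p[OF z, of n] unfolding F_def[symmetric] by (simp add: abs_less_iff)
    qed (use z in \<open>auto intro!: holomorphic_intros F\<close>)
    then show ?thesis by simp
  qed
  have small: "\<exists>N. \<forall>n\<ge>N. 1 / (real n + 1) < e" if e: "e > 0" for e
  proof -
    have "(\<lambda>n. 1 / (real n + 1)) \<longlonglongrightarrow> 0" by real_asymp
    from order_tendstoD(2)[OF this e] show ?thesis by (simp add: eventually_sequentially)
  qed
  have "uniformly_Cauchy_on (cball a r) (\<lambda>n z. Re (F n z))" unfolding uniformly_Cauchy_on_def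
  proof (intro allI impI)
    fix e :: real assume "e > 0"
    with small[of "e / 2"] obtain N where N: "\<And>n. n \<ge> N \<Longrightarrow> 1 / (real n + 1) < e / 2" by auto
    have "dist (Re (F m z)) (Re (F n z)) < e" if "z \<in> cball a r" "m \<ge> N" "n \<ge> N" for z m n
      using le[OF that(1), of m n] le[OF that(1), of n m] N[OF that(2)] N[OF that(3)] unfolding dist_real_def by argo
    then show "\<exists>M. \<forall>x\<in>cball a r. \<forall>m\<ge>M. \<forall>n\<ge>M. dist (Re (F m x)) (Re (F n x)) < e" by blast
  qed
  then obtain v where v: "uniform_limit (cball a r) (\<lambda>n z. Re (F n z)) v sequentially"
    using Cauchy_uniformly_convergent uniformly_convergent_on_def by blast
  show thesis
  proof (rule that[of v])
    show "continuous_on (cball a r) v"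
      by (rule uniform_limit_theorem[OF _ v])
        (auto intro!: always_eventually continuous_intros holomorphic_on_imp_continuous_on F)
    from uniform_limit_Re_holomorphic[OF F uniform_limit_on_subset[OF v ball_subset_cball]]
    show "harmonic_on v (ball a r)" using harmonic_on_Re[OF open_ball] by metis
    fix z assume z: "z \<in> sphere a r"
    then have "(\<lambda>n. Re (F n z)) \<longlonglongrightarrow> v z" by (intro tendsto_uniform_limitI[OF v]) auto
    moreover have "(\<lambda>n. Re (F n z)) \<longlonglongrightarrow> \<phi> z" 
    proof (rule LIMSEQ_I)
      fix e :: real assume "e > 0"
      from small[OF this] obtain N where N: "\<And>n. n \<ge> N \<Longrightarrow> 1 / (real n + 1) < e" by auto
      show "\<exists>no. \<forall>n\<ge>no. norm (Re (F n z) - \<phi> z) < e"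
        using p[OF z] N less_trans unfolding F_def[symmetric] real_norm_def by (metis abs_minus_commute)
    qed
    ultimately show "v z = \<phi> z" using LIMSEQ_unique by blast
  qed
qed

text \<open>Only continuous subharmonic functions occur. Domination by harmonic functions on closed
  discs, in place of a mean value inequality, makes closure under maxima immediate and matches the
  Dirichlet solutions used in \<open>Poisson_modification\<close>.\<close>

definition subharmonic_on :: "(complex \<Rightarrow> real) \<Rightarrow> complex set \<Rightarrow> bool" where
  "subharmonic_on s G \<longleftrightarrow> continuous_on G s \<and>
    (\<forall>a r h. r > 0 \<longrightarrow> cball a r \<subseteq> G \<longrightarrow> continuous_on (cball a r) h \<longrightarrow> harmonic_on h (ball a r) \<longrightarrow>
       (\<forall>z\<in>sphere a r. s z \<le> h z) \<longrightarrow> (\<forall>z\<in>ball a r. s z \<le> h z))"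

lemma subharmonic_onD:
  assumes "subharmonic_on s G" "r > 0" "cball a r \<subseteq> G" "continuous_on (cball a r) h" "harmonic_on h (ball a r)"
    and le: "\<And>z. z \<in> sphere a r \<Longrightarrow> s z \<le> h z" and z: "z \<in> cball a r"
  shows "s z \<le> h z"
proof (cases "z \<in> ball a r")
  case True
  have "\<forall>z\<in>sphere a r. s z \<le> h z" using le by blast
  with True assms(1-5) show ?thesis unfolding subharmonic_on_def by blast
next
  case False
  then show ?thesis using le[of z] z by simp
qed

lemma harmonic_imp_subharmonic_on:
  assumes h: "harmonic_on s G"
  shows "subharmonic_on s G"
  unfolding subharmonic_on_def
proof (intro conjI allI impI ballI harmonic_on_continuous[OF h])
  fix a r k z assume r: "(r::real) > 0" and sub: "cball a r \<subseteq> G" and cont: "continuous_on (cball a r) k"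
    and k: "harmonic_on k (ball a r)" and le: "\<forall>z\<in>sphere a r. s z \<le> k z" and z: "z \<in> ball a r"
  have s: "harmonic_on s (ball a r)" using sub by (intro harmonic_on_subset[OF h]) auto
  have "s z - k z \<le> 0"
  proof (rule harmonic_on_maximum_principle_closure[OF harmonic_on_diff[OF s k] bounded_ball _ refl _ z])
    show "continuous_on (closure (ball a r)) (\<lambda>z. s z - k z)"
      using r cont continuous_on_subset[OF harmonic_on_continuous[OF h] sub] by (auto intro!: continuous_intros)
    show "s \<xi> - k \<xi> \<le> 0" if "\<xi> \<in> frontier (ball a r)" for \<xi> using that r le by simp
  qed
  then show "s z \<le> k z" by simp
qed

lemma subharmonic_on_max:
  assumes "subharmonic_on s G" "subharmonic_on t G"
  shows "subharmonic_on (\<lambda>z. max (s z) (t z)) G"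
  using assms unfolding subharmonic_on_def by (auto intro!: continuous_intros)

text \<open>Inside the disc \<open>s\<close> is replaced by the Dirichlet solution with the same
  values on the circle. The last property keeps the modified function below every harmonic majorant
  of \<open>s\<close>, so the Perron family of \<open>greatest_harmonic_minorant\<close> is
  preserved.\<close>

lemma Poisson_modification:
  assumes s: "subharmonic_on s G" and r: "r > 0" and sub: "cball a r \<subseteq> G"
  obtains t where "subharmonic_on t G" "harmonic_on t (ball a r)" "\<And>z. z \<in> G \<Longrightarrow> s z \<le> t z"
    "\<And>p. harmonic_on p G \<Longrightarrow> (\<And>z. z \<in> G \<Longrightarrow> s z \<le> p z) \<Longrightarrow> (\<And>z. z \<in> G \<Longrightarrow> t z \<le> p z)"
proof -
  have conts: "continuous_on G s" using s by (simp add: subharmonic_on_def)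
  have "continuous_on (sphere a r) s" using conts by (rule continuous_on_subset) (use sub in auto)
  from Dirichlet_ball[OF r this] obtain v where contv: "continuous_on (cball a r) v" 
    and veq: "\<And>z. z \<in> sphere a r \<Longrightarrow> v z = s z" and harv: "harmonic_on v (ball a r)" by metis
  define t where "t z = (if z \<in> cball a r then v z else s z)" for z
  have t_out: "t z = s z" if "z \<notin> ball a r" for z using that veq[of z] by (auto simp: t_def)
  have t_in: "t z = v z" if "z \<in> cball a r" for z using that by (simp add: t_def)
  have st: "s z \<le> t z" if "z \<in> G" for z
  proof (cases "z \<in> cball a r")
    case True
    then show ?thesis using subharmonic_onD[OF s r sub contv harv _ True] veq t_in by simp
  qed (simp add: t_def)
  have "continuous_on ((G \<inter> cball a r) \<union> (G - ball a r)) (\<lambda>z. if z \<in> cball a r then v z else s z)"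
  proof (rule continuous_on_cases_local)
    have G: "(G \<inter> cball a r) \<union> (G - ball a r) = G" by auto
    show "closedin (top_of_set ((G \<inter> cball a r) \<union> (G - ball a r))) (G \<inter> cball a r)"
      unfolding G by (simp add: closedin_closed_Int)
    have "G - ball a r = G \<inter> (- ball a r)" by auto
    then show "closedin (top_of_set ((G \<inter> cball a r) \<union> (G - ball a r))) (G - ball a r)"
      unfolding G by (metis closedin_closed_Int closed_Compl open_ball)
    show "continuous_on (G \<inter> cball a r) v" using contv continuous_on_subset by blast
    show "continuous_on (G - ball a r) s" using conts continuous_on_subset by blast
  qed (use veq in auto)
  moreover have "(G \<inter> cball a r) \<union> (G - ball a r) = G" by auto
  ultimately have contt: "continuous_on G t" by (simp add: t_def[abs_def])
  have hart: "harmonic_on t (ball a r)" using harv by (rule harmonic_on_cong) (simp add: t_def)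
  show thesis
  proof (rule that)
    show "subharmonic_on t G" unfolding subharmonic_on_def
    proof (intro conjI contt allI impI ballI)
      fix b \<rho> h z assume \<rho>: "(\<rho>::real) > 0" and sub': "cball b \<rho> \<subseteq> G" and conth: "continuous_on (cball b \<rho>) h"
        and h: "harmonic_on h (ball b \<rho>)" and le: "\<forall>z\<in>sphere b \<rho>. t z \<le> h z" and z: "z \<in> ball b \<rho>"
      have sh: "s w \<le> h w" if w: "w \<in> cball b \<rho>" for w
        by (rule subharmonic_onD[OF s \<rho> sub' conth h _ w])
          (use le st sub' in \<open>meson order_trans sphere_cball subsetD\<close>)
      show "t z \<le> h z"
      proof (cases "z \<in> ball a r")
        case False
        then show ?thesis using sh[of z] z t_out[of z] by simp
      next
        case True
        \<comment> \<open>A frontier point of \<open>?W\<close> lies either on the circle of the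
          test disc, where \<open>t \<le> h\<close> is given, or inside the test disc but outside
          \<open>ball a r\<close>, where \<open>t = s\<close> and \<open>s \<le> h\<close> is
          already known.\<close>
        let ?W = "ball a r \<inter> ball b \<rho>"
        have "t z - h z \<le> 0"
        proof (rule harmonic_on_maximum_principle_closure[OF _ _ _ refl])
          show "harmonic_on (\<lambda>z. t z - h z) ?W"
            by (intro harmonic_on_diff harmonic_on_subset[OF hart] harmonic_on_subset[OF h]) auto
          show "bounded ?W" by (simp add: bounded_Int)
          have cl: "closure ?W \<subseteq> cball b \<rho>"
            by (rule closure_minimal) auto
          have "continuous_on (closure ?W) t" by (rule continuous_on_subset[OF contt]) (use cl sub' in blast)
          moreover have "continuous_on (closure ?W) h" by (rule continuous_on_subset[OF conth cl])
          ultimately show "continuous_on (closure ?W) (\<lambda>z. t z - h z)" by (intro continuous_intros)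
          show "z \<in> ?W" using True z by simp
          fix \<xi> assume "\<xi> \<in> frontier ?W"
          then have \<xi>: "\<xi> \<in> cball b \<rho>" "\<xi> \<notin> ?W"
            using cl by (auto simp: frontier_def interior_open open_Int)
          show "t \<xi> - h \<xi> \<le> 0"
          proof (cases "\<xi> \<in> ball b \<rho>")
            case True
            then show ?thesis using \<xi> sh[OF \<xi>(1)] t_out[of \<xi>] by simp
          next
            case False
            then show ?thesis using \<xi>(1) le by simp
          qed
        qed
        then show ?thesis by simp
      qed
    qed
    fix p z assume p: "harmonic_on p G" and sp: "\<And>z. z \<in> G \<Longrightarrow> s z \<le> p z" and z: "z \<in> G"
    show "t z \<le> p z"
    proof (cases "z \<in> ball a r")
      case True
      have "t z - p z \<le> 0"
      proof (rule harmonic_on_maximum_principle_closure[OF _ bounded_ball _ refl _ True])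
        show "harmonic_on (\<lambda>z. t z - p z) (ball a r)"
          using sub by (intro harmonic_on_diff hart harmonic_on_subset[OF p]) auto
        show "continuous_on (closure (ball a r)) (\<lambda>z. t z - p z)"
          using r sub by (auto intro!: continuous_intros continuous_on_subset[OF contt] 
              continuous_on_subset[OF harmonic_on_continuous[OF p]])
        show "t \<xi> - p \<xi> \<le> 0" if "\<xi> \<in> frontier (ball a r)" for \<xi>
          using that r sub sp[of \<xi>] t_out[of \<xi>] by auto
      qed
      then show ?thesis by simp
    next
      case False
      then show ?thesis using sp[OF z] t_out by simp
    qed
  qed (use st hart in auto)
qed

section \<open>Greatest harmonic minorants\<close>

text \<open>Perron's method with two majorants, whose minimum is in general not harmonic. A
  competitor \<open>t n\<close> that is harmonic near \<open>a\<close> and almost optimal at the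
  single point \<open>a\<close> is almost optimal uniformly nearby, by Harnack applied to the excess
  of a larger competitor over it. Hence \<open>u\<close> is locally a uniform limit of harmonic
  functions.\<close>

theorem greatest_harmonic_minorant:
  assumes p1: "harmonic_on p1 G" "\<And>z. z \<in> G \<Longrightarrow> p1 z \<ge> 0" 
    and p2: "harmonic_on p2 G" "\<And>z. z \<in> G \<Longrightarrow> p2 z \<ge> 0"
  obtains u where "harmonic_on u G" "\<And>z. z \<in> G \<Longrightarrow> 0 \<le> u z" 
    "\<And>z. z \<in> G \<Longrightarrow> u z \<le> p1 z" "\<And>z. z \<in> G \<Longrightarrow> u z \<le> p2 z"
    "\<forall>k. harmonic_on k G \<longrightarrow> (\<forall>z\<in>G. k z \<le> p1 z) \<longrightarrow> (\<forall>z\<in>G. k z \<le> p2 z) \<longrightarrow> (\<forall>z\<in>G. k z \<le> u z)"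
proof -
  have G: "open G" using p1 harmonic_on_open by blast
  define \<S> where "\<S> = {s. subharmonic_on s G \<and> (\<forall>z\<in>G. 0 \<le> s z \<and> s z \<le> p1 z \<and> s z \<le> p2 z)}"
  define u where "u z = (SUP s\<in>\<S>. s z)" for z
  have zero: "(\<lambda>z. 0) \<in> \<S>"
    using harmonic_imp_subharmonic_on[OF harmonic_on_const[OF G]] p1 p2 by (auto simp: \<S>_def)
  have upper: "s z \<le> u z" if "s \<in> \<S>" "z \<in> G" for s z
    unfolding u_def using that by (intro cSUP_upper bdd_aboveI2[of _ _ "p1 z"]) (auto simp: \<S>_def)
  have least: "u z \<le> M" if "\<And>s. s \<in> \<S> \<Longrightarrow> s z \<le> M" for z M
    unfolding u_def using that zero by (intro cSUP_least) auto
  have max_\<S>: "(\<lambda>z. max (s z) (t z)) \<in> \<S>" if "s \<in> \<S>" "t \<in> \<S>" for s t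
    using that by (auto simp: \<S>_def intro: subharmonic_on_max)
  have modify: "\<exists>t\<in>\<S>. harmonic_on t (ball a r) \<and> (\<forall>z\<in>G. s z \<le> t z)"
    if s: "s \<in> \<S>" and r: "r > 0" "cball a r \<subseteq> G" for s a r
  proof -
    have "subharmonic_on s G" using s by (simp add: \<S>_def)
    from Poisson_modification[OF this r] obtain t where t: "subharmonic_on t G" "harmonic_on t (ball a r)" 
      "\<And>z. z \<in> G \<Longrightarrow> s z \<le> t z"
      "\<And>p z. harmonic_on p G \<Longrightarrow> (\<And>z. z \<in> G \<Longrightarrow> s z \<le> p z) \<Longrightarrow> z \<in> G \<Longrightarrow> t z \<le> p z" by metis
    have "t \<in> \<S>" using t(1) t(3) t(4)[OF p1(1)] t(4)[OF p2(1)] s unfolding \<S>_def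
      by (auto intro: order_trans)
    then show ?thesis using t by blast
  qed
  have har: "harmonic_on u G"
  proof (rule harmonic_onI_local[OF G])
    fix a assume a: "a \<in> G"
    then obtain R where R: "R > 0" "cball a R \<subseteq> G" using G open_contains_cball by blast
    have "\<exists>t\<in>\<S>. harmonic_on t (ball a R) \<and> u a - 1 / (real n + 1) < t a" for n
    proof -
      have "\<exists>s\<in>\<S>. u a - 1 / (real n + 1) < s a"
      proof (rule ccontr)
        assume "\<not> ?thesis"
        then have "u a \<le> u a - 1 / (real n + 1)" by (intro least) (auto simp: not_less)
        moreover have "1 / (real n + 1) > 0" by simp
        ultimately show False by linarith
      qed
      then obtain s where s: "s \<in> \<S>" "u a - 1 / (real n + 1) < s a" by blast
      from modify[OF s(1) R] obtain t where "t \<in> \<S>" "harmonic_on t (ball a R)" "\<forall>z\<in>G. s z \<le> t z" by blast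
      then show ?thesis using s(2) a by (meson less_le_trans)
    qed
    then obtain t where t: "\<And>n. t n \<in> \<S>" "\<And>n. harmonic_on (t n) (ball a R)" "\<And>n. u a - 1 / (real n + 1) < t n a"
      by metis
    have "\<exists>F. F holomorphic_on ball a R \<and> (\<forall>z\<in>ball a R. t n z = Re (F z))" for n
      using harmonic_on_ball_Re[OF t(2) order_refl] by metis
    then obtain F where F: "\<And>n. F n holomorphic_on ball a R" "\<And>n z. z \<in> ball a R \<Longrightarrow> t n z = Re (F n z)" by metis
    \<comment> \<open>At relative distance at most 1/2 the Harnack factor is at most 2. The excess
      of a competitor over \<open>t n\<close> is therefore at most three times its excess at
      \<open>a\<close>, which is at most \<open>1 / (real n + 1)\<close>.\<close>
    have close: "u z \<le> t n z + 3 / (real n + 1)" if z: "z \<in> ball a (R / 2)" for n z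
    proof (rule least)
      fix s assume s: "s \<in> \<S>"
      from modify[OF max_\<S>[OF s t(1)[of n]] R] obtain v where v: "v \<in> \<S>" "harmonic_on v (ball a R)" 
        "\<And>z. z \<in> G \<Longrightarrow> max (s z) (t n z) \<le> v z" by blast
      have zR: "z \<in> ball a R" using z R by auto
      then have zG: "z \<in> G" using R by auto
      define \<rho> where "\<rho> = dist a z / R"
      have \<rho>: "0 \<le> \<rho>" "\<rho> \<le> 1 / 2" using z R by (auto simp: \<rho>_def field_simps)
      have diff: "0 \<le> v a - t n a" "v a - t n a \<le> 1 / (real n + 1)"
        using v(3)[OF a] upper[OF v(1) a] t(3)[of n] by auto
      have "\<bar>(v z - t n z) - (v a - t n a)\<bar> \<le> 2 * \<rho> / (1 - \<rho>) * (v a - t n a)" unfolding \<rho>_def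
      proof (rule harmonic_on_Harnack[OF harmonic_on_diff[OF v(2) t(2)[of n]] order_refl _ zR])
        show "0 \<le> v w - t n w" if "w \<in> ball a R" for w using v(3)[of w] that R(2) by (auto simp: subset_iff)
      qed
      also have "\<dots> \<le> 2 * (v a - t n a)"
        using \<rho> diff by (intro mult_right_mono) (auto simp: field_simps)
      finally have "(v z - t n z) - (v a - t n a) \<le> 2 * (v a - t n a)" by (rule abs_le_D1)
      then have "v z - t n z \<le> 3 * (v a - t n a)" by simp
      also have "\<dots> \<le> 3 * (1 / (real n + 1))" using diff(2) by (rule mult_left_mono) simp
      finally have "v z - t n z \<le> 3 * (1 / (real n + 1))" .
      then show "s z \<le> t n z + 3 / (real n + 1)" using v(3)[OF zG] by simp
    qed
    have "uniform_limit (ball a (R / 2)) (\<lambda>n z. Re (F n z)) u sequentially"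
    proof (rule uniform_limitI)
      fix e :: real assume e: "e > 0"
      have "(\<lambda>n. 3 / (real n + 1)) \<longlonglongrightarrow> 0" by real_asymp
      from order_tendstoD(2)[OF this e] 
      show "\<forall>\<^sub>F n in sequentially. \<forall>z\<in>ball a (R / 2). dist (Re (F n z)) (u z) < e"
      proof eventually_elim
        case (elim n)
        show ?case
        proof
          fix z assume z: "z \<in> ball a (R / 2)"
          then have zR: "z \<in> ball a R" "z \<in> G" using R by auto
          show "dist (Re (F n z)) (u z) < e"
            using close[OF z, of n] upper[OF t(1)[of n] zR(2)] elim F(2)[OF zR(1), of n] by (simp add: dist_real_def)
        qed
      qed
    qed
    moreover have "F n holomorphic_on ball a (R / 2)" for n
      by (rule holomorphic_on_subset[OF F(1)]) (use R in auto)
    ultimately have "\<exists>H. H holomorphic_on ball a (R / 2) \<and> (\<forall>z\<in>ball a (R / 2). u z = Re (H z))"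
      using uniform_limit_Re_holomorphic by blast
    then show "\<exists>r>0. \<exists>F. F holomorphic_on ball a r \<and> (\<forall>w\<in>ball a r. u w = Re (F w))" using R
      by (intro exI[of _ "R / 2"]) auto
  qed
  have le: "0 \<le> u z" "u z \<le> p1 z" "u z \<le> p2 z" if "z \<in> G" for z
    using upper[OF zero that] least[of z "p1 z"] least[of z "p2 z"] that by (auto simp: \<S>_def)
  have "k z \<le> u z" if k: "harmonic_on k G" "\<And>z. z \<in> G \<Longrightarrow> k z \<le> p1 z" "\<And>z. z \<in> G \<Longrightarrow> k z \<le> p2 z" and z: "z \<in> G" for k z
  proof -
    \<comment> \<open>Competitors are nonnegative, so \<open>k\<close> enters through its positive
      part.\<close>
    have "(\<lambda>z. max (k z) 0) \<in> \<S>"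
      using subharmonic_on_max[OF harmonic_imp_subharmonic_on[OF k(1)] harmonic_imp_subharmonic_on[OF harmonic_on_const[OF G]]]
        k(2,3) p1(2) p2(2) by (auto simp: \<S>_def)
    from upper[OF this z] show ?thesis by simp
  qed
  then have "\<forall>k. harmonic_on k G \<longrightarrow> (\<forall>z\<in>G. k z \<le> p1 z) \<longrightarrow> (\<forall>z\<in>G. k z \<le> p2 z) \<longrightarrow> (\<forall>z\<in>G. k z \<le> u z)" by blast
  with har le show thesis by (rule that)
qed

section \<open>The inner radius and Lindelof's principle\<close>

definition log_minorants :: "complex set \<Rightarrow> complex \<Rightarrow> (complex \<Rightarrow> real) set" where
  "log_minorants G z = {h. harmonic_on h G \<and> (\<forall>v\<in>G - {z}. h v \<le> - ln (cmod (v - z)))}"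

lemma log_minorants_nonempty:
  assumes "open G" "bounded G"
  shows "log_minorants G z \<noteq> {}"
proof -
  obtain B where B: "\<And>w. w \<in> G \<Longrightarrow> cmod w \<le> B" using assms(2) bounded_iff by blast
  define M where "M = \<bar>B\<bar> + cmod z + 1"
  have "- ln M \<le> - ln (cmod (v - z))" if "v \<in> G - {z}" for v
  proof -
    have "cmod (v - z) \<le> cmod v + cmod z" by (rule norm_triangle_ineq4)
    also have "\<dots> \<le> M" using B[of v] that by (simp add: M_def)
    finally show ?thesis using that by (auto intro: ln_mono)
  qed
  then have "(\<lambda>v. - ln M) \<in> log_minorants G z"
    using assms by (auto simp: log_minorants_def harmonic_on_const)
  then show ?thesis by blast
qed

text \<open>The defining inequality says nothing at the pole itself; the maximum principle carries
  the bound on the circle of radius \<open>\<rho>\<close> across the whole disc, including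
  \<open>z\<close>.\<close>

lemma log_minorants_bound:
  assumes h: "h \<in> log_minorants G z" and \<rho>: "\<rho> > 0" "cball z \<rho> \<subseteq> G" and w: "w \<in> ball z \<rho>"
  shows "h w \<le> - ln \<rho>"
proof -
  have har: "harmonic_on h G" using h by (simp add: log_minorants_def)
  have "h w - (- ln \<rho>) \<le> 0"
  proof (rule harmonic_on_maximum_principle_closure[OF _ bounded_ball _ refl _ w])
    show "harmonic_on (\<lambda>w. h w - (- ln \<rho>)) (ball z \<rho>)"
      using \<rho> by (intro harmonic_on_diff harmonic_on_const harmonic_on_subset[OF har]) auto
    show "continuous_on (closure (ball z \<rho>)) (\<lambda>w. h w - (- ln \<rho>))"
      using \<rho> by (auto intro!: continuous_intros continuous_on_subset[OF harmonic_on_continuous[OF har]])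
    fix \<xi> assume \<xi>: "\<xi> \<in> frontier (ball z \<rho>)"
    then have "cmod (\<xi> - z) = \<rho>" using \<rho> by (simp add: dist_norm norm_minus_commute)
    moreover have "\<xi> \<in> G - {z}" using \<xi> \<rho> by auto
    moreover from this have "h \<xi> \<le> - ln (cmod (\<xi> - z))" using h unfolding log_minorants_def by blast
    ultimately show "h \<xi> - (- ln \<rho>) \<le> 0" by simp
  qed
  then show ?thesis by simp
qed

text \<open>
  By Harnack, the supremum defining the Green function is continuous at the pole, so the limit in
  the definition of the inner radius is attained by substitution.
\<close>

lemma inner_radius_eq_exp_SUP:
  fixes G z
  defines "C \<equiv> connected_component_set G z"
  assumes G: "open G" "bounded G" and z: "z \<in> G"
  shows "inner_radius G z = exp (- (SUP h\<in>log_minorants C z. h z))"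
    and "bdd_above ((\<lambda>h. h z) ` log_minorants C z)" and "log_minorants C z \<noteq> {}"
proof -
  have C: "open C" "bounded C" "z \<in> C"
    using G z bounded_subset[OF G(2) connected_component_subset] unfolding C_def
    by (auto simp: open_connected_component)
  obtain \<rho> where \<rho>: "\<rho> > 0" "cball z \<rho> \<subseteq> C" using C open_contains_cball by blast
  define M where "M = - ln \<rho>"
  define L where "L w = (SUP h\<in>log_minorants C z. h w)" for w
  show ne: "log_minorants C z \<noteq> {}" by (rule log_minorants_nonempty[OF C(1,2)])
  have bd: "bdd_above ((\<lambda>h. h w) ` log_minorants C z)" if "w \<in> ball z \<rho>" for w
    using log_minorants_bound[OF _ \<rho> that] by (intro bdd_aboveI2[of _ _ M]) (simp add: M_def)
  show "bdd_above ((\<lambda>h. h z) ` log_minorants C z)" using bd \<rho> by simp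
  have upper: "h w \<le> L w" if "h \<in> log_minorants C z" "w \<in> ball z \<rho>" for h w
    unfolding L_def using bd[OF that(2)] that(1) by (rule cSUP_upper[rotated])
  have least: "L w \<le> X" if "\<And>h. h \<in> log_minorants C z \<Longrightarrow> h w \<le> X" for w X
    unfolding L_def using ne that by (rule cSUP_least)
  have LM: "L z \<le> M" using log_minorants_bound[OF _ \<rho>, where w=z] \<rho> by (intro least) (simp add: M_def)
  define \<tau> where "\<tau> w = 2 * (dist z w / \<rho>) / (1 - dist z w / \<rho>)" for w
  have harnack: "\<bar>(M - h w) - (M - h z)\<bar> \<le> \<tau> w * (M - h z)" if h: "h \<in> log_minorants C z" and w: "w \<in> ball z \<rho>" for h w
    unfolding \<tau>_def
  proof (rule harmonic_on_Harnack[OF _ _ _ w])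
    show "harmonic_on (\<lambda>w. M - h w) C"
      using h C by (auto intro!: harmonic_on_diff harmonic_on_const simp: log_minorants_def)
    show "ball z \<rho> \<subseteq> C" using \<rho> by auto
    show "0 \<le> M - h v" if "v \<in> ball z \<rho>" for v using log_minorants_bound[OF h \<rho> that] by (simp add: M_def)
  qed
  \<comment> \<open>Each \<open>M - h\<close> is nonnegative, so the Harnack estimate passes to the
    infimum over \<open>h\<close> in both directions. The radius \<open>\<rho> / 3\<close> ensures
    \<open>\<tau> w \<le> 1\<close>, so that multiplication by \<open>1 - \<tau> w\<close> preserves
    inequalities.\<close>
  have close: "\<bar>L w - L z\<bar> \<le> \<tau> w * (M - L z)" if w: "dist z w < \<rho> / 3" for w
  proof -
    have wb: "w \<in> ball z \<rho>" "z \<in> ball z \<rho>" using w \<rho> by auto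
    define t where "t = dist z w / \<rho>"
    have "0 \<le> t" "t < 1 / 3" using w \<rho> by (auto simp: t_def field_simps)
    then have \<tau>: "0 \<le> \<tau> w" "\<tau> w \<le> 1" unfolding \<tau>_def t_def[symmetric] by (auto simp: field_simps)
    have "L w \<le> M - (1 - \<tau> w) * (M - L z)"
    proof (rule least)
      fix h assume h: "h \<in> log_minorants C z"
      have "(1 - \<tau> w) * (M - L z) \<le> (1 - \<tau> w) * (M - h z)"
        using \<tau> upper[OF h wb(2)] by (intro mult_left_mono) auto
      then show "h w \<le> M - (1 - \<tau> w) * (M - L z)" 
        using harnack[OF h wb(1)] by (auto simp: abs_le_iff algebra_simps)
    qed
    moreover have "L z \<le> M - (M - L w) / (1 + \<tau> w)"
    proof (rule least)
      fix h assume h: "h \<in> log_minorants C z"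
      have "M - L w \<le> M - h w" using upper[OF h wb(1)] by simp
      also have "\<dots> \<le> (1 + \<tau> w) * (M - h z)" using harnack[OF h wb(1)] by (auto simp: abs_le_iff algebra_simps)
      finally have "(M - L w) / (1 + \<tau> w) \<le> M - h z" using \<tau> by (simp add: divide_le_eq mult.commute)
      then show "h z \<le> M - (M - L w) / (1 + \<tau> w)" by simp
    qed
    then have "(M - L w) / (1 + \<tau> w) \<le> M - L z" by simp
    then have "M - L w \<le> (1 + \<tau> w) * (M - L z)" using \<tau> by (simp add: divide_le_eq mult.commute)
    ultimately show ?thesis by (auto simp: abs_le_iff algebra_simps)
  qed
  have "(L \<longlongrightarrow> L z) (at z)"
  proof (rule LIM_zero_cancel)
    show "((\<lambda>w. L w - L z) \<longlongrightarrow> 0) (at z)"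
    proof (rule Lim_null_comparison)
      have "\<forall>\<^sub>F w in at z. w \<in> ball z (\<rho> / 3)" using \<rho> by (intro eventually_at_in_open') auto
      then show "\<forall>\<^sub>F w in at z. norm (L w - L z) \<le> \<tau> w * (M - L z)"
        by eventually_elim (use close in auto)
      have "((\<lambda>w. \<tau> w * (M - L z)) \<longlongrightarrow> 2 * (dist z z / \<rho>) / (1 - dist z z / \<rho>) * (M - L z)) (at z)"
        unfolding \<tau>_def using \<rho> by (intro tendsto_intros) auto
      then show "((\<lambda>w. \<tau> w * (M - L z)) \<longlongrightarrow> 0) (at z)" by simp
    qed
  qed
  then have "((\<lambda>w. - L w) \<longlongrightarrow> - L z) (at z)" by (rule tendsto_minus)
  moreover have "green C w z + ln (cmod (w - z)) = - L w" for w
    by (simp add: green_def L_def log_minorants_def)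
  ultimately have "Lim (at z) (\<lambda>w. green C w z + ln (cmod (w - z))) = - L z"
    by (intro tendsto_Lim) auto
  then show "inner_radius G z = exp (- (SUP h\<in>log_minorants C z. h z))"
    by (simp add: inner_radius_def C_def[symmetric] L_def)
qed

text \<open>For \<open>a\<close> in the disc, the Blaschke factor (w - a) / (1 - cnj a * w) thus has
  modulus 1 on the circle and less than 1 inside. The last term measures the deviation and later
  yields the Poisson asymptotics.\<close>

lemma cmod_blaschke_identity:
  "(cmod (1 - cnj a * w))\<^sup>2 = (cmod (w - a))\<^sup>2 + (1 - (cmod w)\<^sup>2) * (1 - (cmod a)\<^sup>2)"
  unfolding cmod_power2 by (simp add: power2_eq_square algebra_simps)

lemma cmod_one_minus_cnj_self:
  assumes "z \<in> ball 0 1"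
  shows "cmod (1 - cnj z * z) = 1 - (cmod z)\<^sup>2"
proof -
  have "1 - cnj z * z = of_real (1 - (cmod z)\<^sup>2)" by (metis complex_norm_square mult.commute of_real_1 of_real_diff)
  moreover have "(cmod z)\<^sup>2 \<le> 1" using assms by (simp add: power_le_one)
  ultimately show ?thesis by (simp add: norm_of_real del: of_real_diff)
qed

text \<open>
  Lindelof's principle at the pole: the maximum principle is applied to the holomorphic function
  \<open>\<Phi>\<close>, whose modulus is the exponential of the difference of the two kernels.
\<close>

lemma Lindelof_minorant_bound:
  assumes f: "f holomorphic_on ball 0 1" "f ` ball 0 1 \<subseteq> C" and h: "h \<in> log_minorants C (f \<zeta>)"
    and \<zeta>: "\<zeta> \<in> ball 0 1"
  shows "exp (h (f \<zeta>)) * (cmod (deriv f \<zeta>) * (1 - (cmod \<zeta>)\<^sup>2)) \<le> 1"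
proof -
  have "harmonic_on h C" using h by (simp add: log_minorants_def)
  from harmonic_on_compose[OF this f(1) open_ball f(2)] 
  have "harmonic_on (\<lambda>w. h (f w)) (ball 0 1)" .
  from harmonic_on_ball_Re[OF this order_refl] obtain K where K: "K holomorphic_on ball 0 1" 
    "\<And>w. w \<in> ball 0 1 \<Longrightarrow> h (f w) = Re (K w)" by metis
  define \<phi> where "\<phi> w = (if w = \<zeta> then deriv f \<zeta> else (f w - f \<zeta>) / (w - \<zeta>))" for w
  \<comment> \<open>\<open>\<phi>\<close> fills the removable singularity of the difference
    quotient. Away from \<open>\<zeta>\<close> the modulus of \<open>\<Phi>\<close> is
    \<open>exp (h (f w)) * cmod (f w - f \<zeta>)\<close> divided by the modulus of the Blaschke
    factor; at \<open>\<zeta>\<close> it is the quantity to be bounded.\<close>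
  define \<Phi> where "\<Phi> w = exp (K w) * \<phi> w * (1 - cnj \<zeta> * w)" for w
  have hol: "\<Phi> holomorphic_on ball 0 1" unfolding \<Phi>_def
    using pole_lemma_open[OF f(1) open_ball] unfolding \<phi>_def by (intro holomorphic_intros K) 
  have bound: "cmod (\<Phi> w) * cmod (w - \<zeta>) \<le> cmod (1 - cnj \<zeta> * w)" if w: "w \<in> ball 0 1" "w \<noteq> \<zeta>" for w
  proof (cases "f w = f \<zeta>")
    case False
    have "f w \<in> C - {f \<zeta>}" using False f(2) w by auto
    then have "h (f w) \<le> - ln (cmod (f w - f \<zeta>))" using h by (simp add: log_minorants_def)
    then have "exp (h (f w)) \<le> 1 / cmod (f w - f \<zeta>)"
      using False by (metis exp_le_cancel_iff exp_ln exp_minus inverse_eq_divide right_minus_eq zero_less_norm_iff)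
    then have "exp (h (f w)) * cmod (f w - f \<zeta>) \<le> 1" using False by (simp add: field_simps)
    then have "exp (h (f w)) * cmod (f w - f \<zeta>) * cmod (1 - cnj \<zeta> * w) \<le> 1 * cmod (1 - cnj \<zeta> * w)"
      by (rule mult_right_mono) simp
    then show ?thesis using w K(2)[OF w(1)] by (simp add: \<Phi>_def \<phi>_def norm_mult norm_divide)
  qed (use w in \<open>simp add: \<Phi>_def \<phi>_def\<close>)
  \<comment> \<open>\<open>\<Phi>\<close> need not extend to the unit circle, so the maximum
    principle is used on circles of radius \<open>r < 1\<close>. There the reciprocal of the squared
    Blaschke modulus exceeds 1 by at most the last term, which vanishes as \<open>r\<close> tends to
    1.\<close>
  have "(cmod (\<Phi> \<zeta>))\<^sup>2 \<le> 1 + (1 - r\<^sup>2) * (1 - (cmod \<zeta>)\<^sup>2) / (r - cmod \<zeta>)\<^sup>2" if r: "cmod \<zeta> < r" "r < 1" for r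
  proof -
    define B where "B = 1 + (1 - r\<^sup>2) * (1 - (cmod \<zeta>)\<^sup>2) / (r - cmod \<zeta>)\<^sup>2"
    have r0: "0 < r" using r norm_ge_zero[of \<zeta>] by linarith
    have r1: "r\<^sup>2 \<le> 1" "(cmod \<zeta>)\<^sup>2 \<le> 1" using r r0 \<zeta> by (auto simp: power_le_one)
    have B: "B \<ge> 0" unfolding B_def using r1 by (intro add_nonneg_nonneg divide_nonneg_nonneg mult_nonneg_nonneg) auto
    have "cmod (\<Phi> \<zeta>) \<le> sqrt B"
    proof (rule maximum_modulus_frontier[where S="cball 0 r" and f=\<Phi> and \<xi>=\<zeta> and B="sqrt B"])
      show "\<Phi> holomorphic_on interior (cball 0 r)" by (rule holomorphic_on_subset[OF hol]) (use r in auto)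
      show "continuous_on (closure (cball 0 r)) \<Phi>"
        by (rule continuous_on_subset[OF holomorphic_on_imp_continuous_on[OF hol]]) (use r in auto)
      fix w assume "w \<in> frontier (cball (0::complex) r)"
      then have w: "cmod w = r" using r0 by simp
      have tri: "r - cmod \<zeta> \<le> cmod (w - \<zeta>)" using norm_triangle_ineq2[of w \<zeta>] w by simp
      then have pos: "cmod (w - \<zeta>) > 0" "w \<noteq> \<zeta>" using r by auto
      have "(cmod (\<Phi> w))\<^sup>2 * (cmod (w - \<zeta>))\<^sup>2 \<le> (cmod (1 - cnj \<zeta> * w))\<^sup>2"
        unfolding power_mult_distrib[symmetric] using bound[of w] w r pos by (intro power_mono) auto
      also have "\<dots> = (cmod (w - \<zeta>))\<^sup>2 + (1 - r\<^sup>2) * (1 - (cmod \<zeta>)\<^sup>2)"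
        using cmod_blaschke_identity[of \<zeta> w] w by simp
      finally have "(cmod (\<Phi> w))\<^sup>2 \<le> 1 + (1 - r\<^sup>2) * (1 - (cmod \<zeta>)\<^sup>2) / (cmod (w - \<zeta>))\<^sup>2"
        using pos by (simp add: field_simps)
      also have "\<dots> \<le> B" unfolding B_def
        using r1 r tri pos by (intro add_left_mono divide_left_mono power_mono mult_nonneg_nonneg mult_pos_pos zero_less_power) auto
      finally show "cmod (\<Phi> w) \<le> sqrt B" by (simp add: real_le_rsqrt)
    qed (use r in auto)
    then show ?thesis using B unfolding B_def[symmetric] by (simp add: real_le_rsqrt sqrt_ge_absD)
  qed
  then have ev: "\<forall>\<^sub>F r in at_left 1. (cmod (\<Phi> \<zeta>))\<^sup>2 \<le> 1 + (1 - r\<^sup>2) * (1 - (cmod \<zeta>)\<^sup>2) / (r - cmod \<zeta>)\<^sup>2"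
    using \<zeta> by (auto simp: eventually_at_left[of "cmod \<zeta>" 1])
  have "((\<lambda>r. 1 + (1 - r\<^sup>2) * (1 - (cmod \<zeta>)\<^sup>2) / (r - cmod \<zeta>)\<^sup>2) \<longlongrightarrow> 
      1 + (1 - 1\<^sup>2) * (1 - (cmod \<zeta>)\<^sup>2) / (1 - cmod \<zeta>)\<^sup>2) (at_left 1)"
    using \<zeta> by (intro tendsto_intros) auto
  from tendsto_lowerbound[OF this ev] have "(cmod (\<Phi> \<zeta>))\<^sup>2 \<le> 1\<^sup>2" by simp
  then have "cmod (\<Phi> \<zeta>) \<le> 1" by (rule power2_le_imp_le) simp
  then show ?thesis using K(2)[OF \<zeta>] cmod_one_minus_cnj_self[OF \<zeta>]
    by (simp add: \<Phi>_def \<phi>_def norm_mult mult.assoc)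
qed

text \<open>The image of the disc is connected and so lies in the component that defines the inner
  radius. The Lindelof estimate bounds every minorant at the pole, hence also their
  supremum.\<close>

lemma inner_radius_holomorphic_image_ge:
  assumes G: "open G" "bounded G" and f: "f holomorphic_on ball 0 1" "f ` ball 0 1 \<subseteq> G" and \<zeta>: "\<zeta> \<in> ball 0 1"
  shows "cmod (deriv f \<zeta>) * (1 - (cmod \<zeta>)\<^sup>2) \<le> inner_radius G (f \<zeta>)"
proof (cases "deriv f \<zeta> = 0")
  case True
  then show ?thesis by (simp add: inner_radius_def)
next
  case False
  let ?C = "connected_component_set G (f \<zeta>)"
  let ?c = "cmod (deriv f \<zeta>) * (1 - (cmod \<zeta>)\<^sup>2)"
  have z: "f \<zeta> \<in> G" using f \<zeta> by blast
  have pos: "?c > 0" using False \<zeta> by (simp add: power_less_one_iff)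
  have "connected (f ` ball 0 1)"
    using f(1) holomorphic_on_imp_continuous_on connected_continuous_image connected_ball by blast
  then have sub: "f ` ball 0 1 \<subseteq> ?C" using \<zeta> f(2) by (intro connected_component_maximal) auto
  have "(SUP h\<in>log_minorants ?C (f \<zeta>). h (f \<zeta>)) \<le> - ln ?c"
  proof (rule cSUP_least[OF inner_radius_eq_exp_SUP(3)[OF G z]])
    fix h assume "h \<in> log_minorants ?C (f \<zeta>)"
    from Lindelof_minorant_bound[OF f(1) sub this \<zeta>] have "exp (h (f \<zeta>)) \<le> 1 / ?c" using pos by (simp add: pos_le_divide_eq)
    then have "exp (h (f \<zeta>)) \<le> exp (- ln ?c)" using pos by (simp only: exp_minus exp_ln inverse_eq_divide)
    then show "h (f \<zeta>) \<le> - ln ?c" by simp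
  qed
  then have "exp (ln ?c) \<le> inner_radius G (f \<zeta>)"
    unfolding inner_radius_eq_exp_SUP(1)[OF G z] exp_le_cancel_iff by linarith
  then show ?thesis using pos by simp
qed

lemma harmonic_on_ln_cmod:
  assumes G: "open G" and F: "F holomorphic_on G" "\<And>z. z \<in> G \<Longrightarrow> F z \<noteq> 0"
  shows "harmonic_on (\<lambda>z. ln (cmod (F z))) G"
proof (rule harmonic_onI_local[OF G])
  fix z assume "z \<in> G"
  then obtain r where r: "r > 0" "ball z r \<subseteq> G" using G openE by blast
  then have ne: "F w \<noteq> 0" if "w \<in> ball z r" for w using that F(2) by blast
  have "z \<in> ball z r" using r by simp
  from holomorphic_logarithm_exists[OF convex_ball open_ball holomorphic_on_subset[OF F(1) r(2)] ne this]
  obtain g where "g holomorphic_on ball z r" "\<And>w. w \<in> ball z r \<Longrightarrow> exp (g w) = F w" by metis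
  then show "\<exists>r>0. \<exists>H. H holomorphic_on ball z r \<and> (\<forall>w\<in>ball z r. ln (cmod (F w)) = Re (H w))"
    using r(1) by (metis norm_exp_eq_Re ln_exp)
qed

text \<open>The inverse map transplants the Green function of the disc: off the pole,
  \<open>h v\<close> equals \<open>- ln (cmod (v - f \<zeta>))\<close> minus that Green function at
  \<open>g v\<close> with pole \<open>\<zeta>\<close>, and \<open>\<psi>\<close> removes the
  singularity at \<open>f \<zeta>\<close>. This one minorant already has the extremal value at the
  pole.\<close>

lemma inner_radius_conformal_image_le:
  assumes bd: "bounded (f ` ball 0 1)" and f: "f holomorphic_on ball 0 1" "inj_on f (ball 0 1)" and \<zeta>: "\<zeta> \<in> ball 0 1"
  shows "inner_radius (f ` ball 0 1) (f \<zeta>) \<le> cmod (deriv f \<zeta>) * (1 - (cmod \<zeta>)\<^sup>2)"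
proof -
  let ?G = "f ` ball 0 1"
  let ?c = "cmod (deriv f \<zeta>) * (1 - (cmod \<zeta>)\<^sup>2)"
  have G: "open ?G" using open_mapping_thm3[OF f(1) open_ball f(2)] .
  have z: "f \<zeta> \<in> ?G" using \<zeta> by blast
  have "connected ?G"
    using f(1) holomorphic_on_imp_continuous_on connected_continuous_image connected_ball by blast
  then have C: "connected_component_set ?G (f \<zeta>) = ?G" using z connected_component_eq_self by blast
  from holomorphic_has_inverse[OF f(1) open_ball f(2)] obtain g where g: "g holomorphic_on ?G"
    "\<And>z. z \<in> ball 0 1 \<Longrightarrow> deriv f z * deriv g (f z) = 1" "\<And>z. z \<in> ball 0 1 \<Longrightarrow> g (f z) = z" by metis
  define \<psi> where "\<psi> v = (if v = f \<zeta> then deriv g (f \<zeta>) else (g v - g (f \<zeta>)) / (v - f \<zeta>))" for v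
  have \<psi>: "\<psi> holomorphic_on ?G" unfolding \<psi>_def by (rule pole_lemma_open[OF g(1) G])
  have \<psi>0: "\<psi> v \<noteq> 0" if "v \<in> ?G" for v
    using that g(2)[OF \<zeta>] g(3) \<zeta> by (auto simp: \<psi>_def)
  have gb: "cmod (g v) < 1" if "v \<in> ?G" for v using that g(3) by auto
  have den: "1 - cnj \<zeta> * g v \<noteq> 0" if "v \<in> ?G" for v
  proof -
    have "cmod (cnj \<zeta> * g v) < 1"
      using gb[OF that] \<zeta> mult_strict_mono'[of "cmod \<zeta>" 1 "cmod (g v)" 1] by (simp add: norm_mult)
    then show ?thesis by auto
  qed
  define h where "h v = ln (cmod (\<psi> v)) - ln (cmod (1 - cnj \<zeta> * g v))" for v
  have "h \<in> log_minorants ?G (f \<zeta>)" unfolding log_minorants_def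
  proof (intro CollectI conjI ballI)
    show "harmonic_on h ?G" unfolding h_def
      using den \<psi>0 by (intro harmonic_on_diff harmonic_on_ln_cmod G \<psi> holomorphic_intros g)
    fix v assume v: "v \<in> ?G - {f \<zeta>}"
    then have ne: "g v - \<zeta> \<noteq> 0" using g(3) \<zeta> by auto
    have "(cmod (g v - \<zeta>))\<^sup>2 \<le> (cmod (1 - cnj \<zeta> * g v))\<^sup>2"
      unfolding cmod_blaschke_identity using gb[of v] v \<zeta> by (auto simp: power_le_one)
    then have "cmod (g v - \<zeta>) \<le> cmod (1 - cnj \<zeta> * g v)" by (rule power2_le_imp_le) simp
    then have "ln (cmod (g v - \<zeta>)) \<le> ln (cmod (1 - cnj \<zeta> * g v))" using ne by (intro ln_mono) auto
    moreover have "ln (cmod (\<psi> v)) = ln (cmod (g v - \<zeta>)) - ln (cmod (v - f \<zeta>))"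
      using v ne g(3)[OF \<zeta>] by (simp add: \<psi>_def norm_divide ln_div)
    ultimately show "h v \<le> - ln (cmod (v - f \<zeta>))" by (simp add: h_def)
  qed
  then have "h (f \<zeta>) \<le> (SUP h\<in>log_minorants ?G (f \<zeta>). h (f \<zeta>))"
    using inner_radius_eq_exp_SUP(2)[OF G bd z, unfolded C] by (intro cSUP_upper)
  then have "inner_radius ?G (f \<zeta>) \<le> exp (- h (f \<zeta>))"
    unfolding inner_radius_eq_exp_SUP(1)[OF G bd z] C by simp
  also have "exp (- h (f \<zeta>)) = ?c"
  proof -
    have f': "deriv f \<zeta> \<noteq> 0" using g(2)[OF \<zeta>] by auto
    have "cmod (deriv f \<zeta>) * cmod (deriv g (f \<zeta>)) = 1" using g(2)[OF \<zeta>] by (metis norm_mult norm_one)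
    then have 1: "cmod (\<psi> (f \<zeta>)) = inverse (cmod (deriv f \<zeta>))" using f' by (simp add: \<psi>_def field_simps)
    have lt: "(cmod \<zeta>)\<^sup>2 < 1" using \<zeta> by (simp add: power_less_one_iff)
    have 2: "cmod (1 - cnj \<zeta> * g (f \<zeta>)) = 1 - (cmod \<zeta>)\<^sup>2"
      using g(3)[OF \<zeta>] cmod_one_minus_cnj_self[OF \<zeta>] by simp
    show ?thesis unfolding h_def 1 2 using f' lt by (simp add: ln_inverse exp_add)
  qed
  finally show ?thesis .
qed

lemma inner_radius_unit_disc:
  assumes "z \<in> ball 0 1"
  shows "inner_radius (ball 0 1) z = 1 - (cmod z)\<^sup>2"
proof (rule antisym)
  show "inner_radius (ball 0 1) z \<le> 1 - (cmod z)\<^sup>2"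
    using inner_radius_conformal_image_le[of "\<lambda>z. z" z] assms by simp
  show "1 - (cmod z)\<^sup>2 \<le> inner_radius (ball 0 1) z"
    using inner_radius_holomorphic_image_ge[of "ball 0 1" "\<lambda>z. z" z] assms by simp
qed

section \<open>Boundary behaviour at the point 1\<close>

text \<open>Local model of the disc at 1: the map (1 - z) / (1 + z) takes the unit disc to the right
  half-plane and 1 to 0.\<close>

definition half_disc :: "real \<Rightarrow> complex set" where
  "half_disc r = {s. Re s > 0} \<inter> ball 0 r"

lemma open_half_disc: "open (half_disc r)"
  unfolding half_disc_def by (intro open_Int open_halfspace_Re_gt open_ball)

lemma convex_half_disc: "convex (half_disc r)"
  unfolding half_disc_def by (intro convex_Int convex_halfspace_Re_gt convex_ball)

text \<open>
  The bound \<open>u s \<le> C * Re s\<close> makes the holomorphic completion of \<open>u\<close> Lipschitz, hence continuous up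
  to the imaginary axis, where its real part vanishes, so Schwarz reflection applies.
\<close>

lemma harmonic_boundary_derivative:
  assumes u: "harmonic_on u (half_disc \<delta>)" and \<delta>: "\<delta> > 0"
    and bound: "\<And>s. s \<in> half_disc \<delta> \<Longrightarrow> 0 \<le> u s \<and> u s \<le> C * Re s"
  shows "\<exists>D. ((\<lambda>s. (u s - Re (D * s)) / cmod s) \<longlongrightarrow> 0) (at 0 within {s. Re s > 0})"
proof -
  obtain F where F: "F holomorphic_on half_disc \<delta>" "\<And>s. s \<in> half_disc \<delta> \<Longrightarrow> u s = Re (F s)"
    by (rule harmonic_on_convex_Re[OF u open_half_disc convex_half_disc order_refl]) blast
  define r where "r = \<delta> / 2"
  have r: "r > 0" using \<delta> by (simp add: r_def)
  let ?H = "half_disc r"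
  have H\<delta>: "?H \<subseteq> half_disc \<delta>" using \<delta> by (auto simp: half_disc_def r_def)
  \<comment> \<open>The disc of radius \<open>Re s\<close> about \<open>s\<close> stays in
    \<open>half_disc \<delta>\<close> because \<open>r\<close> is half of \<open>\<delta>\<close>.
    The gradient bound \<open>2 / Re s * u s\<close> then loses its singularity thanks to
    \<open>u s \<le> C * Re s\<close>.\<close>
  have dF: "cmod (deriv F s) \<le> 2 * C" if s: "s \<in> ?H" for s
  proof -
    have "Re s > 0" using s by (simp add: half_disc_def)
    have sub: "ball s (Re s) \<subseteq> half_disc \<delta>"
    proof
      fix w assume w: "w \<in> ball s (Re s)"
      then have "cmod (w - s) < Re s" by (simp add: dist_norm norm_minus_commute)
      moreover have "\<bar>Re (w - s)\<bar> \<le> cmod (w - s)" by (rule abs_Re_le_cmod)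
      moreover have "cmod w \<le> cmod (w - s) + cmod s" using norm_triangle_ineq[of "w - s" s] by simp
      moreover have "cmod s < r" "Re s \<le> cmod s" using s complex_Re_le_cmod by (auto simp: half_disc_def)
      ultimately show "w \<in> half_disc \<delta>" by (auto simp: half_disc_def r_def)
    qed
    have "cmod (deriv F s) \<le> 2 / Re s * Re (F s)"
      by (rule Re_nonneg_deriv_bound[OF holomorphic_on_subset[OF F(1) sub]])
        (use sub F(2) bound \<open>Re s > 0\<close> in fastforce)+
    also have "\<dots> \<le> 2 / Re s * (C * Re s)"
      using bound[of s] F(2)[of s] s H\<delta> \<open>Re s > 0\<close> by (intro mult_left_mono) auto
    finally show ?thesis using \<open>Re s > 0\<close> by simp
  qed
  have "cmod (F y - F x) \<le> 2 * C * cmod (y - x)" if "x \<in> ?H" "y \<in> ?H" for x y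
  proof (rule field_differentiable_bound[OF convex_half_disc _ dF that(2,1)])
    show "(F has_field_derivative deriv F z) (at z within ?H)" if "z \<in> ?H" for z
      using holomorphic_derivI[OF F(1) open_half_disc] H\<delta> that has_field_derivative_at_within by blast
  qed
  then have lip: "dist (F x) (F y) \<le> (2 * C) * dist x y" if "x \<in> ?H" "y \<in> ?H" for x y
    using that unfolding dist_norm by blast
  have C: "C \<ge> 0"
    using order_trans[OF norm_ge_zero dF[of "of_real (r / 2)"]] r by (simp add: half_disc_def)
  have "uniformly_continuous_on ?H F"
    by (rule lipschitz_on_uniformly_continuous[of "2 * C"]) (use lip C in \<open>auto intro!: lipschitz_onI\<close>)
  then obtain g where g: "uniformly_continuous_on (closure ?H) g" "\<And>x. x \<in> ?H \<Longrightarrow> F x = g x"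
    using uniformly_continuous_on_extension_on_closure by metis
  have contg: "continuous_on (closure ?H) g" using g(1) uniformly_continuous_imp_continuous by blast
  \<comment> \<open>\<open>X\<close> approaches \<open>s\<close> from the right within the
    half-disc; on the axis the squeeze between 0 and \<open>C * Re (X n)\<close> forces the real
    part of the extension to vanish.\<close>
  have axis: "s \<in> closure ?H \<and> (Re s = 0 \<longrightarrow> Re (g s) = 0)" if s: "Re s \<ge> 0" "cmod s < r" for s
  proof -
    define X where "X n = s + of_real ((r - cmod s) / (real n + 2))" for n
    have XH: "X n \<in> ?H" for n
    proof -
      have pos: "(r - cmod s) / (real n + 2) > 0" using s by simp
      have "cmod (X n) \<le> cmod s + (r - cmod s) / (real n + 2)"
        unfolding X_def using norm_triangle_ineq[of s "of_real ((r - cmod s) / (real n + 2))"] pos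
        unfolding norm_of_real by simp
      also have "(r - cmod s) / (real n + 2) \<le> (r - cmod s) / 2" using s by (intro divide_left_mono) auto
      also have "cmod s + (r - cmod s) / 2 < r" using s by (simp add: field_simps)
      finally have "cmod (X n) < r" by simp
      moreover have "Re (X n) > 0" using add_nonneg_pos[OF s(1) pos] unfolding X_def by (simp only: plus_complex.simps Re_complex_of_real)
      ultimately show ?thesis by (simp add: half_disc_def)
    qed
    have "(\<lambda>n. (r - cmod s) / (real n + 2)) \<longlonglongrightarrow> 0" by real_asymp
    then have "(\<lambda>n. s + of_real ((r - cmod s) / (real n + 2))) \<longlonglongrightarrow> s + of_real 0" by (intro tendsto_intros)
    then have X: "X \<longlonglongrightarrow> s" by (simp add: X_def[abs_def])
    have cl: "s \<in> closure ?H" using X XH closure_sequential by blast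
    have "Re (g s) = 0" if "Re s = 0"
    proof -
      have "(\<lambda>n. g (X n)) \<longlonglongrightarrow> g s"
        using contg cl X XH closure_subset by (intro continuous_on_tendsto_compose[OF contg X cl]) (auto intro!: always_eventually)
      then have "(\<lambda>n. Re (g (X n))) \<longlonglongrightarrow> Re (g s)" by (rule tendsto_Re)
      moreover have "(\<lambda>n. Re (g (X n))) \<longlonglongrightarrow> 0"
      proof (rule tendsto_sandwich[OF _ _ tendsto_const])
        show "\<forall>\<^sub>F n in sequentially. 0 \<le> Re (g (X n))" "\<forall>\<^sub>F n in sequentially. Re (g (X n)) \<le> C * Re (X n)"
          using bound F(2) g(2) XH H\<delta> by (auto intro!: always_eventually) (metis subsetD)+
        have "(\<lambda>n. C * Re (X n)) \<longlonglongrightarrow> C * Re s" using X by (intro tendsto_intros)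
        then show "(\<lambda>n. C * Re (X n)) \<longlonglongrightarrow> 0" using that by simp
      qed
      ultimately show ?thesis using LIMSEQ_unique by blast
    qed
    with cl show ?thesis by blast
  qed
  \<comment> \<open>A quarter turn makes the imaginary axis real and turns a vanishing real part
    into a vanishing imaginary part, the form required for Schwarz reflection. \<open>P\<close>
    below undoes the rotation.\<close>
  define f where "f \<zeta> = \<i> * g (- \<i> * \<zeta>)" for \<zeta>
  have refl: "(\<lambda>z. if 0 \<le> Im z then f z else cnj (f (cnj z))) holomorphic_on ball 0 r"
  proof (rule Schwarz_reflection[OF open_ball])
    show "cnj ` ball 0 r \<subseteq> ball 0 r" by auto
    have "(\<lambda>\<zeta>. F (- \<i> * \<zeta>)) holomorphic_on (ball 0 r \<inter> {z. 0 < Im z})"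
      by (rule holomorphic_on_compose_gen[of _ _ F "half_disc \<delta>", unfolded o_def])
        (use F(1) \<delta> in \<open>auto intro!: holomorphic_intros simp: half_disc_def r_def norm_mult\<close>)
    then have "(\<lambda>\<zeta>. \<i> * F (- \<i> * \<zeta>)) holomorphic_on (ball 0 r \<inter> {z. 0 < Im z})" by (intro holomorphic_intros)
    moreover have "\<i> * F (- \<i> * \<zeta>) = f \<zeta>" if "\<zeta> \<in> ball 0 r \<inter> {z. 0 < Im z}" for \<zeta>
      using that g(2)[of "- \<i> * \<zeta>"] by (simp add: f_def half_disc_def norm_mult)
    ultimately show "f holomorphic_on (ball 0 r \<inter> {z. 0 < Im z})" using holomorphic_transform by blast
    show "continuous_on (ball 0 r \<inter> {z. 0 \<le> Im z}) f" unfolding f_def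
      by (intro continuous_intros continuous_on_compose2[OF contg]) (use axis in \<open>auto simp: norm_mult\<close>)
    show "f z \<in> \<real>" if "z \<in> ball 0 r" "z \<in> \<real>" for z
      using that axis[of "- \<i> * z"] by (auto simp: f_def norm_mult complex_is_Real_iff)
  qed
  define P where "P s = - \<i> * (if 0 \<le> Im (\<i> * s) then f (\<i> * s) else cnj (f (cnj (\<i> * s))))" for s
  have "P holomorphic_on ball 0 r" unfolding P_def
    by (intro holomorphic_intros holomorphic_on_compose_gen[OF _ refl, unfolded o_def]) (auto simp: norm_mult)
  then have D: "(P has_field_derivative deriv P 0) (at 0)" using r holomorphic_derivI by auto
  have P0: "Re (P 0) = 0" using axis[of 0] r by (simp add: P_def f_def)
  have PF: "Re (P s) = u s" if "s \<in> ?H" for s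
  proof -
    have "P s = g s" using that by (simp add: P_def f_def half_disc_def flip: mult.assoc)
    then show ?thesis using g(2)[OF that] F(2)[of s] that H\<delta> by auto
  qed
  have "((\<lambda>s. (P s - P 0 - deriv P 0 * s) / s) \<longlongrightarrow> 0) (at 0)"
  proof -
    have "((\<lambda>s. (P s - P 0) / s - deriv P 0) \<longlongrightarrow> 0) (at 0)"
      using D by (simp add: has_field_derivative_iff LIM_zero_iff)
    then show ?thesis 
      by (rule Lim_transform_eventually) (auto simp: eventually_at_filter field_simps intro!: always_eventually)
  qed
  then have lim: "((\<lambda>s. (P s - P 0 - deriv P 0 * s) / s) \<longlongrightarrow> 0) (at 0 within {s. Re s > 0})"
    by (rule tendsto_within_subset) simp
  have "((\<lambda>s. (u s - Re (deriv P 0 * s)) / cmod s) \<longlongrightarrow> 0) (at 0 within {s. Re s > 0})"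
  proof (rule Lim_null_comparison[OF _ tendsto_norm_zero[OF lim]])
    have "\<forall>\<^sub>F s in at 0 within {s. Re s > 0}. s \<in> ?H"
      using r by (auto simp: eventually_at half_disc_def intro!: exI[of _ r])
    then show "\<forall>\<^sub>F s in at 0 within {s. Re s > 0}. 
       norm ((u s - Re (deriv P 0 * s)) / cmod s) \<le> norm ((P s - P 0 - deriv P 0 * s) / s)"
    proof eventually_elim
      case (elim s)
      have "u s - Re (deriv P 0 * s) = Re (P s - P 0 - deriv P 0 * s)" using PF[OF elim] P0 by simp
      then have "\<bar>u s - Re (deriv P 0 * s)\<bar> \<le> cmod (P s - P 0 - deriv P 0 * s)" using abs_Re_le_cmod by metis
      then show ?case by (simp add: norm_divide divide_right_mono)
    qed
  qed
  then show ?thesis by blast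
qed

section \<open>The Green function of the disc and its Poisson asymptotics\<close>

definition disc_green :: "complex \<Rightarrow> complex \<Rightarrow> real" where
  "disc_green w z = ln (cmod (1 - cnj z * w)) - ln (cmod (w - z))"

lemma one_minus_cnj_mult_nonzero:
  assumes "z \<in> ball 0 1" "cmod w \<le> 1"
  shows "1 - cnj z * w \<noteq> 0"
proof -
  have "cmod (cnj z * w) \<le> cmod z * 1" using assms by (simp add: norm_mult mult_left_le)
  then show ?thesis using assms by auto
qed

text \<open>Puts the logarithm in the form ln (1 + X), where X becomes small as \<open>z\<close>
  nears the circle away from \<open>w\<close>; this is the form to be linearized.\<close>

lemma disc_green_eq:
  assumes z: "z \<in> ball 0 1" and w: "cmod w \<le> 1" "w \<noteq> z"
  shows "disc_green w z = ln (1 + (1 - (cmod w)\<^sup>2) * (1 - (cmod z)\<^sup>2) / (cmod (w - z))\<^sup>2) / 2"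
proof -
  have pos: "cmod (w - z) > 0" "cmod (1 - cnj z * w) > 0"
    using w one_minus_cnj_mult_nonzero[OF z w(1)] by auto
  have "1 + (1 - (cmod w)\<^sup>2) * (1 - (cmod z)\<^sup>2) / (cmod (w - z))\<^sup>2 = (cmod (1 - cnj z * w) / cmod (w - z))\<^sup>2"
    using pos unfolding power_divide cmod_blaschke_identity by (simp add: field_simps)
  moreover have "ln ((cmod (1 - cnj z * w) / cmod (w - z))\<^sup>2) = 2 * ln (cmod (1 - cnj z * w) / cmod (w - z))"
    using pos by (simp add: ln_realpow)
  ultimately show ?thesis using pos by (simp add: disc_green_def ln_div)
qed

lemma disc_green_nonneg:
  assumes z: "z \<in> ball 0 1" and w: "cmod w \<le> 1" "w \<noteq> z"
  shows "disc_green w z \<ge> 0"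
proof -
  have "(1 - (cmod w)\<^sup>2) * (1 - (cmod z)\<^sup>2) / (cmod (w - z))\<^sup>2 \<ge> 0"
    using z w by (intro divide_nonneg_nonneg mult_nonneg_nonneg) (auto simp: power_le_one)
  then show ?thesis unfolding disc_green_eq[OF assms] by simp
qed

text \<open>The Poisson kernel of the disc at the boundary point 1; \<open>poisson (- w)\<close> is
  the kernel at -1. As a real part it is visibly harmonic.\<close>

definition poisson :: "complex \<Rightarrow> real" where
  "poisson w = Re ((1 + w) / (1 - w))"

lemma poisson_eq: "poisson w = (1 - (cmod w)\<^sup>2) / (cmod (1 - w))\<^sup>2"
proof -
  have "(1 + w) / (1 - w) = (1 + w) * cnj (1 - w) / of_real ((cmod (1 - w))\<^sup>2)"
    by (rule complex_div_cnj)
  then have "poisson w = Re ((1 + w) * cnj (1 - w)) / (cmod (1 - w))\<^sup>2"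
    unfolding poisson_def by (simp only: Re_divide_of_real)
  also have "Re ((1 + w) * cnj (1 - w)) = 1 - (cmod w)\<^sup>2"
    unfolding cmod_power2 by (simp add: power2_eq_square algebra_simps)
  finally show ?thesis .
qed

lemma poisson_nonneg: "cmod w \<le> 1 \<Longrightarrow> poisson w \<ge> 0"
  unfolding poisson_eq by (simp add: power_le_one)

lemma harmonic_on_poisson: "harmonic_on poisson (ball 0 1)" "harmonic_on (\<lambda>w. poisson (- w)) (ball 0 1)"
proof -
  have 1: "1 - w \<noteq> 0" if "w \<in> ball 0 1" for w :: complex using that by auto
  have 2: "1 + w \<noteq> 0" if "w \<in> ball 0 1" for w :: complex
  proof
    assume "1 + w = 0"
    then have "w = - 1" by (simp add: add_eq_0_iff)
    then show False using that by simp
  qed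
  show "harmonic_on poisson (ball 0 1)" unfolding poisson_def[abs_def]
    by (rule harmonic_on_Re[OF open_ball _ refl]) (intro holomorphic_intros 1)
  have "harmonic_on (\<lambda>w. Re ((1 - w) / (1 + w))) (ball 0 1)"
    by (rule harmonic_on_Re[OF open_ball _ refl]) (intro holomorphic_intros 2)
  then show "harmonic_on (\<lambda>w. poisson (- w)) (ball 0 1)" by (simp add: poisson_def)
qed

text \<open>By \<open>disc_green_eq\<close> the Green function is \<open>ln (1 + X) / 2\<close>,
  where the denominator of \<open>X\<close> is the squared distance from \<open>w\<close> to
  \<open>z\<close>; the Poisson term has the distance to 1 instead. For \<open>w\<close> at distance
  at least \<open>d\<close> from 1 the two distances are uniformly comparable and \<open>X\<close>
  is uniformly small, so X / (1 + X) \<le> ln (1 + X) \<le> X suffices.\<close>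

lemma disc_green_poisson_asymp:
  assumes d: "d > 0" and \<epsilon>: "\<epsilon> > 0"
  obtains \<eta> where "\<eta> > 0" "\<And>z w. z \<in> ball 0 1 \<Longrightarrow> cmod (z - 1) < \<eta> \<Longrightarrow> w \<in> ball 0 1 \<Longrightarrow> d \<le> cmod (w - 1) \<Longrightarrow>
      (1 - \<epsilon>) * ((1 - (cmod z)\<^sup>2) / 2) * poisson w \<le> disc_green w z \<and>
      disc_green w z \<le> (1 + \<epsilon>) * ((1 - (cmod z)\<^sup>2) / 2) * poisson w"
proof -
  \<comment> \<open>The conditions on \<open>\<eta>\<close> are the error factors of the two bounds:
    the squared distance ratio for the upper one, and the squared distance ratio times a bound for
    \<open>1 + X\<close> for the lower one.\<close>
  have "((\<lambda>\<eta>. (1 + \<eta> / (d - \<eta>))\<^sup>2) \<longlongrightarrow> (1 + 0 / (d - 0))\<^sup>2) (at_right 0)"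
    using d by (intro tendsto_intros) auto
  then have "\<forall>\<^sub>F \<eta> in at_right 0. (1 + \<eta> / (d - \<eta>))\<^sup>2 < 1 + \<epsilon>"
    using \<epsilon> by (intro order_tendstoD(2)) auto
  moreover have "((\<lambda>\<eta>. 1 / ((1 + \<eta> / d)\<^sup>2 * (1 + 2 * \<eta> / (d - \<eta>)\<^sup>2))) \<longlongrightarrow> 1 / ((1 + 0 / d)\<^sup>2 * (1 + 2 * 0 / (d - 0)\<^sup>2))) (at_right 0)"
    using d by (intro tendsto_intros) auto
  then have "\<forall>\<^sub>F \<eta> in at_right 0. 1 - \<epsilon> < 1 / ((1 + \<eta> / d)\<^sup>2 * (1 + 2 * \<eta> / (d - \<eta>)\<^sup>2))"
    using \<epsilon> by (intro order_tendstoD(1)) auto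
  moreover have "\<forall>\<^sub>F \<eta> in at_right 0. \<eta> \<in> {0<..<d}" using d by (rule eventually_at_right_real)
  ultimately have "\<forall>\<^sub>F \<eta> in at_right 0. 0 < \<eta> \<and> \<eta> < d \<and> (1 + \<eta> / (d - \<eta>))\<^sup>2 < 1 + \<epsilon> \<and>
      1 - \<epsilon> < 1 / ((1 + \<eta> / d)\<^sup>2 * (1 + 2 * \<eta> / (d - \<eta>)\<^sup>2))"
    by eventually_elim auto
  then obtain \<eta> where \<eta>: "0 < \<eta>" "\<eta> < d" "(1 + \<eta> / (d - \<eta>))\<^sup>2 < 1 + \<epsilon>" 
      "1 - \<epsilon> < 1 / ((1 + \<eta> / d)\<^sup>2 * (1 + 2 * \<eta> / (d - \<eta>)\<^sup>2))"
    using eventually_happens'[OF trivial_limit_at_right_real] by blast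
  show thesis
  proof (rule that[OF \<eta>(1)])
    fix z w assume z: "z \<in> ball 0 1" "cmod (z - 1) < \<eta>" and w: "w \<in> ball 0 1" "d \<le> cmod (w - 1)"
    define \<kappa> where "\<kappa> = 1 - (cmod z)\<^sup>2"
    define \<omega> where "\<omega> = 1 - (cmod w)\<^sup>2"
    define a where "a = cmod (w - z)"
    define b where "b = cmod (w - 1)"
    have \<kappa>: "\<kappa> > 0" and \<omega>: "\<omega> > 0" "\<omega> \<le> 1" using z w by (auto simp: \<kappa>_def \<omega>_def power_less_one_iff)
    have "1 - cmod z \<le> cmod (z - 1)" using norm_triangle_ineq2[of 1 z] by (simp add: norm_minus_commute)
    then have "(1 - cmod z) * (1 + cmod z) \<le> \<eta> * 2" using z by (intro mult_mono) auto
    then have \<kappa>2: "\<kappa> \<le> 2 * \<eta>" by (simp add: \<kappa>_def power2_eq_square algebra_simps)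
    have tri: "b \<le> a + \<eta>" "a \<le> b + \<eta>"
      using norm_triangle_ineq[of "w - z" "z - 1"] norm_triangle_ineq4[of "w - 1" "z - 1"] z by (auto simp: a_def b_def)
    have b: "d \<le> b" using w by (simp add: b_def)
    have a: "d - \<eta> \<le> a" "a > 0" "w \<noteq> z" using tri b \<eta> by (auto simp: a_def)
    have "\<eta> \<le> \<eta> / (d - \<eta>) * a" using mult_left_mono[OF a(1), of "\<eta> / (d - \<eta>)"] \<eta> by simp
    then have "b \<le> (1 + \<eta> / (d - \<eta>)) * a" using tri(1) by (simp add: algebra_simps)
    then have "b\<^sup>2 \<le> ((1 + \<eta> / (d - \<eta>)) * a)\<^sup>2" using b d by (intro power_mono) auto
    also have "\<dots> \<le> (1 + \<epsilon>) * a\<^sup>2" unfolding power_mult_distrib using \<eta>(3) by (intro mult_right_mono) auto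
    finally have ba: "b\<^sup>2 \<le> (1 + \<epsilon>) * a\<^sup>2" .
    have "\<eta> \<le> \<eta> / d * b" using mult_left_mono[OF b, of "\<eta> / d"] \<eta> d by simp
    then have "a \<le> (1 + \<eta> / d) * b" using tri(2) by (simp add: algebra_simps)
    then have "a\<^sup>2 \<le> ((1 + \<eta> / d) * b)\<^sup>2" using a by (intro power_mono) auto
    then have ab: "a\<^sup>2 \<le> (1 + \<eta> / d)\<^sup>2 * b\<^sup>2" by (simp add: power_mult_distrib)
    define X where "X = \<omega> * \<kappa> / a\<^sup>2"
    have X: "X > 0" using \<omega> \<kappa> a by (simp add: X_def)
    have "X \<le> 1 * (2 * \<eta>) / (d - \<eta>)\<^sup>2" unfolding X_def
      using \<omega> \<kappa> \<kappa>2 a \<eta> by (intro frac_le mult_mono power_mono) auto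
    then have X2: "X \<le> 2 * \<eta> / (d - \<eta>)\<^sup>2" by simp
    have gr: "disc_green w z = ln (1 + X) / 2"
      using disc_green_eq[OF z(1) _ a(3)] w by (simp add: X_def \<omega>_def \<kappa>_def a_def)
    have po: "poisson w = \<omega> / b\<^sup>2" by (simp add: poisson_eq \<omega>_def b_def norm_minus_commute)
    have b0: "b > 0" using b d by simp
    have up: "disc_green w z \<le> (1 + \<epsilon>) * (\<kappa> / 2) * poisson w"
    proof -
      have "disc_green w z \<le> X / 2" unfolding gr using ln_add_one_self_le_self[of X] X by simp
      also have "\<dots> = \<omega> * (\<kappa> / 2) * (1 / a\<^sup>2)" by (simp add: X_def)
      also have "\<dots> \<le> \<omega> * (\<kappa> / 2) * ((1 + \<epsilon>) / b\<^sup>2)"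
        using \<omega> \<kappa> ba a b0 by (intro mult_left_mono) (auto simp: field_simps)
      finally show ?thesis by (simp add: po algebra_simps)
    qed
    define q where "q = (1 + \<eta> / d)\<^sup>2"
    define p where "p = 1 + 2 * \<eta> / (d - \<eta>)\<^sup>2"
    have "1 + \<eta> / d > 0" using \<eta> d by (intro add_pos_pos) auto
    then have qp: "q > 0" "p > 0" using \<eta> d by (auto simp: q_def p_def intro!: add_pos_nonneg zero_less_power)
    have lo: "(1 - \<epsilon>) * (\<kappa> / 2) * poisson w \<le> disc_green w z"
    proof -
      have "(1 - \<epsilon>) * (\<kappa> / 2) * poisson w \<le> 1 / (q * p) * (\<kappa> / 2) * poisson w"
        using \<eta>(4) \<kappa> \<omega> b0 unfolding po q_def p_def by (intro mult_right_mono) auto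
      also have "\<dots> = \<omega> * \<kappa> / 2 * (1 / (q * b\<^sup>2)) * (1 / p)" by (simp add: po mult.commute mult.left_commute)
      also have "\<dots> \<le> \<omega> * \<kappa> / 2 * (1 / a\<^sup>2) * (1 / (1 + X))"
        using \<omega> \<kappa> ab a b0 qp X X2 unfolding q_def[symmetric] 
        by (intro mult_mono mult_left_mono divide_left_mono mult_nonneg_nonneg) (auto simp: p_def)
      also have "\<dots> = X / (1 + X) / 2" by (simp add: X_def)
      also have "X / (1 + X) \<le> ln (1 + X)"
      proof -
        have "ln (1 / (1 + X)) \<le> 1 / (1 + X) - 1" using X by (intro ln_le_minus_one) auto
        also have "1 / (1 + X) - 1 = - (X / (1 + X))" using X by (simp add: field_simps)
        finally show ?thesis using X by (simp add: ln_div)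
      qed
      finally show ?thesis by (simp add: gr)
    qed
    from lo up show "(1 - \<epsilon>) * ((1 - (cmod z)\<^sup>2) / 2) * poisson w \<le> disc_green w z \<and>
      disc_green w z \<le> (1 + \<epsilon>) * ((1 - (cmod z)\<^sup>2) / 2) * poisson w" by (simp add: \<kappa>_def)
  qed
qed

text \<open>\<open>Z\<close> collects the poles deleted from the lens. These are the cases to check
  when the maximum principle is used there.\<close>

lemma frontier_lens:
  assumes Z: "finite Z" and \<xi>: "\<xi> \<in> frontier (ball 0 1 \<inter> ball 1 d - Z)"
  shows "\<xi> \<in> Z \<or> cmod \<xi> = 1 \<and> cmod (\<xi> - 1) \<le> d \<or> cmod \<xi> < 1 \<and> cmod (\<xi> - 1) = d"
proof -
  let ?W = "ball 0 1 \<inter> ball 1 d - Z"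
  have "open ?W" using Z by (intro open_Diff open_Int open_ball finite_imp_closed)
  then have "\<xi> \<in> closure ?W" "\<xi> \<notin> ?W" using \<xi> by (auto simp: frontier_def interior_open)
  moreover have "closure ?W \<subseteq> cball 0 1 \<inter> cball 1 d" by (rule closure_minimal) (auto intro: closed_Int)
  ultimately show ?thesis by (auto simp: dist_norm norm_minus_commute)
qed

lemma disc_green_boundary:
  assumes "cmod \<xi> = 1"
  shows "disc_green \<xi> z = 0"
proof -
  have "(cmod (1 - cnj z * \<xi>))\<^sup>2 = (cmod (\<xi> - z))\<^sup>2" using assms by (simp add: cmod_blaschke_identity)
  then have "cmod (1 - cnj z * \<xi>) = cmod (\<xi> - z)" by (rule power2_eq_imp_eq) auto
  then show ?thesis by (simp add: disc_green_def)
qed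

lemma tendsto_disc_green:
  assumes "z \<in> ball 0 1" "cmod \<xi> \<le> 1" "\<xi> \<noteq> z"
  shows "((\<lambda>w. disc_green w z) \<longlongrightarrow> disc_green \<xi> z) (at \<xi> within W)"
proof -
  have "cmod (1 - cnj z * \<xi>) \<noteq> 0" "cmod (\<xi> - z) \<noteq> 0"
    using assms(3) one_minus_cnj_mult_nonzero[OF assms(1,2)] by simp_all
  then show ?thesis unfolding disc_green_def by (intro tendsto_intros)
qed

lemma tendsto_poisson_uminus:
  assumes "\<xi> \<noteq> - 1"
  shows "((\<lambda>w. poisson (- w)) \<longlongrightarrow> poisson (- \<xi>)) (at \<xi> within W)"
proof -
  have "1 + \<xi> \<noteq> 0" using assms by (simp add: add_eq_0_iff)
  then have "((\<lambda>w. Re ((1 - w) / (1 + w))) \<longlongrightarrow> Re ((1 - \<xi>) / (1 + \<xi>))) (at \<xi> within W)" 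
    by (intro tendsto_intros)
  then show ?thesis by (simp add: poisson_def)
qed

text \<open>Upper half of the squeeze. \<open>k\<close> is harmonic through \<open>z\<close>, and
  off the pole it is at most \<open>disc_green w z / c\<close>. Once \<open>k\<close> lies below
  both \<open>poisson\<close> and the barrier on all of \<open>C\<close>, extremality of
  \<open>u\<close> applies and is evaluated at \<open>z\<close>. Away from 1 this domination is the
  assumed estimate; in the lens it follows from the maximum principle, since the Green function
  vanishes on the circle.\<close>

lemma log_minorant_le:
  assumes C: "open C" "C \<subseteq> ball 0 1" "ball 0 1 \<inter> cball 1 d \<subseteq> C" and d: "0 < d" "d \<le> 1"
    and z: "z \<in> ball 0 1" "cmod (z - 1) < d" and c: "c > 0"
    and u: "\<forall>k. harmonic_on k C \<longrightarrow> (\<forall>w\<in>C. k w \<le> poisson w) \<longrightarrow>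
      (\<forall>w\<in>C. k w \<le> 4 / d\<^sup>2 * poisson (- w)) \<longrightarrow> (\<forall>w\<in>C. k w \<le> u w)"
    and est: "\<And>w. w \<in> ball 0 1 \<Longrightarrow> d \<le> cmod (w - 1) \<Longrightarrow> disc_green w z \<le> c * poisson w"
    and h: "h \<in> log_minorants C z"
  shows "h z + ln (1 - (cmod z)\<^sup>2) \<le> c * u z"
proof -
  let ?p2 = "\<lambda>w. 4 / d\<^sup>2 * poisson (- w)"
  define k where "k w = 1 / c * (h w + ln (cmod (1 - cnj z * w)))" for w
  have har: "harmonic_on k C" unfolding k_def
    using h C z one_minus_cnj_mult_nonzero[OF z(1)]
    by (intro harmonic_on_cmult harmonic_on_add harmonic_on_ln_cmod holomorphic_intros)
      (auto simp: log_minorants_def subset_iff less_imp_le)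
  have k_green: "k w \<le> disc_green w z / c" if "w \<in> C" "w \<noteq> z" for w
  proof -
    have "h w \<le> - ln (cmod (w - z))" using h that by (auto simp: log_minorants_def)
    then show ?thesis using c by (simp add: k_def disc_green_def divide_right_mono)
  qed
  have far: "k w \<le> poisson w" if w: "w \<in> C" "d \<le> cmod (w - 1)" for w
  proof -
    have "w \<noteq> z" using w z by auto
    have "disc_green w z / c \<le> poisson w" using est[of w] w C c by (auto simp: divide_le_eq mult.commute)
    with k_green[OF w(1) \<open>w \<noteq> z\<close>] show ?thesis by linarith
  qed
  \<comment> \<open>Origin of the constant in the barrier: \<open>cmod (1 - w) \<ge> d\<close>,
    while \<open>cmod (1 + w) \<le> 2\<close>.\<close>
  have p12: "poisson w \<le> ?p2 w" if w: "w \<in> ball 0 1" "d \<le> cmod (w - 1)" for w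
  proof -
    define N where "N = (1 - (cmod w)\<^sup>2) / d\<^sup>2"
    have N: "N \<ge> 0" using w by (simp add: N_def power_le_one)
    have "w \<noteq> - 1" using w by auto
    then have "1 + w \<noteq> 0" by (simp add: add_eq_0_iff)
    moreover have "cmod (1 + w) \<le> 2" using norm_triangle_ineq[of 1 w] w by simp
    then have "(cmod (1 + w))\<^sup>2 \<le> 2\<^sup>2" by (intro power_mono) auto
    ultimately have "1 \<le> 4 / (cmod (1 + w))\<^sup>2" by simp
    then have "N * 1 \<le> N * (4 / (cmod (1 + w))\<^sup>2)" using N by (rule mult_left_mono)
    moreover have "(1 - (cmod w)\<^sup>2) / (cmod (1 - w))\<^sup>2 \<le> N" unfolding N_def
    proof (rule divide_left_mono)
      show "d\<^sup>2 \<le> (cmod (1 - w))\<^sup>2" using w d by (intro power_mono) (auto simp: norm_minus_commute)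
      then show "0 < (cmod (1 - w))\<^sup>2 * d\<^sup>2" using d by (intro mult_pos_pos) (auto intro: less_le_trans[of 0 "d\<^sup>2"])
    qed (use w in \<open>simp add: power_le_one\<close>)
    ultimately have "(1 - (cmod w)\<^sup>2) / (cmod (1 - w))\<^sup>2 \<le> N * (4 / (cmod (1 + w))\<^sup>2)" by linarith
    then show ?thesis unfolding poisson_eq N_def by (simp add: mult.commute)
  qed
  \<comment> \<open>A general \<open>p\<close> serves both majorants. On the circle the
    nonnegativity of \<open>p\<close> is enough, so it does no harm that \<open>poisson\<close> has
    no limit at 1.\<close>
  have near: "k w \<le> p w" 
    if p: "harmonic_on p (ball 0 1)" "\<And>w. w \<in> ball 0 1 \<Longrightarrow> 0 \<le> p w" "\<And>w. w \<in> C \<Longrightarrow> d \<le> cmod (w - 1) \<Longrightarrow> k w \<le> p w" 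
      and w: "w \<in> C" for p w
  proof (cases "d \<le> cmod (w - 1)")
    case True
    then show ?thesis using p(3) w by blast
  next
    case False
    let ?W = "ball 0 1 \<inter> ball 1 d - {}"
    have WC: "?W \<subseteq> C" using C by auto
    have contk: "continuous_on C k" "continuous_on C p"
      using har p(1) C(2) harmonic_on_continuous continuous_on_subset by blast+
    have "k w - p w \<le> 0"
    proof (rule harmonic_on_maximum_principle[where h="\<lambda>w. k w - p w" and z=w])
      show "harmonic_on (\<lambda>w. k w - p w) ?W"
        by (intro harmonic_on_diff harmonic_on_subset[OF har _ WC] harmonic_on_subset[OF p(1)]) auto
      show "bounded ?W" by (simp add: bounded_Int)
      show "w \<in> ?W" using False w C by (auto simp: dist_norm norm_minus_commute)
      have W: "\<forall>\<^sub>F w in at \<xi> within ?W. w \<in> ?W" for \<xi> :: complex by (auto simp: eventually_at_filter)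
      fix \<xi> :: complex and e :: real assume \<xi>: "\<xi> \<in> frontier ?W" and e: "e > 0"
      consider (1) "cmod \<xi> = 1" | (2) "cmod \<xi> < 1" "cmod (\<xi> - 1) = d" using frontier_lens[OF _ \<xi>] by auto
      then show "\<forall>\<^sub>F w in at \<xi> within ?W. k w - p w \<le> e"
      proof cases
        case 1
        have "\<xi> \<noteq> z" using 1 z by auto
        then have "((\<lambda>w. disc_green w z) \<longlongrightarrow> 0) (at \<xi> within ?W)"
          using tendsto_disc_green[OF z(1) _ \<open>\<xi> \<noteq> z\<close>, of ?W] disc_green_boundary[OF 1, of z] 1 by simp
        then have "\<forall>\<^sub>F w in at \<xi> within ?W. disc_green w z < e * c" using e c by (intro order_tendstoD(2)) auto
        moreover have "((\<lambda>w. w) \<longlongrightarrow> \<xi>) (at \<xi> within ?W)" by (rule tendsto_ident_at)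
        then have "\<forall>\<^sub>F w in at \<xi> within ?W. w \<noteq> z" using \<open>\<xi> \<noteq> z\<close> by (rule tendsto_imp_eventually_ne)
        ultimately show ?thesis using W
        proof eventually_elim
          case (elim w)
          then have "w \<in> C" "w \<in> ball 0 1" using WC by auto
          then have "k w \<le> disc_green w z / c" "0 \<le> p w" using k_green elim p(2) by auto
          moreover have "disc_green w z / c < e" using elim c by (simp add: divide_less_eq)
          ultimately show ?case by linarith
        qed
      next
        case 2
        then have "\<xi> \<in> C" using C by (auto simp: dist_norm norm_minus_commute)
        then have "((\<lambda>w. k w - p w) \<longlongrightarrow> k \<xi> - p \<xi>) (at \<xi> within ?W)"
          using contk WC by (intro tendsto_intros) (auto simp: continuous_on_def intro: tendsto_within_subset)
        moreover have "k \<xi> - p \<xi> < e" using p(3)[OF \<open>\<xi> \<in> C\<close>] 2 e by simp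
        ultimately have "\<forall>\<^sub>F w in at \<xi> within ?W. k w - p w < e" by (rule order_tendstoD(2))
        then show ?thesis by eventually_elim simp
      qed
    qed
    then show ?thesis by simp
  qed
  have zC: "z \<in> C" using z C by (auto simp: dist_norm norm_minus_commute)
  have "\<forall>w\<in>C. k w \<le> poisson w"
    by (intro ballI near[OF harmonic_on_poisson(1) _ far]) (auto intro: poisson_nonneg)
  moreover have "\<forall>w\<in>C. k w \<le> ?p2 w"
  proof (rule ballI, rule near[OF harmonic_on_cmult[OF harmonic_on_poisson(2)]])
    show "0 \<le> ?p2 w" if "w \<in> ball 0 1" for w
      using that by (auto intro!: poisson_nonneg mult_nonneg_nonneg divide_nonneg_nonneg)
    show "k w \<le> ?p2 w" if "w \<in> C" "d \<le> cmod (w - 1)" for w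
      using order_trans[OF far[OF that] p12] that C by auto
  qed
  ultimately have "k z \<le> u z" using u har zC by blast
  then show ?thesis using c cmod_one_minus_cnj_self[OF z(1)] by (simp add: k_def divide_le_eq mult.commute)
qed

text \<open>Lower half of the squeeze: \<open>c * u\<close> must stay below
  \<open>disc_green\<close> off the pole. In the lens without \<open>z\<close>, the difference
  \<open>c * u w - disc_green w z\<close> tends to minus infinity at \<open>z\<close>. On the
  circle, and in particular at 1, the barrier forces \<open>u\<close> to 0 while the Green function
  is nonnegative.\<close>

lemma log_minorant_of_poisson_minorant:
  assumes C: "open C" "C \<subseteq> ball 0 1" "ball 0 1 \<inter> cball 1 d \<subseteq> C" and d: "0 < d" "d \<le> 1"
    and z: "z \<in> ball 0 1" and c: "c \<ge> 0"
    and u: "harmonic_on u C" "\<And>w. w \<in> C \<Longrightarrow> 0 \<le> u w" "\<And>w. w \<in> C \<Longrightarrow> u w \<le> poisson w"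
      "\<And>w. w \<in> C \<Longrightarrow> u w \<le> 4 / d\<^sup>2 * poisson (- w)"
    and est: "\<And>w. w \<in> ball 0 1 \<Longrightarrow> d \<le> cmod (w - 1) \<Longrightarrow> c * poisson w \<le> disc_green w z"
    and zd: "cmod (z - 1) < d"
  shows "(\<lambda>w. c * u w - ln (cmod (1 - cnj z * w))) \<in> log_minorants C z"
  unfolding log_minorants_def
proof (intro CollectI conjI ballI)
  have hl: "harmonic_on (\<lambda>w. ln (cmod (1 - cnj z * w))) C"
    using C z one_minus_cnj_mult_nonzero[OF z]
    by (intro harmonic_on_ln_cmod holomorphic_intros) (auto simp: subset_iff less_imp_le)
  show "harmonic_on (\<lambda>w. c * u w - ln (cmod (1 - cnj z * w))) C"
    by (intro harmonic_on_diff harmonic_on_cmult u hl)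
  have far: "c * u w \<le> disc_green w z" if w: "w \<in> C" "d \<le> cmod (w - 1)" for w
    using mult_left_mono[OF u(3)[OF w(1)] c] est[of w] w C by auto
  have zC: "z \<in> C" using z zd C by (auto simp: dist_norm norm_minus_commute)
  have contu: "continuous_on C u" using u(1) harmonic_on_continuous by blast
  fix v assume v: "v \<in> C - {z}"
  have "c * u v - disc_green v z \<le> 0"
  proof (cases "d \<le> cmod (v - 1)")
    case True
    then show ?thesis using far v by simp
  next
    case False
    let ?W = "ball 0 1 \<inter> ball 1 d - {z}"
    have WC: "?W \<subseteq> C" using C by auto
    have W: "\<forall>\<^sub>F w in at \<xi> within ?W. w \<in> ?W" for \<xi> :: complex by (auto simp: eventually_at_filter)
    have oW: "open ?W" by (intro open_Diff open_Int open_ball) auto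
    show ?thesis
    proof (rule harmonic_on_maximum_principle[where h="\<lambda>w. c * u w - disc_green w z" and z=v])
      have "harmonic_on (\<lambda>w. ln (cmod (w - z))) ?W"
        by (intro harmonic_on_ln_cmod holomorphic_intros oW) auto
      then show "harmonic_on (\<lambda>w. c * u w - disc_green w z) ?W" unfolding disc_green_def
        by (intro harmonic_on_diff harmonic_on_cmult harmonic_on_subset[OF u(1) oW WC] harmonic_on_subset[OF hl oW WC])
      show "bounded ?W" by (intro bounded_diff bounded_Int) auto
      show "v \<in> ?W" using False v C by (auto simp: dist_norm norm_minus_commute)
      fix \<xi> :: complex and e :: real assume \<xi>: "\<xi> \<in> frontier ?W" and e: "e > 0"
      consider (1) "cmod \<xi> = 1" "cmod (\<xi> - 1) \<le> d" | (2) "cmod \<xi> < 1" "cmod (\<xi> - 1) = d" | (3) "\<xi> = z"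
        using frontier_lens[OF _ \<xi>] by auto
      then show "\<forall>\<^sub>F w in at \<xi> within ?W. c * u w - disc_green w z \<le> e"
      proof cases
        case 1
        \<comment> \<open>The barrier is singular only at -1, which \<open>d \<le> 1\<close> keeps
          away from the lens.\<close>
        have "\<xi> \<noteq> - 1" using 1 d by auto
        from tendsto_poisson_uminus[OF this]
        have "((\<lambda>w. c * (4 / d\<^sup>2 * poisson (- w))) \<longlongrightarrow> c * (4 / d\<^sup>2 * poisson (- \<xi>))) (at \<xi> within ?W)"
          by (intro tendsto_intros)
        moreover have "poisson (- \<xi>) = 0" using 1 by (simp add: poisson_eq)
        ultimately have "\<forall>\<^sub>F w in at \<xi> within ?W. c * (4 / d\<^sup>2 * poisson (- w)) < e"
          using e by (intro order_tendstoD(2)) auto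
        then show ?thesis using W
        proof eventually_elim
          case (elim w)
          then have "w \<in> C" "w \<in> ball 0 1" "w \<noteq> z" using WC by auto
          then have "c * u w \<le> c * (4 / d\<^sup>2 * poisson (- w))" "0 \<le> disc_green w z"
            using mult_left_mono[OF u(4) c, of w] disc_green_nonneg[OF z, of w] by (simp_all add: less_imp_le)
          then show ?case using elim by linarith
        qed
      next
        case 2
        then have \<xi>C: "\<xi> \<in> C" and "\<xi> \<noteq> z" using C zd by (auto simp: dist_norm norm_minus_commute)
        then have "((\<lambda>w. c * u w - disc_green w z) \<longlongrightarrow> c * u \<xi> - disc_green \<xi> z) (at \<xi> within ?W)"
          using contu WC 2
          by (intro tendsto_intros tendsto_disc_green[OF z]) (auto simp: continuous_on_def intro: tendsto_within_subset)
        moreover have "c * u \<xi> - disc_green \<xi> z < e" using far[OF \<xi>C] 2 e by simp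
        ultimately have "\<forall>\<^sub>F w in at \<xi> within ?W. c * u w - disc_green w z < e" by (rule order_tendstoD(2))
        then show ?thesis by eventually_elim simp
      next
        case 3
        have "(u \<longlongrightarrow> u z) (at z within ?W)"
          using contu zC WC by (auto simp: continuous_on_def intro: tendsto_within_subset)
        moreover have "1 - cnj z * z \<noteq> 0" using one_minus_cnj_mult_nonzero[OF z, of z] z by simp
        ultimately have "((\<lambda>w. c * u w - ln (cmod (1 - cnj z * w))) \<longlongrightarrow> c * u z - ln (cmod (1 - cnj z * z))) (at z within ?W)"
          by (intro tendsto_intros) auto
        then have 1: "\<forall>\<^sub>F w in at z within ?W. c * u w - ln (cmod (1 - cnj z * w)) < c * u z - ln (cmod (1 - cnj z * z)) + 1"
          by (rule order_tendstoD(2)) simp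
        have "filterlim (\<lambda>w. cmod (w - z)) (at_right 0) (at z within ?W)"
          unfolding filterlim_at
        proof
          show "\<forall>\<^sub>F w in at z within ?W. cmod (w - z) \<in> {0<..} \<and> cmod (w - z) \<noteq> 0"
            using W by eventually_elim auto
          have "((\<lambda>w. cmod (w - z)) \<longlongrightarrow> cmod (z - z)) (at z within ?W)" by (intro tendsto_intros)
          then show "((\<lambda>w. cmod (w - z)) \<longlongrightarrow> 0) (at z within ?W)" by simp
        qed
        from filterlim_compose[OF ln_at_0 this] 
        have "filterlim (\<lambda>w. ln (cmod (w - z))) at_bot (at z within ?W)" .
        then have "\<forall>\<^sub>F w in at z within ?W. ln (cmod (w - z)) \<le> - (c * u z - ln (cmod (1 - cnj z * z)) + 1)"
          by (simp add: filterlim_at_bot)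
        with 1 show ?thesis unfolding 3
        proof eventually_elim
          case (elim w)
          then show ?case using e unfolding disc_green_def by linarith
        qed
      qed
    qed
  qed
  then show "c * u v - ln (cmod (1 - cnj z * v)) \<le> - ln (cmod (v - z))" by (simp add: disc_green_def)
qed

section \<open>Existence of the relative capacity\<close>

text \<open>Arbitrary filters and curves with the prescribed limiting direction are allowed, and the
  constant is chosen before the curve. The result is applied both to the perpendicular arcs in
  \<open>relcap\<close> and to the image of the radius under \<open>f\<close>, which need not be an
  arc.\<close>

lemma inner_radius_ratio_expansion:
  assumes G: "open G" "G \<subseteq> ball 0 1" and r: "r > 0" "ball 0 1 \<inter> ball 1 r \<subseteq> G"
  shows "\<exists>c. \<forall>(F::real filter) \<gamma>. (\<gamma> \<longlongrightarrow> 1) F \<longrightarrow> (\<forall>\<^sub>F t in F. \<gamma> t \<in> ball 0 1) \<longrightarrow> 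
     ((\<lambda>t. sgn (\<gamma> t - 1)) \<longlongrightarrow> - 1) F \<longrightarrow>
     ((\<lambda>t. (inner_radius G (\<gamma> t) / inner_radius (ball 0 1) (\<gamma> t) - 1) / (cmod (\<gamma> t - 1))\<^sup>2) \<longlongrightarrow> - 2 * c) F"
proof -
  have bdG: "bounded G" using G(2) bounded_subset bounded_ball by blast
  \<comment> \<open>\<open>d < r\<close> keeps the closed lens inside \<open>G\<close>;
    \<open>d \<le> 1\<close> keeps it away from -1.\<close>
  define d where "d = min 1 (r / 2)"
  have d: "0 < d" "d \<le> 1" "d < r" using r by (auto simp: d_def min_def)
  have sub: "ball 0 1 \<inter> cball 1 d \<subseteq> G" using r(2) d(3) by auto
  have p: "of_real (1 - d / 2) \<in> ball (0::complex) 1 \<inter> cball 1 d"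
  proof -
    have "(1::complex) - of_real (1 - d / 2) = of_real (d / 2)" by simp
    then have "dist (1::complex) (of_real (1 - d / 2)) = d / 2" unfolding dist_norm using d by (simp only: norm_of_real)
    moreover have "cmod (of_real (1 - d / 2)) = 1 - d / 2" using d by (simp only: norm_of_real)
    ultimately show ?thesis using d by simp
  qed
  \<comment> \<open>Any point of the lens would do as base point: the lens is convex, hence
    contained in a single component.\<close>
  define C where "C = connected_component_set G (of_real (1 - d / 2))"
  have lens: "ball 0 1 \<inter> cball 1 d \<subseteq> C" unfolding C_def
    by (rule connected_component_maximal[OF p _ sub]) (intro convex_connected convex_Int convex_ball convex_cball)
  have C: "open C" "C \<subseteq> ball 0 1"
    using G connected_component_subset[of G] unfolding C_def by (auto simp: open_connected_component)
  have comp: "connected_component_set G z = C" if "z \<in> ball 0 1 \<inter> cball 1 d" for z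
    using lens that unfolding C_def by (metis connected_component_eq subsetD)
  let ?p2 = "\<lambda>w. 4 / d\<^sup>2 * poisson (- w)"
  have p1: "harmonic_on poisson C" "\<And>z. z \<in> C \<Longrightarrow> 0 \<le> poisson z"
    using harmonic_on_subset[OF harmonic_on_poisson(1) C] C(2) by (auto intro!: poisson_nonneg)
  have p2: "harmonic_on ?p2 C" "\<And>z. z \<in> C \<Longrightarrow> 0 \<le> ?p2 z"
    by (intro harmonic_on_cmult harmonic_on_subset[OF harmonic_on_poisson(2) C])
      (use C(2) in \<open>auto intro!: poisson_nonneg divide_nonneg_nonneg simp: subset_iff less_imp_le\<close>)
  obtain u where u: "harmonic_on u C" "\<And>z. z \<in> C \<Longrightarrow> 0 \<le> u z" 
    "\<And>z. z \<in> C \<Longrightarrow> u z \<le> poisson z" "\<And>z. z \<in> C \<Longrightarrow> u z \<le> ?p2 z"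
    "\<forall>k. harmonic_on k C \<longrightarrow> (\<forall>z\<in>C. k z \<le> poisson z) \<longrightarrow> (\<forall>z\<in>C. k z \<le> ?p2 z) \<longrightarrow> (\<forall>z\<in>C. k z \<le> u z)"
    by (rule greatest_harmonic_minorant[OF p1 p2], assumption, assumption) (rule that)

  \<comment> \<open>The Cayley map is its own inverse and sends 1 to 0. It turns the barrier into a
    multiple of \<open>Re s\<close>, which is the linear bound that
    \<open>harmonic_boundary_derivative\<close> asks for. The radius \<open>d / 2\<close> suffices
    because \<open>cmod (1 - cay s) \<le> 2 * cmod s\<close>.\<close>
  define cay where "cay s = (1 - s) / (1 + s)" for s :: complex
  have cay_lens: "cay s \<in> ball 0 1 \<inter> cball 1 d \<and> 1 + s \<noteq> 0 \<and> cay (cay s) = s" if s: "s \<in> half_disc (d / 2)" for s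
  proof -
    have Re: "Re s > 0" and small: "cmod s < d / 2" using s by (auto simp: half_disc_def)
    have ge: "1 \<le> cmod (1 + s)" using Re complex_Re_le_cmod[of "1 + s"] by simp
    have ne: "1 + s \<noteq> 0" using ge by auto
    have "(cmod (1 - s))\<^sup>2 < (cmod (1 + s))\<^sup>2" unfolding cmod_power2 using Re by (simp add: power2_eq_square algebra_simps)
    then have "cmod (1 - s) < cmod (1 + s)" by (rule power2_less_imp_less) simp
    then have 1: "cmod (cay s) < 1" using ge by (simp add: cay_def norm_divide divide_less_eq)
    have "1 - cay s = 2 * s / (1 + s)" using ne by (simp add: cay_def field_simps)
    then have "cmod (1 - cay s) = 2 * cmod s / cmod (1 + s)" by (simp add: norm_divide norm_mult)
    also have "\<dots> \<le> 2 * cmod s / 1" using ge by (intro divide_left_mono) auto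
    also have "\<dots> \<le> d" using small by simp
    finally have 2: "cmod (1 - cay s) \<le> d" .
    have "1 + cay s = 2 / (1 + s)" "1 - cay s = 2 * s / (1 + s)" using ne by (simp_all add: cay_def field_simps)
    then have 3: "cay (cay s) = s" using ne unfolding cay_def[of "cay s"] by simp
    from 1 2 3 ne show ?thesis by (simp add: dist_norm)
  qed
  define U where "U s = u (cay s)" for s
  have "harmonic_on U (half_disc (d / 2))" unfolding U_def
  proof (rule harmonic_on_compose[OF u(1) _ open_half_disc])
    show "cay holomorphic_on half_disc (d / 2)" unfolding cay_def[abs_def]
      using cay_lens by (intro holomorphic_intros) auto
    show "cay ` half_disc (d / 2) \<subseteq> C" using cay_lens lens by blast
  qed
  moreover have "0 \<le> U s \<and> U s \<le> 4 / d\<^sup>2 * Re s" if "s \<in> half_disc (d / 2)" for s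
  proof -
    have "cay s \<in> C" using cay_lens[OF that] lens by blast
    moreover have "poisson (- cay s) = Re s" using cay_lens[OF that] by (simp add: poisson_def cay_def)
    ultimately show ?thesis using u(2) u(4)[of "cay s"] by (simp add: U_def)
  qed
  ultimately obtain D where D: "((\<lambda>s. (U s - Re (D * s)) / cmod s) \<longlongrightarrow> 0) (at 0 within {s. Re s > 0})"
    using harmonic_boundary_derivative[of U "d / 2" "4 / d\<^sup>2"] d by auto

  define \<kappa> where "\<kappa> z = (1 - (cmod z)\<^sup>2) / 2" for z
  define \<Sigma> where "\<Sigma> z = (SUP h\<in>log_minorants C z. h z) + ln (1 - (cmod z)\<^sup>2)" for z
  have ratio: "inner_radius G z / inner_radius (ball 0 1) z = exp (- \<Sigma> z)" if z: "z \<in> ball 0 1 \<inter> cball 1 d" for z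
  proof -
    have "1 - (cmod z)\<^sup>2 > 0" using z by (simp add: power_less_one_iff)
    then have "inner_radius (ball 0 1) z = exp (ln (1 - (cmod z)\<^sup>2))"
      using inner_radius_unit_disc[of z] z by simp
    moreover have "inner_radius G z = exp (- (SUP h\<in>log_minorants C z. h z))"
      using inner_radius_eq_exp_SUP(1)[OF G(1) bdG, of z] z sub comp[OF z] by auto
    ultimately show ?thesis by (simp add: \<Sigma>_def flip: exp_diff)
  qed
  \<comment> \<open>The two comparison lemmas enter with the constants
    \<open>(1 + \<epsilon>) * \<kappa> z\<close> and \<open>(1 - \<epsilon>) * \<kappa> z\<close>;
    \<open>\<epsilon> < 1\<close> keeps the second one positive.\<close>
  have squeeze: "\<exists>\<eta>>0. \<forall>z\<in>ball 0 1. cmod (z - 1) < \<eta> \<longrightarrow> 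
      0 \<le> \<Sigma> z \<and> \<bar>\<Sigma> z - \<kappa> z * u z\<bar> \<le> \<epsilon> * (\<kappa> z * u z)" if \<epsilon>: "0 < \<epsilon>" "\<epsilon> < 1" for \<epsilon>
  proof -
    obtain \<eta> where \<eta>: "\<eta> > 0" "\<And>z w. z \<in> ball 0 1 \<Longrightarrow> cmod (z - 1) < \<eta> \<Longrightarrow> w \<in> ball 0 1 \<Longrightarrow> d \<le> cmod (w - 1) \<Longrightarrow>
      (1 - \<epsilon>) * \<kappa> z * poisson w \<le> disc_green w z \<and> disc_green w z \<le> (1 + \<epsilon>) * \<kappa> z * poisson w"
      using disc_green_poisson_asymp[OF d(1) \<epsilon>(1)] unfolding \<kappa>_def by metis
    have "0 \<le> \<Sigma> z \<and> \<bar>\<Sigma> z - \<kappa> z * u z\<bar> \<le> \<epsilon> * (\<kappa> z * u z)" 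
      if z: "z \<in> ball 0 1" "cmod (z - 1) < min \<eta> d" for z
    proof -
      have zl: "z \<in> ball 0 1 \<inter> cball 1 d" using z by (auto simp: dist_norm norm_minus_commute)
      then have zG: "z \<in> G" and zC: "z \<in> C" using sub lens by auto
      have \<kappa>: "\<kappa> z > 0" using z by (simp add: \<kappa>_def power_less_one_iff)
      have est: "(1 - \<epsilon>) * \<kappa> z * poisson w \<le> disc_green w z" "disc_green w z \<le> (1 + \<epsilon>) * \<kappa> z * poisson w"
        if "w \<in> ball 0 1" "d \<le> cmod (w - 1)" for w using \<eta>(2)[OF z(1) _ that] z(2) by auto
      note sup = inner_radius_eq_exp_SUP(2,3)[OF G(1) bdG zG, unfolded comp[OF zl]]
      have "(SUP h\<in>log_minorants C z. h z) \<le> (1 + \<epsilon>) * \<kappa> z * u z - ln (1 - (cmod z)\<^sup>2)"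
      proof (rule cSUP_least[OF sup(2)])
        fix h assume h: "h \<in> log_minorants C z"
        have "h z + ln (1 - (cmod z)\<^sup>2) \<le> (1 + \<epsilon>) * \<kappa> z * u z"
          by (rule log_minorant_le[where c="(1 + \<epsilon>) * \<kappa> z" and u=u and d=d, OF C lens d(1,2) z(1) _ _ u(5) est(2) h]) (use z(2) \<epsilon> \<kappa> in auto)
        then show "h z \<le> (1 + \<epsilon>) * \<kappa> z * u z - ln (1 - (cmod z)\<^sup>2)" by simp
      qed
      then have up: "\<Sigma> z \<le> (1 + \<epsilon>) * \<kappa> z * u z" by (simp add: \<Sigma>_def)
      have "(\<lambda>w. (1 - \<epsilon>) * \<kappa> z * u w - ln (cmod (1 - cnj z * w))) \<in> log_minorants C z"
        by (rule log_minorant_of_poisson_minorant[where c="(1 - \<epsilon>) * \<kappa> z" and u=u and d=d, OF C lens d(1,2) z(1) _ u(1-4) est(1)]) (use z(2) \<epsilon> \<kappa> in auto)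
      from cSUP_upper[OF this sup(1)] 
      have "(1 - \<epsilon>) * \<kappa> z * u z - ln (cmod (1 - cnj z * z)) \<le> (SUP h\<in>log_minorants C z. h z)" .
      then have lo: "(1 - \<epsilon>) * \<kappa> z * u z \<le> \<Sigma> z" using cmod_one_minus_cnj_self[OF z(1)] by (simp add: \<Sigma>_def)
      have "0 \<le> (1 - \<epsilon>) * \<kappa> z * u z" using \<epsilon> \<kappa> u(2)[OF zC] by simp
      with up lo show ?thesis by (simp add: abs_le_iff algebra_simps)
    qed
    then show ?thesis using \<eta>(1) d by (intro exI[of _ "min \<eta> d"]) auto
  qed

  \<comment> \<open>Along a curve at distance \<open>m\<close> from 1, \<open>\<kappa>\<close>
    behaves like \<open>m\<close> and the Cayley coordinate like \<open>m / 2\<close>. So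
    \<open>u / m\<close> tends to \<open>Re D / 2\<close> and \<open>\<Sigma> / m\<^sup>2\<close> to
    \<open>L\<close>; matching \<open>- L\<close> with \<open>- 2 * c\<close> gives the witness
    \<open>L / 2\<close>.\<close>
  define L where "L = Re D / 2"
  show ?thesis
  proof (intro exI[of _ "L / 2"] allI impI)
    fix F :: "real filter" and \<gamma> :: "real \<Rightarrow> complex"
    assume lim: "(\<gamma> \<longlongrightarrow> 1) F" and ball: "\<forall>\<^sub>F t in F. \<gamma> t \<in> ball 0 1" and dir: "((\<lambda>t. sgn (\<gamma> t - 1)) \<longlongrightarrow> - 1) F"
    define m where "m t = cmod (\<gamma> t - 1)" for t
    have near: "\<forall>\<^sub>F t in F. m t < \<eta>" if "\<eta> > 0" for \<eta>
      using tendstoD[OF lim that] by (simp add: m_def dist_norm)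
    have m0: "(m \<longlongrightarrow> 0) F" unfolding m_def[abs_def] using lim by (simp add: tendsto_norm_zero LIM_zero)
    have good: "\<forall>\<^sub>F t in F. \<gamma> t \<in> ball 0 1 \<inter> cball 1 d \<and> m t > 0"
      using ball near[OF d(1)] by eventually_elim (auto simp: m_def dist_norm norm_minus_commute)
    have \<kappa>lim: "((\<lambda>t. \<kappa> (\<gamma> t) / m t) \<longlongrightarrow> 1) F"
    proof -
      \<comment> \<open>Expanding the square gives 1 - |w|^2 = - 2 Re (w - 1) - |w - 1|^2, so only
        the direction of approach enters the limit.\<close>
      have "((\<lambda>t. - Re (sgn (\<gamma> t - 1)) - m t / 2) \<longlongrightarrow> - Re (- 1) - 0 / 2) F"
        by (intro tendsto_intros dir m0) simp
      moreover have "\<forall>\<^sub>F t in F. - Re (sgn (\<gamma> t - 1)) - m t / 2 = \<kappa> (\<gamma> t) / m t"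
        using good
      proof eventually_elim
        case (elim t)
        have e: "(m t)\<^sup>2 = (cmod (\<gamma> t))\<^sup>2 - 2 * Re (\<gamma> t) + 1"
          unfolding m_def cmod_power2 by (simp add: power2_eq_square algebra_simps)
        have r: "Re (sgn (\<gamma> t - 1)) = (Re (\<gamma> t) - 1) / m t" by (simp add: m_def)
        show ?case unfolding r \<kappa>_def using elim e by (simp add: field_simps power2_eq_square)
      qed
      ultimately show ?thesis by (simp add: tendsto_cong)
    qed
    define s where "s t = cay (\<gamma> t)" for t
    have s_eq: "\<forall>\<^sub>F t in F. s t = - (sgn (\<gamma> t - 1) * of_real (m t)) / (1 + \<gamma> t) \<and> Re (s t) > 0 \<and> u (\<gamma> t) = U (s t)"
      using good
    proof eventually_elim
      case (elim t)
      have "\<gamma> t \<noteq> - 1" using elim by auto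
      then have ne: "1 + \<gamma> t \<noteq> 0" by (simp add: add_eq_0_iff)
      have "Re (s t) = (1 - (cmod (\<gamma> t))\<^sup>2) / (cmod (1 + \<gamma> t))\<^sup>2"
        using poisson_eq[of "- \<gamma> t"] by (simp add: poisson_def s_def cay_def)
      moreover have "1 - (cmod (\<gamma> t))\<^sup>2 > 0" using elim by (simp add: power_less_one_iff)
      ultimately have 1: "Re (s t) > 0" using ne by simp
      have "1 + s t = 2 / (1 + \<gamma> t)" "1 - s t = 2 * \<gamma> t / (1 + \<gamma> t)" using ne by (simp_all add: s_def cay_def field_simps)
      then have "cay (s t) = \<gamma> t" using ne unfolding cay_def by simp
      then have 2: "u (\<gamma> t) = U (s t)" by (simp add: U_def)
      have "sgn (\<gamma> t - 1) * of_real (m t) = \<gamma> t - 1" using elim by (simp add: sgn_div_norm m_def scaleR_conv_of_real)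
      then show ?case using 1 2 by (simp add: s_def cay_def)
    qed
    have slim: "((\<lambda>t. s t) \<longlongrightarrow> 0) F"
    proof -
      have "((\<lambda>t. (1 - \<gamma> t) / (1 + \<gamma> t)) \<longlongrightarrow> (1 - 1) / (1 + 1)) F" by (intro tendsto_intros lim) simp
      then show ?thesis by (simp add: s_def[abs_def] cay_def)
    qed
    have "filterlim s (at 0 within {s. Re s > 0}) F"
      unfolding filterlim_at using slim s_eq by (auto elim!: eventually_mono)
    from filterlim_compose[OF D this] have Ulim: "((\<lambda>t. (U (s t) - Re (D * s t)) / cmod (s t)) \<longlongrightarrow> 0) F" .
    have ulim: "((\<lambda>t. u (\<gamma> t) / m t) \<longlongrightarrow> L) F"
    proof -
      have "((\<lambda>t. (U (s t) - Re (D * s t)) / cmod (s t) * cmod (- sgn (\<gamma> t - 1) / (1 + \<gamma> t)) + Re (D * (- sgn (\<gamma> t - 1) / (1 + \<gamma> t))))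
         \<longlongrightarrow> 0 * cmod (- (- 1) / (1 + 1)) + Re (D * (- (- 1) / (1 + 1)))) F"
        by (intro tendsto_intros Ulim dir lim) simp_all
      moreover have "\<forall>\<^sub>F t in F. (U (s t) - Re (D * s t)) / cmod (s t) * cmod (- sgn (\<gamma> t - 1) / (1 + \<gamma> t)) + Re (D * (- sgn (\<gamma> t - 1) / (1 + \<gamma> t)))
          = u (\<gamma> t) / m t"
        using s_eq good
      proof eventually_elim
        case (elim t)
        define \<sigma> where "\<sigma> = - sgn (\<gamma> t - 1) / (1 + \<gamma> t)"
        have mt: "m t > 0" using elim by simp
        have s: "s t = of_real (m t) * \<sigma>" using elim by (simp add: \<sigma>_def)
        have \<sigma>0: "\<sigma> \<noteq> 0" using elim s by auto
        have e1: "cmod (s t) = m t * cmod \<sigma>" unfolding s using mt by (simp add: norm_mult)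
        have e2: "Re (D * s t) = m t * Re (D * \<sigma>)" unfolding s by (simp add: algebra_simps)
        have "(x - m t * B) / (m t * A) * A + B = x / m t" if "A \<noteq> 0" for x A B :: real
          using mt that by (simp add: field_simps)
        from this[of "cmod \<sigma>" "U (s t)" "Re (D * \<sigma>)"] \<sigma>0
        have "(U (s t) - Re (D * s t)) / cmod (s t) * cmod \<sigma> + Re (D * \<sigma>) = U (s t) / m t"
          unfolding e1 e2 by simp
        then show ?case using elim unfolding \<sigma>_def by simp
      qed
      ultimately show ?thesis by (simp add: tendsto_cong L_def)
    qed
    define W where "W t = \<kappa> (\<gamma> t) * u (\<gamma> t) / (m t)\<^sup>2" for t
    have Wlim: "(W \<longlongrightarrow> L) F"
      using tendsto_mult[OF \<kappa>lim ulim] by (simp add: W_def[abs_def] power2_eq_square)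
    define V where "V t = \<Sigma> (\<gamma> t) / (m t)\<^sup>2" for t
    have close: "\<forall>\<^sub>F t in F. 0 \<le> V t \<and> \<bar>V t - W t\<bar> \<le> \<epsilon> * W t" if "0 < \<epsilon>" "\<epsilon> < 1" for \<epsilon>
    proof -
      from squeeze[OF that] obtain \<eta> where \<eta>: "\<eta> > 0" "\<forall>z\<in>ball 0 1. cmod (z - 1) < \<eta> \<longrightarrow> 
        0 \<le> \<Sigma> z \<and> \<bar>\<Sigma> z - \<kappa> z * u z\<bar> \<le> \<epsilon> * (\<kappa> z * u z)" by blast
      show ?thesis using near[OF \<eta>(1)] good
      proof eventually_elim
        case (elim t)
        then have "0 \<le> \<Sigma> (\<gamma> t)" and *: "\<bar>\<Sigma> (\<gamma> t) - \<kappa> (\<gamma> t) * u (\<gamma> t)\<bar> \<le> \<epsilon> * (\<kappa> (\<gamma> t) * u (\<gamma> t))" 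
          using \<eta>(2) by (auto simp: m_def)
        moreover have "\<bar>V t - W t\<bar> = \<bar>\<Sigma> (\<gamma> t) - \<kappa> (\<gamma> t) * u (\<gamma> t)\<bar> / (m t)\<^sup>2"
          by (simp add: V_def W_def flip: diff_divide_distrib)
        ultimately show ?case using divide_right_mono[OF *, of "(m t)\<^sup>2"] by (simp add: V_def W_def)
      qed
    qed
    have "((\<lambda>t. V t - W t) \<longlongrightarrow> 0) F"
    proof (rule tendstoI)
      fix e :: real assume e: "e > 0"
      define \<epsilon> where "\<epsilon> = min (1 / 2) (e / (2 * (\<bar>L\<bar> + 1)))"
      have \<epsilon>: "0 < \<epsilon>" "\<epsilon> < 1" using e by (auto simp: \<epsilon>_def min_def)
      have "\<forall>\<^sub>F t in F. W t < \<bar>L\<bar> + 1" using Wlim by (rule order_tendstoD(2)) simp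
      with close[OF \<epsilon>] show "\<forall>\<^sub>F t in F. dist (V t - W t) 0 < e"
      proof eventually_elim
        case (elim t)
        then have "\<bar>V t - W t\<bar> \<le> \<epsilon> * (\<bar>L\<bar> + 1)" using \<epsilon> by (meson less_imp_le mult_left_mono order_trans)
        also have "\<dots> \<le> e / (2 * (\<bar>L\<bar> + 1)) * (\<bar>L\<bar> + 1)" by (intro mult_right_mono) (auto simp: \<epsilon>_def)
        also have "\<dots> = e / 2" by (simp add: field_simps)
        finally show ?case using e by (simp add: dist_real_def)
      qed
    qed
    from tendsto_add[OF this Wlim] have Vlim: "(V \<longlongrightarrow> L) F" by simp
    \<comment> \<open>For x \<ge> 0 the exponential satisfies 1 - x \<le> exp (- x) \<le> 1 - x +
      x^2. With x = \<open>\<Sigma> (\<gamma> t)\<close> the quadratic error divided by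
      \<open>(m t)\<^sup>2\<close> is \<open>(V t)\<^sup>2 * (m t)\<^sup>2\<close>, which tends to
      0.\<close>
    have "((\<lambda>t. (exp (- \<Sigma> (\<gamma> t)) - 1) / (m t)\<^sup>2) \<longlongrightarrow> - L) F"
    proof (rule tendsto_sandwich)
      show "((\<lambda>t. - V t) \<longlongrightarrow> - L) F" by (intro tendsto_intros Vlim)
      have "((\<lambda>t. - V t + (V t)\<^sup>2 * (m t)\<^sup>2) \<longlongrightarrow> - L + L\<^sup>2 * 0\<^sup>2) F" by (intro tendsto_intros Vlim m0)
      then show "((\<lambda>t. - V t + (V t)\<^sup>2 * (m t)\<^sup>2) \<longlongrightarrow> - L) F" by simp
      have ev: "\<forall>\<^sub>F t in F. 0 \<le> \<Sigma> (\<gamma> t) \<and> m t > 0"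
        using close[of "1 / 2", simplified] good
      proof eventually_elim
        case (elim t)
        then show ?case by (auto simp: V_def zero_le_divide_iff)
      qed
      then show "\<forall>\<^sub>F t in F. - V t \<le> (exp (- \<Sigma> (\<gamma> t)) - 1) / (m t)\<^sup>2"
      proof eventually_elim
        case (elim t)
        have "- \<Sigma> (\<gamma> t) \<le> exp (- \<Sigma> (\<gamma> t)) - 1" using exp_ge_add_one_self[of "- \<Sigma> (\<gamma> t)"] by simp
        from divide_right_mono[OF this, of "(m t)\<^sup>2"] show ?case by (simp add: V_def)
      qed
      from ev show "\<forall>\<^sub>F t in F. (exp (- \<Sigma> (\<gamma> t)) - 1) / (m t)\<^sup>2 \<le> - V t + (V t)\<^sup>2 * (m t)\<^sup>2"
      proof eventually_elim
        case (elim t)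
        define x where "x = \<Sigma> (\<gamma> t)"
        have x: "x \<ge> 0" using elim by (simp add: x_def)
        have "exp (- x) \<le> 1 / (1 + x)"
          using exp_ge_add_one_self[of x] x by (simp add: exp_minus inverse_eq_divide divide_left_mono)
        also have "\<dots> \<le> 1 - x + x\<^sup>2"
        proof -
          have "(1 - x + x\<^sup>2) * (1 + x) = 1 + x ^ 3" by (simp add: algebra_simps power2_eq_square power3_eq_cube)
          then have "1 \<le> (1 - x + x\<^sup>2) * (1 + x)" using x by simp
          then show ?thesis using x by (subst pos_divide_le_eq) auto
        qed
        finally have "exp (- x) - 1 \<le> - x + x\<^sup>2" by simp
        from divide_right_mono[OF this, of "(m t)\<^sup>2"]
        have "(exp (- x) - 1) / (m t)\<^sup>2 \<le> - (x / (m t)\<^sup>2) + x\<^sup>2 / (m t)\<^sup>2" by (simp add: add_divide_distrib diff_divide_distrib)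
        also have "x\<^sup>2 / (m t)\<^sup>2 = (x / (m t)\<^sup>2)\<^sup>2 * (m t)\<^sup>2" using elim by (simp add: power2_eq_square)
        finally show ?case by (simp add: V_def x_def)
      qed
    qed
    moreover have "\<forall>\<^sub>F t in F. (exp (- \<Sigma> (\<gamma> t)) - 1) / (m t)\<^sup>2 = 
       (inner_radius G (\<gamma> t) / inner_radius (ball 0 1) (\<gamma> t) - 1) / (cmod (\<gamma> t - 1))\<^sup>2"
      using good by eventually_elim (simp add: ratio m_def)
    ultimately show "((\<lambda>t. (inner_radius G (\<gamma> t) / inner_radius (ball 0 1) (\<gamma> t) - 1) / (cmod (\<gamma> t - 1))\<^sup>2) \<longlongrightarrow> - 2 * (L / 2)) F"
      by (simp add: tendsto_cong)
  qed
qed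

section \<open>Boundary expansions of class B functions\<close>

text \<open>The hypotheses describe the sector of half-angle pi/4. The angle pi/3 leaves room for
  the strict inequality and is still admissible in \<open>class_B\<close>.\<close>

lemma stolz_angleI:
  assumes "z \<in> ball 0 1" "Re (1 - z) > 0" "\<bar>Im (1 - z)\<bar> \<le> Re (1 - z)"
  shows "z \<in> stolz_angle (pi / 3)"
proof -
  define T where "T = Im (1 - z) / Re (1 - z)"
  have "\<bar>T\<bar> \<le> 1" using assms(2,3) unfolding T_def by (simp add: abs_divide divide_le_eq)
  then have "- 1 \<le> T" "T \<le> 1" by linarith+
  then have "arctan (- 1) \<le> arctan T" "arctan T \<le> arctan 1"
    unfolding arctan_le_iff by simp_all
  moreover have "arctan (- 1) = - (pi / 4)" "arctan 1 = pi / 4" by (simp_all add: arctan_minus arctan_one)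
  moreover have "Arg (1 - z) = arctan T" using assms(2) unfolding T_def by (rule arg_conv_arctan)
  ultimately have "\<bar>Arg (1 - z)\<bar> < pi / 3" using pi_gt_zero by (simp only: abs_less_iff) linarith
  then show ?thesis using assms(1) by (simp add: stolz_angle_def)
qed

text \<open>Discs whose radius is proportional to the distance from 1 stay in one Stolz angle. This
  is what allows Cauchy's inequality to differentiate the remainder.\<close>

lemma cball_subset_stolz_angle:
  assumes x: "0 < x" "x < 1" and z: "z \<in> cball (of_real x) ((1 - x) / 2)"
  shows "z \<in> stolz_angle (pi / 3)" "z \<in> ball 0 1" "z \<noteq> 1" "cmod (z - 1) \<le> 3 / 2 * (1 - x)"
proof -
  have d: "cmod (z - of_real x) \<le> (1 - x) / 2" using z by (simp add: dist_norm norm_minus_commute)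
  have "cmod z \<le> cmod (z - of_real x) + x" using norm_triangle_ineq[of "z - of_real x" "of_real x"] x by simp
  also have "\<dots> < 1" using d x by simp
  finally show 1: "z \<in> ball 0 1" by simp
  have re: "Re (1 - z) \<ge> (1 - x) / 2" 
    using abs_Re_le_cmod[of "z - of_real x"] d by simp
  have im: "\<bar>Im (1 - z)\<bar> \<le> (1 - x) / 2" 
    using abs_Im_le_cmod[of "z - of_real x"] d by simp
  have pos: "(1 - x) / 2 > 0" using x by simp
  show "z \<in> stolz_angle (pi / 3)"
    by (rule stolz_angleI[OF 1]) (use re im pos in linarith)+
  show "z \<noteq> 1" using 1 by auto
  have "cmod (z - 1) \<le> cmod (z - of_real x) + cmod (of_real x - 1)"
    using norm_triangle_ineq[of "z - of_real x" "of_real x - 1"] by simp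
  also have "cmod (of_real x - 1) = 1 - x"
    using x norm_of_real[of "x - 1", where 'a=complex] by simp
  finally show "cmod (z - 1) \<le> 3 / 2 * (1 - x)" using d by simp
qed

text \<open>The expansion of \<open>f\<close> says nothing directly about its derivative. Cauchy's
  inequality on discs of radius \<open>(1 - x) / 2\<close> bounds the derivative of the remainder at
  the cost of one power of \<open>1 - x\<close>.\<close>

lemma stolz_remainder_tendsto:
  assumes R: "R holomorphic_on ball 0 1" and o: "R \<in> o[at 1 within stolz_angle (pi / 3)](\<lambda>z. (z - 1) ^ 3)"
  shows "((\<lambda>x. R (of_real x) / of_real (x - 1) ^ 3) \<longlongrightarrow> 0) (at_left 1)"
    and "((\<lambda>x. deriv R (of_real x) / of_real (x - 1) ^ 2) \<longlongrightarrow> 0) (at_left 1)"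
proof -
  have small: "\<forall>\<^sub>F x in at_left 1. 0 < x \<and> x < 1 \<and> 
      (\<forall>z\<in>cball (of_real x) ((1 - x) / 2). cmod (R z) \<le> e * (3 / 2 * (1 - x)) ^ 3)" if e: "e > 0" for e
  proof -
    from landau_o.smallD[OF o e] obtain \<delta> where \<delta>: "\<delta> > 0" 
      "\<And>z. z \<in> stolz_angle (pi / 3) \<Longrightarrow> z \<noteq> 1 \<Longrightarrow> dist z 1 < \<delta> \<Longrightarrow> cmod (R z) \<le> e * cmod ((z - 1) ^ 3)"
      unfolding eventually_at by blast
    have "\<forall>\<^sub>F x in at_left 1. x \<in> {max 0 (1 - \<delta> / 2)<..<1}" using \<delta> by (intro eventually_at_left_real) auto
    then show ?thesis
    proof eventually_elim
      case (elim x)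
      then have x: "0 < x" "x < 1" "1 - \<delta> / 2 < x" by auto
      have "cmod (R z) \<le> e * (3 / 2 * (1 - x)) ^ 3" if z: "z \<in> cball (of_real x) ((1 - x) / 2)" for z
      proof -
        note zz = cball_subset_stolz_angle[OF x(1,2) z]
        have "dist z 1 < \<delta>" using zz(4) x(2,3) by (simp add: dist_norm)
        from \<delta>(2)[OF zz(1,3) this] have "cmod (R z) \<le> e * cmod (z - 1) ^ 3" by (simp add: norm_power)
        also have "\<dots> \<le> e * (3 / 2 * (1 - x)) ^ 3" using zz(4) e by (intro mult_left_mono power_mono) auto
        finally show ?thesis .
      qed
      with x show ?case by blast
    qed
  qed
  show "((\<lambda>x. R (of_real x) / of_real (x - 1) ^ 3) \<longlongrightarrow> 0) (at_left 1)"
  proof (rule tendstoI)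
    fix e :: real assume e: "e > 0"
    \<comment> \<open>The divisor 4 works because (3/2)^3 / 4 = 27/32 < 1. For the derivative the
      divisor 8 gives the same number, as the radius in Cauchy's inequality contributes a factor
      2.\<close>
    from small[of "e / 4"] e have "\<forall>\<^sub>F x in at_left 1. 0 < x \<and> x < 1 \<and> 
      (\<forall>z\<in>cball (of_real x) ((1 - x) / 2). cmod (R z) \<le> e / 4 * (3 / 2 * (1 - x)) ^ 3)" by simp
    then show "\<forall>\<^sub>F x in at_left 1. dist (R (of_real x) / of_real (x - 1) ^ 3) 0 < e"
    proof eventually_elim
      case (elim x)
      then have x: "0 < x" "x < 1" by auto
      have "cmod (R (of_real x)) \<le> e / 4 * (3 / 2 * (1 - x)) ^ 3" using elim by auto
      also have "\<dots> = 27 / 32 * e * (1 - x) ^ 3" unfolding power_mult_distrib by (simp add: power_divide)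
      also have "\<dots> < e * (1 - x) ^ 3" using e x by (intro mult_strict_right_mono) auto
      finally have "cmod (R (of_real x)) < e * (1 - x) ^ 3" .
      moreover have "cmod (of_real (x - 1) ^ 3) = (1 - x) ^ 3" using x by (simp add: norm_power del: of_real_diff)
      ultimately show ?case using x by (simp add: norm_divide divide_less_eq del: of_real_diff)
    qed
  qed
  show "((\<lambda>x. deriv R (of_real x) / of_real (x - 1) ^ 2) \<longlongrightarrow> 0) (at_left 1)"
  proof (rule tendstoI)
    fix e :: real assume e: "e > 0"
    from small[of "e / 8"] e have "\<forall>\<^sub>F x in at_left 1. 0 < x \<and> x < 1 \<and> 
      (\<forall>z\<in>cball (of_real x) ((1 - x) / 2). cmod (R z) \<le> e / 8 * (3 / 2 * (1 - x)) ^ 3)" by simp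
    then show "\<forall>\<^sub>F x in at_left 1. dist (deriv R (of_real x) / of_real (x - 1) ^ 2) 0 < e"
    proof eventually_elim
      case (elim x)
      then have x: "0 < x" "x < 1" by auto
      have sub: "cball (complex_of_real x) ((1 - x) / 2) \<subseteq> ball 0 1"
        using cball_subset_stolz_angle(2)[OF x] by blast
      have "cmod ((deriv ^^ 1) R (of_real x)) \<le> fact 1 * (e / 8 * (3 / 2 * (1 - x)) ^ 3) / ((1 - x) / 2) ^ 1"
      proof (rule Cauchy_inequality)
        show "R holomorphic_on ball (of_real x) ((1 - x) / 2)"
          by (rule holomorphic_on_subset[OF R]) (use sub ball_subset_cball in blast)
        show "continuous_on (cball (of_real x) ((1 - x) / 2)) R"
          by (rule continuous_on_subset[OF holomorphic_on_imp_continuous_on[OF R] sub])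
        show "cmod (R z) \<le> e / 8 * (3 / 2 * (1 - x)) ^ 3" if "cmod (of_real x - z) = (1 - x) / 2" for z
          using elim that by (auto simp: dist_norm)
      qed (use x in simp)
      also have "\<dots> = 27 / 32 * e * (1 - x) ^ 2"
        using x unfolding power_mult_distrib by (simp add: power_divide power3_eq_cube power2_eq_square field_simps)
      also have "\<dots> < e * (1 - x) ^ 2" using e x by (intro mult_strict_right_mono) auto
      finally have "cmod (deriv R (of_real x)) < e * (1 - x) ^ 2" by simp
      moreover have "cmod (of_real (x - 1) ^ 2) = (1 - x) ^ 2" using x by (simp add: norm_power del: of_real_diff)
      ultimately show ?case using x by (simp add: norm_divide divide_less_eq del: of_real_diff)
    qed
  qed
qed

text \<open>
  The normalization \<open>a = 2 * Re b + 1\<close> makes the linear terms of \<open>X\<close> and \<open>N\<close> agree.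
\<close>

lemma hyperbolic_distortion_algebra:
  fixes a s :: real and b p q :: complex
  defines "h \<equiv> 2 * Re q + (Re b + Re q * s)\<^sup>2 + (Im b + Im q * s)\<^sup>2"
  defines "N \<equiv> 1 + (2 * Re b + 1 / 2) * s + s\<^sup>2 * (Re q + a * Re b + a * s * h / 2)"
  defines "X \<equiv> 1 + (2 * Re b + 1 / 2) * s + s\<^sup>2 * (Re p + Re b + Re p * s / 2)"
  defines "K \<equiv> Re p + Re b + Re p * s / 2 - (Re q + a * Re b + a * s * h / 2)"
  assumes a: "a = 2 * Re b + 1" "a > 0" and s: "s \<noteq> 0" and N: "N \<noteq> 0"
  shows "(cmod (of_real a * (1 + 2 * b * of_real s + p * (of_real s)\<^sup>2)) * (1 - (1 + s)\<^sup>2) / (1 - (cmod (1 + of_real a * of_real s * (1 + b * of_real s + q * (of_real s)\<^sup>2)))\<^sup>2))\<^sup>2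
     = 1 + s\<^sup>2 * ((K * (X + N) + (2 * Im b + Im p * s)\<^sup>2 * (1 + s / 2)\<^sup>2) / N\<^sup>2)"
proof -
  have re: "Re (1 + 2 * b * of_real s + p * (of_real s)\<^sup>2) = 1 + 2 * Re b * s + Re p * s\<^sup>2" 
    "Im (1 + 2 * b * of_real s + p * (of_real s)\<^sup>2) = 2 * Im b * s + Im p * s\<^sup>2"
    "Re (1 + b * of_real s + q * (of_real s)\<^sup>2) = 1 + Re b * s + Re q * s\<^sup>2" 
    "Im (1 + b * of_real s + q * (of_real s)\<^sup>2) = Im b * s + Im q * s\<^sup>2"
    by (simp_all flip: of_real_power)
  \<comment> \<open>Since 1 - (1 + s)^2 = - 2 s (1 + s / 2) and the denominator is
    \<open>- 2 * a * s * N\<close>, the factors \<open>- 2 * a * s\<close> cancel. \<open>X\<close>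
    is the real part of what remains of the numerator; the imaginary part contributes to the squared
    modulus only at order \<open>s\<^sup>2\<close>.\<close>
  have X: "X = (1 + 2 * Re b * s + Re p * s\<^sup>2) * (1 + s / 2)"
    unfolding X_def by (simp add: algebra_simps power2_eq_square)
  have num: "(cmod (of_real a * (1 + 2 * b * of_real s + p * (of_real s)\<^sup>2)))\<^sup>2 * (1 + s / 2)\<^sup>2 = a\<^sup>2 * (X\<^sup>2 + s\<^sup>2 * ((2 * Im b + Im p * s)\<^sup>2 * (1 + s / 2)\<^sup>2))"
    unfolding norm_mult power_mult_distrib cmod_power2[of "1 + 2 * b * of_real s + p * (of_real s)\<^sup>2"] re X norm_of_real power2_abs
    by (simp add: algebra_simps power2_eq_square)
  have g: "(cmod (1 + b * of_real s + q * (of_real s)\<^sup>2))\<^sup>2 = 1 + 2 * Re b * s + s\<^sup>2 * h"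
    unfolding cmod_power2 re h_def by (simp add: algebra_simps power2_eq_square)
  have w: "(cmod (1 + of_real a * of_real s * w))\<^sup>2 = 1 + 2 * (a * s) * Re w + (a * s)\<^sup>2 * (cmod w)\<^sup>2" for w
    unfolding cmod_power2 by (simp add: algebra_simps power2_eq_square)
  have den: "1 - (cmod (1 + of_real a * of_real s * (1 + b * of_real s + q * (of_real s)\<^sup>2)))\<^sup>2 = - 2 * a * s * N"
  proof -
    have "N = Re (1 + b * of_real s + q * (of_real s)\<^sup>2) + (a * s / 2) * (cmod (1 + b * of_real s + q * (of_real s)\<^sup>2))\<^sup>2"
      unfolding g re N_def using a(1) by (simp add: field_simps power2_eq_square)
    then show ?thesis unfolding w by (simp add: algebra_simps power2_eq_square)
  qed
  have XN: "X\<^sup>2 = N\<^sup>2 + s\<^sup>2 * (K * (X + N))"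
  proof -
    have "X - N = s\<^sup>2 * K" unfolding X_def N_def K_def by (simp add: algebra_simps)
    then have "(X - N) * (X + N) = s\<^sup>2 * (K * (X + N))" by simp
    then show ?thesis by (simp add: algebra_simps power2_eq_square)
  qed
  have s2: "(1 - (1 + s)\<^sup>2)\<^sup>2 = 4 * s\<^sup>2 * (1 + s / 2)\<^sup>2" by (simp add: algebra_simps power2_eq_square)
  have "(cmod (of_real a * (1 + 2 * b * of_real s + p * (of_real s)\<^sup>2)) * (1 - (1 + s)\<^sup>2) / (- 2 * a * s * N))\<^sup>2
     = ((cmod (of_real a * (1 + 2 * b * of_real s + p * (of_real s)\<^sup>2)))\<^sup>2 * (1 + s / 2)\<^sup>2) * (4 * s\<^sup>2) / (4 * s\<^sup>2 * a\<^sup>2 * N\<^sup>2)"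
    unfolding power_divide power_mult_distrib s2 by simp
  also have "\<dots> = (X\<^sup>2 + s\<^sup>2 * ((2 * Im b + Im p * s)\<^sup>2 * (1 + s / 2)\<^sup>2)) / N\<^sup>2"
    unfolding num using a s by simp
  also have "\<dots> = 1 + s\<^sup>2 * ((K * (X + N) + (2 * Im b + Im p * s)\<^sup>2 * (1 + s / 2)\<^sup>2) / N\<^sup>2)"
    unfolding XN using N by (simp add: add_divide_distrib distrib_left)
  finally show ?thesis unfolding den .
qed

text \<open>The remainders are absorbed into variable coefficients \<open>p\<close> and
  \<open>q\<close>. On the radius both expansions become exact identities, and the later limit only
  needs continuity of an algebraic expression.\<close>

lemma class_B_boundary_form:
  assumes B: "class_B f a1 a2 a3"
  obtains p q :: "real \<Rightarrow> complex" where
    "(p \<longlongrightarrow> 3 * a3 / of_real a1) (at_left 1)" "(q \<longlongrightarrow> a3 / of_real a1) (at_left 1)"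
    "\<And>x. 0 < x \<Longrightarrow> x < 1 \<Longrightarrow> f (of_real x) = 1 + of_real a1 * of_real (x - 1) * (1 + a2 / of_real a1 * of_real (x - 1) + q x * (of_real (x - 1))\<^sup>2)"
    "\<And>x. 0 < x \<Longrightarrow> x < 1 \<Longrightarrow> deriv f (of_real x) = of_real a1 * (1 + 2 * (a2 / of_real a1) * of_real (x - 1) + p x * (of_real (x - 1))\<^sup>2)"
proof -
  have f: "f holomorphic_on ball 0 1" and a1: "a1 > 0" using B by (auto simp: class_B_def)
  define R where "R z = f z - (1 + a1 * (z - 1) + a2 * (z - 1)\<^sup>2 + a3 * (z - 1) ^ 3)" for z :: complex
  have "pi / 3 \<in> {0<..<pi / 2}" by (simp add: pi_gt_zero)
  then have o: "R \<in> o[at 1 within stolz_angle (pi / 3)](\<lambda>z. (z - 1) ^ 3)"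
    using B unfolding class_B_def R_def[abs_def] by blast
  have R: "R holomorphic_on ball 0 1" unfolding R_def[abs_def] by (intro holomorphic_intros f)
  have dR: "deriv f z = a1 + 2 * a2 * (z - 1) + 3 * a3 * (z - 1)\<^sup>2 + deriv R z" if "z \<in> ball 0 1" for z
  proof -
    have "(R has_field_derivative deriv R z) (at z)" using R that holomorphic_derivI by blast
    then have "((\<lambda>z. R z + (1 + a1 * (z - 1) + a2 * (z - 1)\<^sup>2 + a3 * (z - 1) ^ 3)) has_field_derivative
       deriv R z + (a1 + 2 * a2 * (z - 1) + 3 * a3 * (z - 1)\<^sup>2)) (at z)"
      by (auto intro!: derivative_eq_intros simp: algebra_simps power2_eq_square)
    then have "(f has_field_derivative deriv R z + (a1 + 2 * a2 * (z - 1) + 3 * a3 * (z - 1)\<^sup>2)) (at z)"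
      by (simp add: R_def)
    then show ?thesis by (auto dest!: DERIV_imp_deriv)
  qed
  define q where "q x = (a3 + R (of_real x) / of_real (x - 1) ^ 3) / a1" for x :: real
  define p where "p x = (3 * a3 + deriv R (of_real x) / of_real (x - 1) ^ 2) / a1" for x :: real
  show thesis
  proof (rule that[of p q])
    have "(p \<longlongrightarrow> (3 * a3 + 0) / a1) (at_left 1)" "(q \<longlongrightarrow> (a3 + 0) / a1) (at_left 1)"
      unfolding p_def q_def using a1 by (intro tendsto_intros stolz_remainder_tendsto[OF R o]; simp)+
    then show "(p \<longlongrightarrow> 3 * a3 / of_real a1) (at_left 1)" "(q \<longlongrightarrow> a3 / of_real a1) (at_left 1)" by simp_all
    fix x :: real assume x: "0 < x" "x < 1"
    define t :: complex where "t = of_real (x - 1)"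
    have t: "t \<noteq> 0" "of_real x - 1 = t" "complex_of_real x \<in> ball 0 1" using x by (auto simp: t_def)
    have "R (of_real x) = f (of_real x) - (1 + a1 * t + a2 * t\<^sup>2 + a3 * t ^ 3)" using t(2) by (simp add: R_def)
    then have "f (of_real x) = 1 + a1 * t + a2 * t\<^sup>2 + (a3 + R (of_real x) / t ^ 3) * t ^ 3"
      using t(1) by (simp add: algebra_simps)
    also have "a3 + R (of_real x) / t ^ 3 = a1 * q x" using a1 by (simp add: q_def t_def)
    finally show "f (of_real x) = 1 + of_real a1 * of_real (x - 1) * (1 + a2 / of_real a1 * of_real (x - 1) + q x * (of_real (x - 1))\<^sup>2)"
      using a1 by (simp add: t(2) algebra_simps power2_eq_square power3_eq_cube)
    have "deriv f (of_real x) = a1 + 2 * a2 * t + (3 * a3 + deriv R (of_real x) / t ^ 2) * t ^ 2"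
      using dR[OF t(3)] t by (simp add: algebra_simps)
    also have "3 * a3 + deriv R (of_real x) / t ^ 2 = a1 * p x" using a1 by (simp add: p_def t_def)
    finally show "deriv f (of_real x) = of_real a1 * (1 + 2 * (a2 / of_real a1) * of_real (x - 1) + p x * (of_real (x - 1))\<^sup>2)"
      using a1 by (simp add: t(2) algebra_simps)
  qed
qed

text \<open>The quotient is the hyperbolic derivative of \<open>f\<close> on the radius, squared so
  as to be rational in real and imaginary parts. The other limits certify that the image of the
  radius approaches 1 perpendicularly, and at what rate.\<close>

lemma class_B_hyperbolic_distortion:
  assumes B: "class_B f a1 a2 a3"
  shows "((\<lambda>x. ((cmod (deriv f (of_real x)) * (1 - x\<^sup>2) / (1 - (cmod (f (of_real x)))\<^sup>2))\<^sup>2 - 1) / (x - 1)\<^sup>2)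
      \<longlongrightarrow> 4 * Re (a3 / a1 - a2\<^sup>2 / (complex_of_real a1)\<^sup>2)) (at_left 1)"
    and "((\<lambda>x. cmod (f (of_real x) - 1) / (1 - x)) \<longlongrightarrow> a1) (at_left 1)"
    and "((\<lambda>x. sgn (f (of_real x) - 1)) \<longlongrightarrow> - 1) (at_left 1)"
    and "((\<lambda>x. f (of_real x)) \<longlongrightarrow> 1) (at_left 1)"
proof -
  have a1: "a1 > 0" and norm: "Re (2 * a2 + a1 * (1 - a1)) = 0" using B by (auto simp: class_B_def)
  define b where "b = a2 / of_real a1"
  have ab: "a1 = 2 * Re b + 1"
  proof -
    have "2 * Re a2 = a1 * (a1 - 1)" using norm by (simp add: algebra_simps)
    then show ?thesis using a1 by (simp add: b_def field_simps)
  qed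
  from class_B_boundary_form[OF B] obtain p q where
    p: "(p \<longlongrightarrow> 3 * a3 / of_real a1) (at_left 1)" and q: "(q \<longlongrightarrow> a3 / of_real a1) (at_left 1)" and
    f: "\<And>x. 0 < x \<Longrightarrow> x < 1 \<Longrightarrow> f (of_real x) = 1 + of_real a1 * of_real (x - 1) * (1 + b * of_real (x - 1) + q x * (of_real (x - 1))\<^sup>2)" and
    f': "\<And>x. 0 < x \<Longrightarrow> x < 1 \<Longrightarrow> deriv f (of_real x) = of_real a1 * (1 + 2 * b * of_real (x - 1) + p x * (of_real (x - 1))\<^sup>2)"
    unfolding b_def by metis
  have x01: "\<forall>\<^sub>F x in at_left 1. 0 < x \<and> x < (1::real)"
    using eventually_at_left_real[of 0 1] by simp
  define s where "s x = x - 1" for x :: real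
  have s: "(s \<longlongrightarrow> 0) (at_left 1)"
  proof -
    have "((\<lambda>x::real. x - 1) \<longlongrightarrow> 1 - 1) (at_left 1)" by (intro tendsto_intros)
    then show ?thesis by (simp add: s_def[abs_def])
  qed
  have g: "((\<lambda>x. 1 + b * of_real (s x) + q x * (of_real (s x))\<^sup>2) \<longlongrightarrow> 1) (at_left 1)"
  proof -
    have "((\<lambda>x. 1 + b * of_real (s x) + q x * (of_real (s x))\<^sup>2) \<longlongrightarrow> 1 + b * of_real 0 + a3 / a1 * (of_real 0)\<^sup>2) (at_left 1)"
      by (intro tendsto_intros s q)
    then show ?thesis by simp
  qed
  have f_s: "f (of_real x) = 1 + of_real a1 * of_real (s x) * (1 + b * of_real (s x) + q x * (of_real (s x))\<^sup>2)" if "0 < x \<and> x < 1" for x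
    using f[of x] that by (simp add: s_def)
  have f'_s: "deriv f (of_real x) = of_real a1 * (1 + 2 * b * of_real (s x) + p x * (of_real (s x))\<^sup>2)" if "0 < x \<and> x < 1" for x
    using f'[of x] that by (simp add: s_def)
  show "((\<lambda>x. cmod (f (of_real x) - 1) / (1 - x)) \<longlongrightarrow> a1) (at_left 1)"
  proof (rule Lim_transform_eventually)
    have "((\<lambda>x. a1 * cmod (1 + b * of_real (s x) + q x * (of_real (s x))\<^sup>2)) \<longlongrightarrow> a1 * cmod 1) (at_left 1)" by (intro tendsto_intros g)
    then show "((\<lambda>x. a1 * cmod (1 + b * of_real (s x) + q x * (of_real (s x))\<^sup>2)) \<longlongrightarrow> a1) (at_left 1)" by simp
    show "\<forall>\<^sub>F x in at_left 1. a1 * cmod (1 + b * of_real (s x) + q x * (of_real (s x))\<^sup>2) = cmod (f (of_real x) - 1) / (1 - x)"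
      using x01
    proof eventually_elim
      case (elim x)
      have "cmod (f (of_real x) - 1) = \<bar>a1\<bar> * \<bar>s x\<bar> * cmod (1 + b * of_real (s x) + q x * (of_real (s x))\<^sup>2)"
        unfolding f_s[OF elim] by (simp add: norm_mult)
      also have "\<bar>a1\<bar> * \<bar>s x\<bar> = a1 * (1 - x)" using a1 elim by (simp add: s_def)
      finally show ?case using elim by simp
    qed
  qed
  show "((\<lambda>x. sgn (f (of_real x) - 1)) \<longlongrightarrow> - 1) (at_left 1)"
  proof (rule Lim_transform_eventually)
    have "((\<lambda>x. - sgn (1 + b * of_real (s x) + q x * (of_real (s x))\<^sup>2)) \<longlongrightarrow> - sgn 1) (at_left 1)" by (intro tendsto_intros g) simp
    then show "((\<lambda>x. - sgn (1 + b * of_real (s x) + q x * (of_real (s x))\<^sup>2)) \<longlongrightarrow> - 1) (at_left 1)" by simp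
    show "\<forall>\<^sub>F x in at_left 1. - sgn (1 + b * of_real (s x) + q x * (of_real (s x))\<^sup>2) = sgn (f (of_real x) - 1)"
      using x01
    proof eventually_elim
      case (elim x)
      define w where "w = 1 + b * of_real (s x) + q x * (of_real (s x))\<^sup>2"
      have "a1 * s x < 0" using a1 elim by (simp add: s_def mult_pos_neg)
      then have "sgn (a1 * s x) = - 1" by (rule sgn_neg)
      moreover have "f (of_real x) - 1 = (a1 * s x) *\<^sub>R w"
        unfolding f_s[OF elim] w_def[symmetric] by (simp add: scaleR_conv_of_real)
      ultimately have "sgn (f (of_real x) - 1) = - sgn w" by (simp add: sgn_scaleR)
      then show ?case by (simp add: w_def)
    qed
  qed
  show "((\<lambda>x. f (of_real x)) \<longlongrightarrow> 1) (at_left 1)"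
  proof (rule Lim_transform_eventually)
    have "((\<lambda>x. 1 + of_real a1 * of_real (s x) * (1 + b * of_real (s x) + q x * (of_real (s x))\<^sup>2)) \<longlongrightarrow> 1 + of_real a1 * of_real 0 * 1) (at_left 1)" by (intro tendsto_intros s g)
    then show "((\<lambda>x. 1 + of_real a1 * of_real (s x) * (1 + b * of_real (s x) + q x * (of_real (s x))\<^sup>2)) \<longlongrightarrow> 1) (at_left 1)" by simp
    show "\<forall>\<^sub>F x in at_left 1. 1 + of_real a1 * of_real (s x) * (1 + b * of_real (s x) + q x * (of_real (s x))\<^sup>2) = f (of_real x)"
      using x01 by eventually_elim (simp add: f_s)
  qed

  define h where "h x = 2 * Re (q x) + (Re b + Re (q x) * s x)\<^sup>2 + (Im b + Im (q x) * s x)\<^sup>2" for x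
  define N where "N x = 1 + (2 * Re b + 1 / 2) * s x + (s x)\<^sup>2 * (Re (q x) + a1 * Re b + a1 * s x * h x / 2)" for x
  define X where "X x = 1 + (2 * Re b + 1 / 2) * s x + (s x)\<^sup>2 * (Re (p x) + Re b + Re (p x) * s x / 2)" for x
  define K where "K x = Re (p x) + Re b + Re (p x) * s x / 2 - (Re (q x) + a1 * Re b + a1 * s x * h x / 2)" for x
  define b3 where "b3 = a3 / of_real a1"
  have p3: "(p \<longlongrightarrow> 3 * b3) (at_left 1)" and q3: "(q \<longlongrightarrow> b3) (at_left 1)" using p q by (simp_all add: b3_def)
  have h: "(h \<longlongrightarrow> 2 * Re b3 + (Re b + Re b3 * 0)\<^sup>2 + (Im b + Im b3 * 0)\<^sup>2) (at_left 1)"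
    unfolding h_def by (intro tendsto_intros q3 s)
  define h0 where "h0 = 2 * Re b3 + (Re b + Re b3 * 0)\<^sup>2 + (Im b + Im b3 * 0)\<^sup>2"
  note h = h[folded h0_def]
  have N: "(N \<longlongrightarrow> 1) (at_left 1)"
  proof -
    have "(N \<longlongrightarrow> 1 + (2 * Re b + 1 / 2) * 0 + 0\<^sup>2 * (Re b3 + a1 * Re b + a1 * 0 * h0 / 2)) (at_left 1)"
      unfolding N_def by (intro tendsto_intros q3 s h) simp
    then show ?thesis by simp
  qed
  have X: "(X \<longlongrightarrow> 1) (at_left 1)"
  proof -
    have "(X \<longlongrightarrow> 1 + (2 * Re b + 1 / 2) * 0 + 0\<^sup>2 * (Re (3 * b3) + Re b + Re (3 * b3) * 0 / 2)) (at_left 1)"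
      unfolding X_def by (intro tendsto_intros p3 s) simp
    then show ?thesis by simp
  qed
  have K: "(K \<longlongrightarrow> 2 * (Re b3 - (Re b)\<^sup>2)) (at_left 1)"
  proof -
    have "(K \<longlongrightarrow> Re (3 * b3) + Re b + Re (3 * b3) * 0 / 2 - (Re b3 + a1 * Re b + a1 * 0 * h0 / 2)) (at_left 1)"
      unfolding K_def by (intro tendsto_intros p3 q3 s h) simp_all
    then show ?thesis unfolding ab by (simp add: algebra_simps power2_eq_square)
  qed
  have "((\<lambda>x. (K x * (X x + N x) + (2 * Im b + Im (p x) * s x)\<^sup>2 * (1 + s x / 2)\<^sup>2) / (N x)\<^sup>2) \<longlongrightarrow>
     (2 * (Re b3 - (Re b)\<^sup>2) * (1 + 1) + (2 * Im b + Im (3 * b3) * 0)\<^sup>2 * (1 + 0 / 2)\<^sup>2) / 1\<^sup>2) (at_left 1)"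
    by (intro tendsto_intros p3 s N X K) simp_all
  \<comment> \<open>The contribution of \<open>Im b\<close> completes
    \<open>- (Re b)\<^sup>2\<close> to \<open>- Re (b\<^sup>2)\<close>.\<close>
  moreover have "(2 * (Re b3 - (Re b)\<^sup>2) * (1 + 1) + (2 * Im b + Im (3 * b3) * 0)\<^sup>2 * (1 + 0 / 2)\<^sup>2) / 1\<^sup>2 
      = 4 * Re (b3 - b\<^sup>2)"
    by (simp add: power2_eq_square algebra_simps)
  moreover have "b3 - b\<^sup>2 = a3 / a1 - a2\<^sup>2 / (complex_of_real a1)\<^sup>2" by (simp add: b_def b3_def power_divide)
  ultimately have lim: "((\<lambda>x. (K x * (X x + N x) + (2 * Im b + Im (p x) * s x)\<^sup>2 * (1 + s x / 2)\<^sup>2) / (N x)\<^sup>2) \<longlongrightarrow>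
     4 * Re (a3 / a1 - a2\<^sup>2 / (complex_of_real a1)\<^sup>2)) (at_left 1)" by simp
  have "\<forall>\<^sub>F x in at_left 1. N x > 0" using N by (rule order_tendstoD(1)) simp
  with x01 have "\<forall>\<^sub>F x in at_left 1. (K x * (X x + N x) + (2 * Im b + Im (p x) * s x)\<^sup>2 * (1 + s x / 2)\<^sup>2) / (N x)\<^sup>2 =
     ((cmod (deriv f (of_real x)) * (1 - x\<^sup>2) / (1 - (cmod (f (of_real x)))\<^sup>2))\<^sup>2 - 1) / (x - 1)\<^sup>2"
  proof eventually_elim
    case (elim x)
    have s0: "s x \<noteq> 0" and sx: "1 + s x = x" "x - 1 = s x" using elim by (auto simp: s_def)
    from hyperbolic_distortion_algebra[OF ab a1 s0, where p="p x" and q="q x"] elim(2)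
    have "(cmod (deriv f (of_real x)) * (1 - x\<^sup>2) / (1 - (cmod (f (of_real x)))\<^sup>2))\<^sup>2 
       = 1 + (s x)\<^sup>2 * ((K x * (X x + N x) + (2 * Im b + Im (p x) * s x)\<^sup>2 * (1 + s x / 2)\<^sup>2) / (N x)\<^sup>2)"
      unfolding f_s[OF elim(1)] f'_s[OF elim(1)] sx(1) 
      by (simp only: N_def X_def K_def h_def sx(1) less_imp_neq[symmetric] not_False_eq_True)
    then show ?case using s0 unfolding sx(2) by simp
  qed
  with lim show "((\<lambda>x. ((cmod (deriv f (of_real x)) * (1 - x\<^sup>2) / (1 - (cmod (f (of_real x)))\<^sup>2))\<^sup>2 - 1) / (x - 1)\<^sup>2)
      \<longlongrightarrow> 4 * Re (a3 / a1 - a2\<^sup>2 / (complex_of_real a1)\<^sup>2)) (at_left 1)"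
    by (rule Lim_transform_eventually)
qed

section \<open>Relative capacity as a limit, and the main inequality\<close>

lemma perpendicular_arc_radius: "perpendicular_arc (linepath 0 1)"
proof -
  have eq: "linepath 0 1 t = complex_of_real t" for t by (simp add: linepath_def scaleR_conv_of_real)
  have "\<forall>\<^sub>F t in at_left 1. - 1 = sgn (linepath 0 1 t - (1::complex))"
    using eventually_at_left_real[of 0 1, OF zero_less_one]
  proof eventually_elim
    case (elim t)
    have "sgn (linepath 0 1 t - (1::complex)) = of_real (sgn (t - 1))"
      unfolding eq by (metis of_real_1 of_real_diff sgn_of_real)
    then show ?case using elim by simp
  qed
  then have "((\<lambda>t. sgn (linepath 0 1 t - (1::complex))) \<longlongrightarrow> - 1) (at_left 1)"
    using Lim_transform_eventually tendsto_const by fast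
  then show ?thesis by (auto simp: perpendicular_arc_def eq)
qed

text \<open>Resolves the definite description in \<open>relcap\<close>: the expansion supplies one
  constant for all perpendicular arcs, and the radius alone already determines it. The conclusion
  keeps general curves for the application to \<open>f\<close>.\<close>

lemma inner_radius_ratio_tendsto:
  fixes F :: "real filter" and \<gamma> :: "real \<Rightarrow> complex"
  assumes E: "closedin (top_of_set (ball 0 1)) E" and far: "d > 0" "\<forall>w\<in>E. d \<le> dist w 1"
    and \<gamma>: "(\<gamma> \<longlongrightarrow> 1) F" "\<forall>\<^sub>F t in F. \<gamma> t \<in> ball 0 1" "((\<lambda>t. sgn (\<gamma> t - 1)) \<longlongrightarrow> - 1) F"
  shows "((\<lambda>t. (inner_radius (ball 0 1 - E) (\<gamma> t) / inner_radius (ball 0 1) (\<gamma> t) - 1) / (cmod (\<gamma> t - 1))\<^sup>2)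
     \<longlongrightarrow> - 2 * relcap E) F"
proof -
  let ?\<rho> = "\<lambda>z. inner_radius (ball 0 1 - E) z / inner_radius (ball 0 1) z"
  have "openin (top_of_set (ball 0 1)) (ball 0 1 - E)" using E by (simp add: closedin_def)
  then have G: "open (ball 0 1 - E)" using openin_open_eq[OF open_ball] by blast
  have lens: "ball 0 1 \<inter> ball 1 d \<subseteq> ball 0 1 - E"
    using far(2) by (auto simp: dist_commute not_less[symmetric])
  from inner_radius_ratio_expansion[OF G Diff_subset far(1) lens] obtain c where
    c: "\<And>(F::real filter) \<gamma>. (\<gamma> \<longlongrightarrow> 1) F \<Longrightarrow> \<forall>\<^sub>F t in F. \<gamma> t \<in> ball 0 1 \<Longrightarrow> ((\<lambda>t. sgn (\<gamma> t - 1)) \<longlongrightarrow> - 1) F \<Longrightarrow>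
     ((\<lambda>t. (?\<rho> (\<gamma> t) - 1) / (cmod (\<gamma> t - 1))\<^sup>2) \<longlongrightarrow> - 2 * c) F" by blast
  have arcD: "(\<gamma> \<longlongrightarrow> 1) (at_left 1) \<and> (\<forall>\<^sub>F t in at_left 1. \<gamma> t \<in> ball 0 1) \<and> ((\<lambda>t. sgn (\<gamma> t - 1)) \<longlongrightarrow> - 1) (at_left 1)"
    if \<gamma>: "perpendicular_arc \<gamma>" for \<gamma>
  proof -
    have ev: "\<forall>\<^sub>F t in at_left 1. t \<in> {0<..<1::real}" by (rule eventually_at_left_real) simp
    have cont: "continuous_on {0..1} \<gamma>" and one: "\<gamma> 1 = 1"
      using \<gamma> by (auto simp: perpendicular_arc_def arc_def path_def pathfinish_def)
    have "(\<gamma> \<longlongrightarrow> \<gamma> 1) (at 1 within {0..1})" using cont by (simp add: continuous_on_def)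
    then have "(\<gamma> \<longlongrightarrow> 1) (at 1 within {0..1})" by (simp add: one)
    then have "(\<gamma> \<longlongrightarrow> 1) (at_left 1)" by (simp add: at_within_Icc_at_left)
    moreover have "\<forall>\<^sub>F t in at_left 1. \<gamma> t \<in> ball 0 1"
      using ev by eventually_elim (use \<gamma> in \<open>auto simp: perpendicular_arc_def image_subset_iff\<close>)
    ultimately show ?thesis using \<gamma> by (simp add: perpendicular_arc_def)
  qed
  have remainder: "(?\<rho> z - (1 - 2 * c' * (cmod (z - 1))\<^sup>2)) / (cmod (z - 1))\<^sup>2 = (?\<rho> z - 1) / (cmod (z - 1))\<^sup>2 + 2 * c'"
    if "z \<in> ball 0 1" for z c'
  proof -
    have "z \<noteq> 1" using that by auto
    then show ?thesis by (simp add: field_simps)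
  qed
  have "relcap E = c" unfolding relcap_def
  proof (rule the_equality, intro allI impI)
    fix \<gamma> assume "perpendicular_arc \<gamma>"
    from arcD[OF this] have \<gamma>: "(\<gamma> \<longlongrightarrow> 1) (at_left 1)" "\<forall>\<^sub>F t in at_left 1. \<gamma> t \<in> ball 0 1" 
      "((\<lambda>t. sgn (\<gamma> t - 1)) \<longlongrightarrow> - 1) (at_left 1)" by auto
    show "(\<lambda>t. ?\<rho> (\<gamma> t) - (1 - 2 * c * (cmod (\<gamma> t - 1))\<^sup>2)) \<in> o[at_left 1](\<lambda>t. (cmod (\<gamma> t - 1))\<^sup>2)"
    proof (rule smalloI_tendsto)
      have "((\<lambda>t. (?\<rho> (\<gamma> t) - 1) / (cmod (\<gamma> t - 1))\<^sup>2 + 2 * c) \<longlongrightarrow> - 2 * c + 2 * c) (at_left 1)"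
        by (intro tendsto_intros c \<gamma>)
      moreover have "\<forall>\<^sub>F t in at_left 1. (?\<rho> (\<gamma> t) - 1) / (cmod (\<gamma> t - 1))\<^sup>2 + 2 * c = 
         (?\<rho> (\<gamma> t) - (1 - 2 * c * (cmod (\<gamma> t - 1))\<^sup>2)) / (cmod (\<gamma> t - 1))\<^sup>2"
        using \<gamma>(2) by eventually_elim (rule remainder[symmetric])
      ultimately show "((\<lambda>t. (?\<rho> (\<gamma> t) - (1 - 2 * c * (cmod (\<gamma> t - 1))\<^sup>2)) / (cmod (\<gamma> t - 1))\<^sup>2) \<longlongrightarrow> 0) (at_left 1)"
        using Lim_transform_eventually by fastforce
      show "\<forall>\<^sub>F t in at_left 1. (cmod (\<gamma> t - 1))\<^sup>2 \<noteq> 0" using \<gamma>(2) by eventually_elim auto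
    qed
  next
    fix c' assume c': "\<forall>\<gamma>. perpendicular_arc \<gamma> \<longrightarrow> 
      (\<lambda>t. ?\<rho> (\<gamma> t) - (1 - 2 * c' * (cmod (\<gamma> t - 1))\<^sup>2)) \<in> o[at_left 1](\<lambda>t. (cmod (\<gamma> t - 1))\<^sup>2)"
    define \<gamma> :: "real \<Rightarrow> complex" where "\<gamma> = linepath 0 1"
    have arc: "perpendicular_arc \<gamma>" unfolding \<gamma>_def by (rule perpendicular_arc_radius)
    from arcD[OF this] have \<gamma>: "(\<gamma> \<longlongrightarrow> 1) (at_left 1)" "\<forall>\<^sub>F t in at_left 1. \<gamma> t \<in> ball 0 1" 
      "((\<lambda>t. sgn (\<gamma> t - 1)) \<longlongrightarrow> - 1) (at_left 1)" by auto
    have "((\<lambda>t. (?\<rho> (\<gamma> t) - (1 - 2 * c' * (cmod (\<gamma> t - 1))\<^sup>2)) / (cmod (\<gamma> t - 1))\<^sup>2) \<longlongrightarrow> 0) (at_left 1)"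
      using c' arc by (intro smalloD_tendsto) blast
    moreover have "\<forall>\<^sub>F t in at_left 1. (?\<rho> (\<gamma> t) - (1 - 2 * c' * (cmod (\<gamma> t - 1))\<^sup>2)) / (cmod (\<gamma> t - 1))\<^sup>2
        = (?\<rho> (\<gamma> t) - 1) / (cmod (\<gamma> t - 1))\<^sup>2 + 2 * c'"
      using \<gamma>(2) by eventually_elim (rule remainder)
    ultimately have "((\<lambda>t. (?\<rho> (\<gamma> t) - 1) / (cmod (\<gamma> t - 1))\<^sup>2 + 2 * c') \<longlongrightarrow> 0) (at_left 1)"
      by (rule Lim_transform_eventually)
    moreover have "((\<lambda>t. (?\<rho> (\<gamma> t) - 1) / (cmod (\<gamma> t - 1))\<^sup>2 + 2 * c') \<longlongrightarrow> - 2 * c + 2 * c') (at_left 1)"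
      by (intro tendsto_intros c \<gamma>)
    ultimately have "- 2 * c + 2 * c' = 0" using tendsto_unique[OF trivial_limit_at_left_real] by blast
    then show "c' = c" by simp
  qed
  with c[OF \<gamma>] show ?thesis by simp
qed

theorem theorem4p1:
  fixes f :: "complex \<Rightarrow> complex" and a1 :: real and a2 a3 :: complex and E :: "complex set"
  assumes "class_B f a1 a2 a3"
    and "closedin (top_of_set (ball 0 1)) E"
    and "E \<subseteq> ball 0 1 - f ` ball 0 1"
    and "\<exists>d>0. \<forall>w\<in>E. d \<le> dist w 1"
  shows "- (1 / 6) * Re (boundary_schwarzian a1 a2 a3) \<ge> a1\<^sup>2 * relcap E \<and>
         (inj_on f (ball 0 1) \<and> f ` ball 0 1 = ball 0 1 - E \<longrightarrow>
            - (1 / 6) * Re (boundary_schwarzian a1 a2 a3) = a1\<^sup>2 * relcap E)"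
proof -
  let ?G = "ball 0 1 - E"
  let ?S = "Re (a3 / a1 - a2\<^sup>2 / (complex_of_real a1)\<^sup>2)"
  have f: "f holomorphic_on ball 0 1" "f ` ball 0 1 \<subseteq> ball 0 1" using assms(1) by (auto simp: class_B_def)
  have "openin (top_of_set (ball 0 1)) ?G" using assms(2) by (simp add: closedin_def)
  then have G: "open ?G" "bounded ?G" using openin_open_eq[OF open_ball] by (auto intro: bounded_diff)
  have fG: "f ` ball 0 1 \<subseteq> ?G" using f(2) assms(3) by blast
  obtain d where d: "d > 0" "\<forall>w\<in>E. d \<le> dist w 1" using assms(4) by blast
  define \<gamma> where "\<gamma> x = f (of_real x)" for x :: real
  define Q where "Q x = cmod (deriv f (of_real x)) * (1 - x\<^sup>2) / (1 - (cmod (\<gamma> x))\<^sup>2)" for x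
  define \<rho> where "\<rho> x = inner_radius ?G (\<gamma> x) / inner_radius (ball 0 1) (\<gamma> x)" for x
  have x01: "\<forall>\<^sub>F x in at_left 1. 0 < x \<and> x < (1::real)"
    using eventually_at_left_real[of 0 1] by simp
  note dist = class_B_hyperbolic_distortion[OF assms(1), folded \<gamma>_def, folded Q_def]
  have in_ball: "complex_of_real x \<in> ball 0 1 \<and> \<gamma> x \<in> ball 0 1" if "0 < x \<and> x < 1" for x
  proof -
    have "complex_of_real x \<in> ball 0 1" using that by simp
    then show ?thesis using f(2) unfolding \<gamma>_def by blast
  qed
  have "\<forall>\<^sub>F x in at_left 1. \<gamma> x \<in> ball 0 1" using x01 by eventually_elim (use in_ball in blast)
  from inner_radius_ratio_tendsto[OF assms(2) d dist(4) this dist(3)]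
  have \<rho>: "((\<lambda>x. (\<rho> x - 1) / (cmod (\<gamma> x - 1))\<^sup>2) \<longlongrightarrow> - 2 * relcap E) (at_left 1)" unfolding \<rho>_def .
  have "((\<lambda>x. 1 + (\<rho> x - 1) / (cmod (\<gamma> x - 1))\<^sup>2 * (cmod (\<gamma> x - 1))\<^sup>2) \<longlongrightarrow> 1 + - 2 * relcap E * (cmod (1 - 1))\<^sup>2) (at_left 1)"
    by (intro tendsto_intros \<rho> dist(4))
  moreover have "\<forall>\<^sub>F x in at_left 1. 1 + (\<rho> x - 1) / (cmod (\<gamma> x - 1))\<^sup>2 * (cmod (\<gamma> x - 1))\<^sup>2 = \<rho> x"
    using x01
  proof eventually_elim
    case (elim x)
    then have "\<gamma> x \<noteq> 1" using in_ball[of x] by auto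
    then show ?case by simp
  qed
  ultimately have \<rho>1: "(\<rho> \<longlongrightarrow> 1) (at_left 1)" using Lim_transform_eventually by fastforce
  \<comment> \<open>Factoring \<open>(\<rho> x)\<^sup>2 - 1\<close> matches the squared distortion;
    passing from \<open>cmod (\<gamma> x - 1)\<close> to \<open>1 - x\<close> produces the factor
    \<open>a1\<^sup>2\<close>.\<close>
  have "((\<lambda>x. (\<rho> x - 1) / (cmod (\<gamma> x - 1))\<^sup>2 * (\<rho> x + 1) * (cmod (\<gamma> x - 1) / (1 - x))\<^sup>2) \<longlongrightarrow>
     - 2 * relcap E * (1 + 1) * a1\<^sup>2) (at_left 1)"
    by (intro tendsto_intros \<rho> \<rho>1 dist(2))
  moreover have "\<forall>\<^sub>F x in at_left 1. (\<rho> x - 1) / (cmod (\<gamma> x - 1))\<^sup>2 * (\<rho> x + 1) * (cmod (\<gamma> x - 1) / (1 - x))\<^sup>2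
      = ((\<rho> x)\<^sup>2 - 1) / (x - 1)\<^sup>2"
    using x01
  proof eventually_elim
    case (elim x)
    then have "\<gamma> x \<noteq> 1" using in_ball[of x] by auto
    moreover have "(\<rho> x)\<^sup>2 - 1 = (\<rho> x - 1) * (\<rho> x + 1)" by (simp add: power2_eq_square algebra_simps)
    moreover have "(1 - x)\<^sup>2 = (x - 1)\<^sup>2" by (rule power2_commute)
    ultimately show ?case by (simp add: power_divide)
  qed
  ultimately have \<rho>2: "((\<lambda>x. ((\<rho> x)\<^sup>2 - 1) / (x - 1)\<^sup>2) \<longlongrightarrow> - 4 * (a1\<^sup>2 * relcap E)) (at_left 1)"
    using Lim_transform_eventually by (fastforce simp: mult.commute mult.left_commute)
  have radius: "inner_radius (ball 0 1) (\<gamma> x) = 1 - (cmod (\<gamma> x))\<^sup>2" "1 - (cmod (\<gamma> x))\<^sup>2 > 0" "(cmod (of_real x))\<^sup>2 = x\<^sup>2"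
    if "0 < x \<and> x < 1" for x
    using in_ball[OF that] inner_radius_unit_disc by (auto simp: power_less_one_iff)
  have Q\<rho>: "0 \<le> Q x \<and> Q x \<le> \<rho> x" if x: "0 < x \<and> x < 1" for x
  proof -
    have "cmod (deriv f (of_real x)) * (1 - (cmod (of_real x))\<^sup>2) \<le> inner_radius ?G (f (of_real x))"
      using inner_radius_holomorphic_image_ge[OF G f(1) fG] in_ball[OF x] by blast
    then have "Q x \<le> \<rho> x" unfolding Q_def \<rho>_def radius(1)[OF x] radius(3)[OF x] \<gamma>_def[symmetric]
      using radius(2)[OF x] by (intro divide_right_mono) auto
    moreover have "0 \<le> Q x" unfolding Q_def using radius(2)[OF x] x
      by (intro divide_nonneg_nonneg mult_nonneg_nonneg) (auto simp: power_le_one)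
    ultimately show ?thesis by blast
  qed
  \<comment> \<open>\<open>Q x \<le> \<rho> x\<close> passes to the second-order quotients of the
    squares, whose limits are the two sides. In the conformal case below \<open>Q\<close> and
    \<open>\<rho>\<close> coincide.\<close>
  have "4 * ?S \<le> - 4 * (a1\<^sup>2 * relcap E)"
  proof (rule tendsto_le[OF trivial_limit_at_left_real \<rho>2 dist(1)])
    show "\<forall>\<^sub>F x in at_left 1. ((Q x)\<^sup>2 - 1) / (x - 1)\<^sup>2 \<le> ((\<rho> x)\<^sup>2 - 1) / (x - 1)\<^sup>2"
      using x01 by eventually_elim (use Q\<rho> in \<open>auto intro!: divide_right_mono diff_right_mono power_mono\<close>)
  qed
  moreover have "4 * ?S = - 4 * (a1\<^sup>2 * relcap E)" if conf: "inj_on f (ball 0 1)" "f ` ball 0 1 = ?G"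
  proof (rule tendsto_unique[OF trivial_limit_at_left_real dist(1)])
    have "\<forall>\<^sub>F x in at_left 1. ((\<rho> x)\<^sup>2 - 1) / (x - 1)\<^sup>2 = ((Q x)\<^sup>2 - 1) / (x - 1)\<^sup>2"
      using x01
    proof eventually_elim
      case (elim x)
      have "bounded (f ` ball 0 1)" using G(2) conf(2) by simp
      from inner_radius_conformal_image_le[OF this f(1) conf(1)] in_ball[OF elim]
      have "inner_radius ?G (f (of_real x)) \<le> cmod (deriv f (of_real x)) * (1 - (cmod (of_real x))\<^sup>2)"
        unfolding conf(2) by blast
      then have "\<rho> x \<le> Q x" unfolding Q_def \<rho>_def radius(1)[OF elim] radius(3)[OF elim] \<gamma>_def[symmetric]
        using radius(2)[OF elim] by (intro divide_right_mono) auto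
      then show ?case using Q\<rho>[OF elim] by simp
    qed
    with \<rho>2 show "((\<lambda>x. ((Q x)\<^sup>2 - 1) / (x - 1)\<^sup>2) \<longlongrightarrow> - 4 * (a1\<^sup>2 * relcap E)) (at_left 1)"
      by (rule Lim_transform_eventually)
  qed
  moreover have "- (1 / 6) * Re (boundary_schwarzian a1 a2 a3) = - ?S"
  proof -
    have "Re (6 * w) = 6 * Re w" for w by simp
    then show ?thesis unfolding boundary_schwarzian_def by (simp only:)
  qed
  ultimately show ?thesis by auto
qed

end
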